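(* Let $a,b,c:\mathbb R\to\mathbb R$ be smooth functions satisfying hypothesis (H), $m$ a smooth compactly supported symbol on $\mathbb R^2$, and $\phi(\xi,\eta)=-a(\xi+\eta)+b(\xi)+c(\eta)$. Assume that $(\partial_\xi-\partial_\eta)\phi$ never vanishes on $\operatorname{Supp}m$ (no space resonances). Let $q\in[2,\infty]$. Then for any $\delta>0$ the solution $u$ of the system in the context satisfies: (1) if $0\le s<\frac1q$, $\|u(t)\|_{L^q}\lesssim t^{\frac1{2q}+\frac12-\frac32s+\delta}\|f\|_{L^{2,s}}\|g\|_{L^{2,s}}$; (2) if $\frac1q<s<1-\frac1q$, $\|u(t)\|_{L^q}\lesssim t^{\frac12-s+\delta}\|f\|_{L^{2,s}}\|g\|_{L^{2,s}}$; (3) if $s>1-\frac1q$, $\|u(t)\|_{L^q}\lesssim t^{\frac1q-\frac12+\delta}\|f\|_{L^{2,s}}\|g\|_{L^{2,s}}$.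
   Context: Hypothesis (H): the second derivatives $a'',b'',c''$ are bounded away from zero. $T_m(f,g)(x)=\int_{\mathbb R^2}e^{ix(\xi+\eta)}\widehat f(\xi)\widehat g(\eta)m(\xi,\eta)\,d\xi\,d\eta$; $e^{ita(D)}$ is the Fourier multiplier with symbol $e^{ita(\xi)}$. $u$ solves $i\partial_tu+a(D)u=T_m(v,w)$, $i\partial_tv+b(D)v=0$, $i\partial_tw+c(D)w=0$ with $u(0)=0$, $v(0)=f$, $w(0)=g$. $\|f\|_{L^{2,s}}=\|\langle x\rangle^sf\|_{L^2}$, $\langle x\rangle=\sqrt{1+x^2}$. Implicit constants may depend on $\delta$.
   Formalization: The estimates are stated for times t ≥ 1: as t → 0 the solution is of size t, so for large δ the bounds with t to the stated power would fail for small t. *)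

theory Defs
  imports "HOL-Analysis.Analysis"
begin

definition smooth_fun :: "(real \<Rightarrow> real) \<Rightarrow> bool" where
  "smooth_fun f \<longleftrightarrow> (\<forall>k x. (deriv ^^ k) f differentiable (at x))"

definition hyp_H :: "(real \<Rightarrow> real) \<Rightarrow> bool" where
  "hyp_H f \<longleftrightarrow> (\<exists>\<kappa>>0. \<forall>x. \<kappa> \<le> \<bar>deriv (deriv f) x\<bar>)"

definition smooth_symbol :: "(real \<times> real \<Rightarrow> complex) \<Rightarrow> bool" where
  "smooth_symbol m \<longleftrightarrow> (\<exists>D :: nat \<Rightarrow> nat \<Rightarrow> real \<times> real \<Rightarrow> complex.
      D 0 0 = m \<and> (\<forall>j k. continuous_on UNIV (D j k)) \<and>
      (\<forall>j k x y. ((\<lambda>x'. D j k (x', y)) has_vector_derivative D (Suc j) k (x, y)) (at x) \<and>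
                 ((\<lambda>y'. D j k (x, y')) has_vector_derivative D j (Suc k) (x, y)) (at y)))"

definition supp :: "(real \<times> real \<Rightarrow> complex) \<Rightarrow> (real \<times> real) set" where
  "supp m = closure {p. m p \<noteq> 0}"

definition phase :: "(real \<Rightarrow> real) \<Rightarrow> (real \<Rightarrow> real) \<Rightarrow> (real \<Rightarrow> real) \<Rightarrow> real \<times> real \<Rightarrow> real" where
  "phase a b c = (\<lambda>(\<xi>, \<eta>). - a (\<xi> + \<eta>) + b \<xi> + c \<eta>)"

definition fourier_trunc :: "(real \<Rightarrow> complex) \<Rightarrow> real \<Rightarrow> real \<Rightarrow> complex" where
  "fourier_trunc f R \<xi> = (LINT x:{-R..R}|lborel. cis (- x * \<xi>) * f x)"

(* L^2 Fourier transform: the L^2 limit of the truncated Fourier integrals (Plancherel) *)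
definition fourier :: "(real \<Rightarrow> complex) \<Rightarrow> real \<Rightarrow> complex" where
  "fourier f = (SOME F. F \<in> borel_measurable lborel \<and>
     ((\<lambda>R. \<integral>\<^sup>+ \<xi>. ennreal ((cmod (F \<xi> - fourier_trunc f R \<xi>))\<^sup>2) \<partial>lborel) \<longlongrightarrow> 0) at_top)"

(* solution u of  i u_t + a(D) u = T_m(v,w), u(0)=0, with v, w free solutions with data f, g,
   written via Duhamel's formula  u(t) = -i int_0^t e^{i(t-tau)a(D)} T_m(v(tau),w(tau)) dtau,
   all operators expressed on the Fourier side *)
definition sol :: "(real \<Rightarrow> real) \<Rightarrow> (real \<Rightarrow> real) \<Rightarrow> (real \<Rightarrow> real) \<Rightarrow> (real \<times> real \<Rightarrow> complex) \<Rightarrow>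
    (real \<Rightarrow> complex) \<Rightarrow> (real \<Rightarrow> complex) \<Rightarrow> real \<Rightarrow> real \<Rightarrow> complex" where
  "sol a b c m f g t x = - \<i> * (LINT \<tau>:{0..t}|lborel. LINT p|lborel. (case p of (\<xi>, \<eta>) \<Rightarrow>
      cis (x * (\<xi> + \<eta>)) * cis ((t - \<tau>) * a (\<xi> + \<eta>)) *
      cis (\<tau> * b \<xi>) * fourier f \<xi> * cis (\<tau> * c \<eta>) * fourier g \<eta> * m (\<xi>, \<eta>)))"

definition wnorm :: "real \<Rightarrow> (real \<Rightarrow> complex) \<Rightarrow> real" where
  "wnorm s f = sqrt (LINT x|lborel. (1 + x\<^sup>2) powr s * (cmod (f x))\<^sup>2)"

definition in_L2s :: "real \<Rightarrow> (real \<Rightarrow> complex) \<Rightarrow> bool" where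
  "in_L2s s f \<longleftrightarrow> f \<in> borel_measurable lborel \<and>
     integrable lborel (\<lambda>x. (1 + x\<^sup>2) powr s * (cmod (f x))\<^sup>2)"

definition Lq_norm :: "ereal \<Rightarrow> (real \<Rightarrow> complex) \<Rightarrow> ennreal" where
  "Lq_norm q h = (if q = \<infinity> then Inf {C. AE x in lborel. ennreal (cmod (h x)) \<le> C}
     else if h \<in> borel_measurable lborel \<and> integrable lborel (\<lambda>x. cmod (h x) powr real_of_ereal q)
     then ennreal ((LINT x|lborel. cmod (h x) powr real_of_ereal q) powr (1 / real_of_ereal q))
     else \<infinity>)"

definition qinv :: "ereal \<Rightarrow> real" where
  "qinv q = (if q = \<infinity> then 0 else 1 / real_of_ereal q)"

end

(* The solution is a superposition over time of the interactions of the two free waves. Three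
   mechanisms bound it.
   (i) Dispersion: by TT* and |a''| >= kappa, the contribution of an interaction time tau is
   O((t - tau)^(-1/2+)) in sup norm.
   (ii) Absence of space resonances: at fixed output frequency zeta = xi + eta the tau-phase has
   xi-derivative b'(xi) - c'(eta), bounded away from zero on the support of m, so TT* in (xi, tau)
   bounds the L^2 norm of the interactions up to time T by O(T^(1/2)) rather than O(T).
   (iii) Separation of the wave packets: if f and g are supported in |x| <= R, repeated integration
   by parts makes all interaction times tau >> R negligible.
   Cut f and g into finitely many annuli |x| ~ t^(j/K). A pair of annuli of radius at most R
   interacts only up to time about R; interpolating (i) and (ii) gives R^(1-1/q) t^(1/q-1/2+),
   against a gain R^(-s) from the weights. Optimising over 1 <= R <= t yields the exponent
   max(1/2 - s, 1/q - 1/2), which is at most the claimed exponent in each of the three cases. *)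

theory Submission
  imports Defs "HOL-Probability.Characteristic_Functions" "HOL-Probability.Sinc_Integral"
begin

section \<open>Square function bounds and the Fourier transform\<close>

text \<open>The factor t^delta pays for two losses. The kernel behind the dispersive estimate decays
  only like 1/(s |z|), and its integral over a bounded interval carries a logarithm; lowering the
  exponent from 1 to \<open>\<theta>\<close> < 1 avoids it. And consecutive radii differ by a factor
  t^(1/K). The radii are powers of t and not of 2, so that the number of pairs is (K+1)^2 for every
  t and a crude triangle inequality suffices. The innermost ball has radius t^(1/K) and not 1, so R
  >= t^(1/K) for every pair, and a fixed number 2K + 1 of integrations by parts makes late times
  negligible. Mechanisms (ii) and (iii) act at a fixed output frequency; hence the solution is
  rewritten as the inverse transform of \<open>fiber\<close>. There the factor with a(zeta) is
  constant in xi, and the oscillation comes from b and c alone. An obstacle is that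
  \<open>fourier\<close> is merely some L^2 limit, about which nothing is known pointwise. The
  pieces of f and g in bounded annuli have transforms given by convergent integrals, which
  integration by parts can use. The outermost piece is controlled in L^2 only, which is enough
  because R >= t there.\<close>

lemma borel_measurable_cnj_compose [measurable (raw)]:
  "f \<in> borel_measurable M \<Longrightarrow> (\<lambda>x. cnj (f x)) \<in> borel_measurable M"
  by (rule borel_measurable_continuous_on[OF continuous_on_cnj[OF continuous_on_id]])

lemma borel_measurable_cis_compose [measurable (raw)]:
  "f \<in> borel_measurable M \<Longrightarrow> (\<lambda>x. cis (f x)) \<in> borel_measurable M"
  by (rule borel_measurable_continuous_on[OF continuous_on_cis[OF continuous_on_id]])

lemma integrable_pairI:
  fixes f :: "'a::euclidean_space \<times> 'b::euclidean_space \<Rightarrow> 'c::{banach, second_countable_topology}"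
  assumes [measurable]: "f \<in> borel_measurable (lborel \<Otimes>\<^sub>M lborel)"
    and fin: "(\<integral>\<^sup>+ x. \<integral>\<^sup>+ y. ennreal (norm (f (x, y))) \<partial>lborel \<partial>lborel) < \<infinity>"
  shows "integrable (lborel \<Otimes>\<^sub>M lborel) f"
proof (rule integrableI_bounded)
  have "(\<integral>\<^sup>+ x. \<integral>\<^sup>+ y. ennreal (norm (f (x, y))) \<partial>lborel \<partial>lborel)
      = (\<integral>\<^sup>+ p. ennreal (norm (f p)) \<partial>(lborel \<Otimes>\<^sub>M lborel))"
    by (rule lborel.nn_integral_fst) measurable
  then show "(\<integral>\<^sup>+ p. ennreal (norm (f p)) \<partial>(lborel \<Otimes>\<^sub>M lborel)) < \<infinity>"
    using fin by simp
qed measurable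

lemma integrable_pair_mult:
  fixes u :: "'a::euclidean_space \<Rightarrow> 'c::{real_normed_field, banach, second_countable_topology}"
    and v :: "'b::euclidean_space \<Rightarrow> 'c"
  assumes u: "integrable lborel u" and v: "integrable lborel v"
  shows "integrable (lborel \<Otimes>\<^sub>M lborel) (\<lambda>(x, y). u x * v y)"
proof (rule integrable_pairI)
  have [measurable]: "u \<in> borel_measurable lborel" "v \<in> borel_measurable lborel"
    using u v by auto
  show "(\<lambda>(x, y). u x * v y) \<in> borel_measurable (lborel \<Otimes>\<^sub>M lborel)"
    by measurable
  have "(\<integral>\<^sup>+ x. \<integral>\<^sup>+ y. ennreal (norm (case (x, y) of (x, y) \<Rightarrow> u x * v y)) \<partial>lborel \<partial>lborel)
     = (\<integral>\<^sup>+ x. ennreal (norm (u x)) \<partial>lborel) * (\<integral>\<^sup>+ y. ennreal (norm (v y)) \<partial>lborel)"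
    by (simp add: norm_mult ennreal_mult' nn_integral_cmult nn_integral_multc)
  also have "\<dots> < \<infinity>"
    using u v by (simp add: integrable_iff_bounded ennreal_mult_less_top)
  finally show "(\<integral>\<^sup>+ x. \<integral>\<^sup>+ y. ennreal (norm (case (x, y) of (x, y) \<Rightarrow> u x * v y)) \<partial>lborel \<partial>lborel) < \<infinity>" .
qed

lemma nn_integral_lborel_diff:
  fixes k :: "real \<Rightarrow> ennreal"
  assumes [measurable]: "k \<in> borel_measurable borel"
  shows "(\<integral>\<^sup>+ y. k (x - y) \<partial>lborel) = (\<integral>\<^sup>+ y. k y \<partial>lborel)"
    and "(\<integral>\<^sup>+ y. k (y - x) \<partial>lborel) = (\<integral>\<^sup>+ y. k y \<partial>lborel)"
  using nn_integral_real_affine[of k "-1" x] nn_integral_real_affine[of k 1 "-x"] by auto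

text \<open>Expanding the square as a double integral reduces the bound to Schur's test for the kernel of
  $T^*T$, which is dominated by a convolution kernel.\<close>

lemma TTstar_bound:
  fixes Th :: "real \<Rightarrow> real \<Rightarrow> complex" and h :: "real \<Rightarrow> complex"
  assumes Th[measurable]: "(\<lambda>(w, x). Th w x) \<in> borel_measurable (lborel \<Otimes>\<^sub>M lborel)"
    and bd: "\<And>w x. cmod (Th w x) \<le> \<theta> w"
    and \<theta>: "integrable lborel (\<lambda>w. (\<theta> w)\<^sup>2)"
    and h: "integrable lborel h"
    and K: "\<And>x y. cmod (LINT w|lborel. Th w x * cnj (Th w y)) \<le> k (x - y)"
    and k[measurable]: "k \<in> borel_measurable borel"
    and S: "(\<integral>\<^sup>+ y. ennreal (k y) \<partial>lborel) \<le> ennreal S"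
  shows "(\<integral>\<^sup>+ w. ennreal ((cmod (LINT x|lborel. Th w x * h x))\<^sup>2) \<partial>lborel)
    \<le> ennreal S * (\<integral>\<^sup>+ x. ennreal ((cmod (h x))\<^sup>2) \<partial>lborel)"
proof -
  have [measurable]: "h \<in> borel_measurable borel" using h by auto
  define I where "I w = (LINT x|lborel. Th w x * h x)" for w
  define N where "N = (\<integral>\<^sup>+ x. ennreal ((cmod (h x))\<^sup>2) \<partial>lborel)"
  define G where "G = (\<lambda>(w, x, y). Th w x * cnj (Th w y) * h x * cnj (h y))"
  have k0: "0 \<le> k z" for z
    using order_trans[OF norm_ge_zero K[of z 0]] by simp
  have \<theta>0: "0 \<le> \<theta> w" for w
    using order_trans[OF norm_ge_zero bd[of w 0]] .
  have [measurable]: "G \<in> borel_measurable (lborel \<Otimes>\<^sub>M (lborel \<Otimes>\<^sub>M lborel))"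
    unfolding G_def by measurable
  have hh: "integrable (lborel \<Otimes>\<^sub>M lborel) (\<lambda>(x, y). cmod (h x) * cmod (h y))"
    using h by (intro integrable_pair_mult) auto
  then have "integrable (lborel::(real\<times>real) measure) (\<lambda>(x, y). cmod (h x) * cmod (h y))"
    by (simp add: lborel_prod)
  \<comment> \<open>The bound by \<open>\<theta>\<close> and the integrability of \<open>h\<close>
    are qualitative: they dominate the triple integrand so that Fubini applies, and neither enters
    the final constant.\<close>
  from integrable_pair_mult[OF \<theta> this]
  have dom: "integrable (lborel \<Otimes>\<^sub>M (lborel \<Otimes>\<^sub>M lborel)) (\<lambda>(w, p). (\<theta> w)\<^sup>2 * (case p of (x, y) \<Rightarrow> cmod (h x) * cmod (h y)))"
    by (simp add: lborel_prod)
  have intG: "integrable (lborel \<Otimes>\<^sub>M (lborel \<Otimes>\<^sub>M lborel)) G"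
  proof (rule Bochner_Integration.integrable_bound[OF dom])
    show "AE z in lborel \<Otimes>\<^sub>M (lborel \<Otimes>\<^sub>M lborel). norm (G z) \<le>
        norm (case z of (w, p) \<Rightarrow> (\<theta> w)\<^sup>2 * (case p of (x, y) \<Rightarrow> cmod (h x) * cmod (h y)))"
    proof (rule AE_I2, clarify)
      fix w x y
      have "cmod (Th w x) * cmod (Th w y) \<le> \<theta> w * \<theta> w"
        using bd \<theta>0 by (intro mult_mono) auto
      then have "cmod (Th w x) * cmod (Th w y) * (cmod (h x) * cmod (h y)) \<le> \<theta> w * \<theta> w * (cmod (h x) * cmod (h y))"
        by (intro mult_right_mono) auto
      then show "norm (G (w, x, y)) \<le> norm ((\<theta> w)\<^sup>2 * (cmod (h x) * cmod (h y)))"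
        by (simp add: G_def norm_mult power2_eq_square abs_mult \<theta>0 mult_ac)
    qed
  qed measurable
  have intTh: "integrable lborel (\<lambda>x. Th w x * h x)" for w
  proof (rule Bochner_Integration.integrable_bound)
    show "integrable lborel (\<lambda>x. complex_of_real (\<theta> w) * h x)" using h by simp
    show "AE x in lborel. norm (Th w x * h x) \<le> norm (complex_of_real (\<theta> w) * h x)"
      using bd \<theta>0 by (auto simp: norm_mult intro!: mult_right_mono)
  qed measurable
  have inner: "(LINT p|(lborel \<Otimes>\<^sub>M lborel). G (w, p)) = of_real ((cmod (I w))\<^sup>2)" for w
  proof -
    have "integrable (lborel \<Otimes>\<^sub>M lborel) (\<lambda>(x, y). (Th w x * h x) * cnj (Th w y * h y))"
      using intTh[of w] by (intro integrable_pair_mult) (auto simp del: complex_cnj_mult)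
    moreover have eq: "(\<lambda>p. G (w, p)) = (\<lambda>(x, y). (Th w x * h x) * cnj (Th w y * h y))"
      by (auto simp: G_def fun_eq_iff mult_ac)
    ultimately have "integrable (lborel \<Otimes>\<^sub>M lborel) (\<lambda>p. G (w, p))"
      by simp
    from lborel_pair.integral_fst'[OF this]
    have "(LINT x|lborel. LINT y|lborel. (Th w x * h x) * cnj (Th w y * h y))
       = (LINT p|(lborel \<Otimes>\<^sub>M lborel). G (w, p))"
      by (simp add: G_def mult_ac)
    moreover have "(LINT x|lborel. LINT y|lborel. (Th w x * h x) * cnj (Th w y * h y)) = I w * cnj (I w)"
      unfolding I_def using intTh[of w] by (simp del: complex_cnj_mult)
    ultimately show ?thesis by (simp only: complex_norm_square)
  qed
  have intG': "integrable (lborel \<Otimes>\<^sub>M (lborel::(real\<times>real) measure)) (\<lambda>(w, p). G (w, p))"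
    using intG by (simp add: lborel_prod)
  have inner': "(LINT p|lborel. G (w, p)) = of_real ((cmod (I w))\<^sup>2)" for w
    using inner[of w] by (simp add: lborel_prod)
  have intI: "integrable lborel (\<lambda>w. complex_of_real ((cmod (I w))\<^sup>2))"
    using lborel_pair.integrable_fst[OF intG'] unfolding inner' .
  then have intI': "integrable lborel (\<lambda>w. (cmod (I w))\<^sup>2)"
    using complex_of_real_integrable_eq by blast
  define L where "L = (LINT w|lborel. (cmod (I w))\<^sup>2)"
  have "complex_of_real L = (LINT w|lborel. of_real ((cmod (I w))\<^sup>2))"
    unfolding L_def using intI' by (rule integral_of_real[symmetric])
  also have "\<dots> = (LINT w|lborel. LINT p|lborel. G (w, p))" unfolding inner' ..
  also have "\<dots> = (LINT p|lborel. LINT w|lborel. G (w, p))"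
    using lborel_pair.Fubini_integral[OF intG'] by simp
  finally have LE: "complex_of_real L = (LINT p|lborel. LINT w|lborel. G (w, p))" .
  have Gw: "(LINT w|lborel. G (w, x, y)) = (LINT w|lborel. Th w x * cnj (Th w y)) * (h x * cnj (h y))" for x y
    unfolding G_def prod.case by (subst integral_mult_left_zero[symmetric]) (simp only: mult.assoc)
  have "ennreal L = ennreal (norm (complex_of_real L))"
    unfolding L_def by simp
  also have "\<dots> \<le> (\<integral>\<^sup>+ p. ennreal (norm (LINT w|lborel. G (w, p))) \<partial>lborel)"
  proof -
    have "integrable lborel (\<lambda>p. LINT w|lborel. G (w, p))"
      using lborel_pair.integrable_snd[OF intG'] by simp
    then show ?thesis unfolding LE by (rule integral_norm_bound_ennreal)
  qed
  also have "\<dots> \<le> (\<integral>\<^sup>+ p. (case p of (x, y) \<Rightarrow> ennreal (k (x - y)) * (ennreal ((cmod (h x))\<^sup>2) / 2 + ennreal ((cmod (h y))\<^sup>2) / 2)) \<partial>(lborel \<Otimes>\<^sub>M lborel))"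
    unfolding lborel_prod
  proof (rule nn_integral_mono, clarify)
    fix x y :: real
    have "norm (LINT w|lborel. G (w, x, y)) \<le> k (x - y) * (cmod (h x) * cmod (h y))"
      unfolding Gw norm_mult using K[of x y] by (simp add: mult_right_mono)
    \<comment> \<open>Splitting the product by the inequality of means turns each half into a
      convolution of \<open>k\<close> with one of the two squares, whose integral is the mass of
      \<open>k\<close> times \<open>N\<close> / 2 by translation invariance.\<close>
    also have "\<dots> \<le> k (x - y) * ((cmod (h x))\<^sup>2 / 2 + (cmod (h y))\<^sup>2 / 2)"
      using sum_squares_bound[of "cmod (h x)" "cmod (h y)"] by (intro mult_left_mono k0) (auto)
    finally have "ennreal (norm (LINT w|lborel. G (w, x, y))) \<le> ennreal (k (x - y) * ((cmod (h x))\<^sup>2 / 2 + (cmod (h y))\<^sup>2 / 2))"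
      by (rule ennreal_leI)
    also have "\<dots> = ennreal (k (x - y)) * (ennreal ((cmod (h x))\<^sup>2) / 2 + ennreal ((cmod (h y))\<^sup>2) / 2)"
      using k0 by (simp add: ennreal_mult' ennreal_plus divide_ennreal[symmetric] flip: ennreal_numeral)
    finally show "ennreal (norm (LINT w|lborel. G (w, x, y))) \<le> \<dots>" .
  qed
  also have "\<dots> = (\<integral>\<^sup>+ p. (case p of (x, y) \<Rightarrow> ennreal (k (x - y)) * (ennreal ((cmod (h x))\<^sup>2) / 2)) \<partial>(lborel \<Otimes>\<^sub>M lborel))
      + (\<integral>\<^sup>+ p. (case p of (x, y) \<Rightarrow> ennreal (k (x - y)) * (ennreal ((cmod (h y))\<^sup>2) / 2)) \<partial>(lborel \<Otimes>\<^sub>M lborel))"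
    by (subst nn_integral_add[symmetric]) (auto simp: distrib_left intro!: nn_integral_cong)
  also have "(\<integral>\<^sup>+ p. (case p of (x, y) \<Rightarrow> ennreal (k (x - y)) * (ennreal ((cmod (h x))\<^sup>2) / 2)) \<partial>(lborel \<Otimes>\<^sub>M lborel))
      = (\<integral>\<^sup>+ x. \<integral>\<^sup>+ y. ennreal (k (x - y)) * (ennreal ((cmod (h x))\<^sup>2) / 2) \<partial>lborel \<partial>lborel)"
    by (subst lborel.nn_integral_fst[symmetric]) auto
  also have "\<dots> = (\<integral>\<^sup>+ x. (\<integral>\<^sup>+ y. ennreal (k y) \<partial>lborel) * (ennreal ((cmod (h x))\<^sup>2) / 2) \<partial>lborel)"
    by (simp add: nn_integral_multc nn_integral_lborel_diff[of "\<lambda>y. ennreal (k y)"])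
  also have "(\<integral>\<^sup>+ p. (case p of (x, y) \<Rightarrow> ennreal (k (x - y)) * (ennreal ((cmod (h y))\<^sup>2) / 2)) \<partial>(lborel \<Otimes>\<^sub>M lborel))
      = (\<integral>\<^sup>+ y. \<integral>\<^sup>+ x. ennreal (k (x - y)) * (ennreal ((cmod (h y))\<^sup>2) / 2) \<partial>lborel \<partial>lborel)"
    by (subst lborel_pair.nn_integral_snd[symmetric]) auto
  also have "\<dots> = (\<integral>\<^sup>+ y. (\<integral>\<^sup>+ x. ennreal (k x) \<partial>lborel) * (ennreal ((cmod (h y))\<^sup>2) / 2) \<partial>lborel)"
    by (simp add: nn_integral_multc nn_integral_lborel_diff[of "\<lambda>y. ennreal (k y)"])
  also have "(\<integral>\<^sup>+ x. (\<integral>\<^sup>+ y. ennreal (k y) \<partial>lborel) * (ennreal ((cmod (h x))\<^sup>2) / 2) \<partial>lborel)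
      = (\<integral>\<^sup>+ y. ennreal (k y) \<partial>lborel) * (N / 2)"
    by (simp add: N_def nn_integral_cmult nn_integral_divide)
  also have "(\<integral>\<^sup>+ y. ennreal (k y) \<partial>lborel) * (N / 2) + (\<integral>\<^sup>+ y. ennreal (k y) \<partial>lborel) * (N / 2)
      = (\<integral>\<^sup>+ y. ennreal (k y) \<partial>lborel) * N"
  proof -
    \<comment> \<open>Since \<open>h\<close> is only known to be in L^1, \<open>N\<close> may be
      infinite, and the two halves are recombined by cases.\<close>
    have "N / 2 + N / 2 = N"
      by (cases N) (auto simp: ennreal_divide_numeral ennreal_top_divide simp flip: ennreal_plus)
    then show ?thesis by (simp flip: distrib_left)
  qed
  also have "\<dots> \<le> ennreal S * N" using S by (rule mult_right_mono) simp
  finally have "ennreal L \<le> ennreal S * N" .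
  moreover have "(\<integral>\<^sup>+ w. ennreal ((cmod (I w))\<^sup>2) \<partial>lborel) = ennreal L"
    unfolding L_def by (rule nn_integral_eq_integral[OF intI']) simp
  ultimately show ?thesis unfolding I_def N_def by simp
qed

text \<open>With values in \<open>ennreal\<close> the squared norm makes sense for every function,
  so that bounds can be stated without integrability hypotheses and finiteness is read off from them
  afterwards.\<close>

definition L2sq :: "(real \<Rightarrow> complex) \<Rightarrow> ennreal" where
  "L2sq h = (\<integral>\<^sup>+ x. ennreal ((cmod (h x))\<^sup>2) \<partial>lborel)"

lemma L2sq_mono:
  "(\<And>x. cmod (g x) \<le> cmod (h x)) \<Longrightarrow> L2sq g \<le> L2sq h"
  unfolding L2sq_def by (intro nn_integral_mono ennreal_leI power_mono) auto

lemma L2sq_add_le: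
  assumes [measurable]: "g \<in> borel_measurable borel" "h \<in> borel_measurable borel"
  shows "L2sq (\<lambda>x. g x + h x) \<le> 2 * L2sq g + 2 * L2sq h"
proof -
  have "L2sq (\<lambda>x. g x + h x) \<le> (\<integral>\<^sup>+ x. 2 * ennreal ((cmod (g x))\<^sup>2) + 2 * ennreal ((cmod (h x))\<^sup>2) \<partial>lborel)"
    unfolding L2sq_def
  proof (rule nn_integral_mono)
    fix x
    have "(cmod (g x + h x))\<^sup>2 \<le> (cmod (g x) + cmod (h x))\<^sup>2"
      by (intro power_mono norm_triangle_ineq) auto
    also have "\<dots> \<le> 2 * (cmod (g x))\<^sup>2 + 2 * (cmod (h x))\<^sup>2"
      using sum_squares_bound[of "cmod (g x)" "cmod (h x)"] by (simp add: power2_sum)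
    finally have "ennreal ((cmod (g x + h x))\<^sup>2) \<le> ennreal (2 * (cmod (g x))\<^sup>2 + 2 * (cmod (h x))\<^sup>2)"
      by (rule ennreal_leI)
    then show "ennreal ((cmod (g x + h x))\<^sup>2) \<le> 2 * ennreal ((cmod (g x))\<^sup>2) + 2 * ennreal ((cmod (h x))\<^sup>2)"
      by (simp add: ennreal_plus ennreal_mult')
  qed
  also have "\<dots> = 2 * L2sq g + 2 * L2sq h"
    unfolding L2sq_def by (simp add: nn_integral_add nn_integral_cmult)
  finally show ?thesis .
qed

text \<open>On a bounded set L^2 embeds in L^1, here simply by |h| <= 1 + |h|^2. It supplies the
  qualitative integrability that Fubini and \<open>TTstar_bound\<close> ask for.\<close>

lemma integrable_L2_compact_support:
  assumes h[measurable]: "h \<in> borel_measurable borel" and fin: "L2sq h < \<infinity>"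
    and supp: "\<And>x. r < \<bar>x\<bar> \<Longrightarrow> h x = 0"
  shows "integrable lborel h"
proof (rule integrableI_bounded)
  have "(\<integral>\<^sup>+ x. ennreal (norm (h x)) \<partial>lborel) \<le>
      (\<integral>\<^sup>+ x. indicator {-r..r} x + ennreal ((cmod (h x))\<^sup>2) \<partial>lborel)"
  proof (rule nn_integral_mono)
    fix x
    show "ennreal (norm (h x)) \<le> indicator {-r..r} x + ennreal ((cmod (h x))\<^sup>2)"
    proof (cases "r < \<bar>x\<bar>")
      case False
      have "cmod (h x) \<le> 1 + (cmod (h x))\<^sup>2"
        using sum_squares_bound[of 1 "cmod (h x)"] norm_ge_zero[of "h x"] by (simp; linarith)
      then have "ennreal (cmod (h x)) \<le> ennreal (1 + (cmod (h x))\<^sup>2)" by (rule ennreal_leI)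
      with False show ?thesis by (auto simp: indicator_def ennreal_plus)
    qed (simp add: supp)
  qed
  also have "\<dots> = emeasure lborel {-r..r} + L2sq h"
    unfolding L2sq_def by (simp add: nn_integral_add)
  also have "\<dots> < \<infinity>" using fin by (simp add: emeasure_lborel_Icc_eq)
  finally show "(\<integral>\<^sup>+ x. ennreal (norm (h x)) \<partial>lborel) < \<infinity>" .
qed simp

section \<open>Plancherel's inequality for integrable functions\<close>

lemma fourier_gaussian:
  fixes c t :: real
  assumes c: "0 < c"
  shows "(LINT w|lborel. complex_of_real (exp (- (w / c)\<^sup>2 / 2)) * cis (t * w))
     = of_real (c * sqrt (2 * pi) * exp (- (c * t)\<^sup>2 / 2))"
proof -
  have "(LINT w|lborel. complex_of_real (exp (- (w / c)\<^sup>2 / 2)) * cis (t * w))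
      = \<bar>c\<bar> *\<^sub>R (LINT v|lborel. complex_of_real (exp (- ((0 + c * v) / c)\<^sup>2 / 2)) * cis (t * (0 + c * v)))"
    using c by (intro lborel_integral_real_affine) simp
  also have "(LINT v|lborel. complex_of_real (exp (- ((0 + c * v) / c)\<^sup>2 / 2)) * cis (t * (0 + c * v)))
      = (LINT v|lborel. of_real (sqrt (2 * pi)) * (std_normal_density v *\<^sub>R iexp (c * t * v)))"
    using c by (intro Bochner_Integration.integral_cong)
      (auto simp: std_normal_density_def cis_conv_exp scaleR_conv_of_real mult_ac)
  also have "\<dots> = of_real (sqrt (2 * pi)) * char std_normal_distribution (c * t)"
    unfolding char_def by (subst integral_density) (auto simp del: mult_scaleR_right)
  finally show ?thesis
    using c by (simp add: char_std_normal_distribution scaleR_conv_of_real mult_ac)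
qed

text \<open>A Gaussian weight in the frequency variable turns the kernel of $T^*T$ into an explicit
  approximate identity of mass $2\pi$; Fatou's lemma then removes the weight.\<close>

lemma plancherel_bound:
  fixes h :: "real \<Rightarrow> complex"
  assumes h: "integrable lborel h"
  shows "L2sq (\<lambda>\<xi>. LINT x|lborel. cis (- x * \<xi>) * h x) \<le> ennreal (2 * pi) * L2sq h"
proof -
  have [measurable]: "h \<in> borel_measurable borel" using h by auto
  define H where "H \<xi> = (LINT x|lborel. cis (- x * \<xi>) * h x)" for \<xi>
  have Hm[measurable]: "H \<in> borel_measurable borel" unfolding H_def by measurable
  have damped: "(\<integral>\<^sup>+ w. ennreal ((exp (- (w / c)\<^sup>2 / 4) * cmod (H w))\<^sup>2) \<partial>lborel) \<le> ennreal (2 * pi) * L2sq h"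
    if c: "0 < c" for c :: real
  proof -
    have sq: "(exp (- (w / c)\<^sup>2 / 4))\<^sup>2 = exp (- (w / c)\<^sup>2 / 2)" for w
      by (simp add: power2_eq_square flip: exp_add)
    \<comment> \<open>Each factor carries the square root of the Gaussian exp (- (w/c)^2 / 2), so
      that the product of two factors carries the Gaussian itself. Its transform is 2 pi times a
      normal density of variance 1/c^2, whose mass 1 does not depend on \<open>c\<close>.\<close>
    have "(\<integral>\<^sup>+ w. ennreal ((cmod (LINT x|lborel. (complex_of_real (exp (- (w / c)\<^sup>2 / 4)) * cis (- x * w)) * h x))\<^sup>2) \<partial>lborel)
      \<le> ennreal (2 * pi) * (\<integral>\<^sup>+ x. ennreal ((cmod (h x))\<^sup>2) \<partial>lborel)"
    proof (rule TTstar_bound[where \<theta> = "\<lambda>w. exp (- (w / c)\<^sup>2 / 4)"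
          and k = "\<lambda>y. 2 * pi * normal_density 0 (1 / c) y", OF _ _ _ h])
      have "integrable lborel (\<lambda>w. (sqrt (2 * pi) * c) * normal_density 0 c w)"
        using c by simp
      also have "(\<lambda>w. (sqrt (2 * pi) * c) * normal_density 0 c w) = (\<lambda>w. (exp (- (w / c)\<^sup>2 / 4))\<^sup>2)"
        unfolding sq using c by (auto simp: normal_density_def fun_eq_iff real_sqrt_mult power_divide)
      finally show "integrable lborel (\<lambda>w. (exp (- (w / c)\<^sup>2 / 4))\<^sup>2)" .
      show "cmod (LINT w|lborel. complex_of_real (exp (- (w / c)\<^sup>2 / 4)) * cis (- x * w)
          * cnj (complex_of_real (exp (- (w / c)\<^sup>2 / 4)) * cis (- y * w))) \<le> 2 * pi * normal_density 0 (1 / c) (x - y)" for x y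
      proof -
        have "(LINT w|lborel. complex_of_real (exp (- (w / c)\<^sup>2 / 4)) * cis (- x * w)
          * cnj (complex_of_real (exp (- (w / c)\<^sup>2 / 4)) * cis (- y * w)))
          = (LINT w|lborel. complex_of_real (exp (- (w / c)\<^sup>2 / 2)) * cis ((y - x) * w))"
        proof (rule Bochner_Integration.integral_cong[OF refl])
          fix w
          have "complex_of_real (exp (- (w / c)\<^sup>2 / 4)) * cis (- x * w)
            * cnj (complex_of_real (exp (- (w / c)\<^sup>2 / 4)) * cis (- y * w))
            = of_real ((exp (- (w / c)\<^sup>2 / 4))\<^sup>2) * (cis (- x * w) * cis (y * w))"
            by (simp add: cis_cnj power2_eq_square mult_ac)
          then show "complex_of_real (exp (- (w / c)\<^sup>2 / 4)) * cis (- x * w)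
            * cnj (complex_of_real (exp (- (w / c)\<^sup>2 / 4)) * cis (- y * w))
            = complex_of_real (exp (- (w / c)\<^sup>2 / 2)) * cis ((y - x) * w)"
            unfolding sq by (simp add: cis_mult algebra_simps)
        qed
        also have "\<dots> = of_real (c * sqrt (2 * pi) * exp (- (c * (y - x))\<^sup>2 / 2))"
          by (rule fourier_gaussian[OF c])
        also have "c * sqrt (2 * pi) * exp (- (c * (y - x))\<^sup>2 / 2) = 2 * pi * normal_density 0 (1 / c) (x - y)"
        proof -
          have "normal_density 0 (1 / c) (x - y) = c / sqrt (2 * pi) * exp (- (c * (y - x))\<^sup>2 / 2)"
            using c by (simp add: normal_density_def real_sqrt_divide real_sqrt_mult power_divide
                power_mult_distrib power2_commute[of x y] mult_ac)
          moreover have "c * sqrt (2 * pi) = 2 * pi * (c / sqrt (2 * pi))"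
            by (simp add: real_div_sqrt divide_simps)
          ultimately show ?thesis by simp
        qed
        finally show ?thesis by (simp only: norm_of_real) simp
      qed
      have "(\<integral>\<^sup>+ y. ennreal (2 * pi * normal_density 0 (1 / c) y) \<partial>lborel)
          = ennreal (LINT y|lborel. 2 * pi * normal_density 0 (1 / c) y)"
        using c by (intro nn_integral_eq_integral) auto
      then show "(\<integral>\<^sup>+ y. ennreal (2 * pi * normal_density 0 (1 / c) y) \<partial>lborel) \<le> ennreal (2 * pi)"
        using c by simp
    qed (auto simp: norm_mult)
    moreover have "cmod (LINT x|lborel. (complex_of_real (exp (- (w / c)\<^sup>2 / 4)) * cis (- x * w)) * h x)
        = exp (- (w / c)\<^sup>2 / 4) * cmod (H w)" for w
      unfolding H_def by (simp add: mult.assoc norm_mult)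
    ultimately show ?thesis unfolding L2sq_def by simp
  qed
  have "L2sq H = (\<integral>\<^sup>+ w. liminf (\<lambda>n. ennreal ((exp (- (w / real (Suc n))\<^sup>2 / 4) * cmod (H w))\<^sup>2)) \<partial>lborel)"
    unfolding L2sq_def
  proof (rule nn_integral_cong)
    fix w
    have "(\<lambda>n. w / real (Suc n)) \<longlonglongrightarrow> 0"
      by (intro LIMSEQ_Suc lim_const_over_n)
    then have "(\<lambda>n. (exp (- (w / real (Suc n))\<^sup>2 / 4) * cmod (H w))\<^sup>2) \<longlonglongrightarrow> (exp (- 0\<^sup>2 / 4) * cmod (H w))\<^sup>2"
      by (intro tendsto_intros) auto
    then have "(\<lambda>n. ennreal ((exp (- (w / real (Suc n))\<^sup>2 / 4) * cmod (H w))\<^sup>2)) \<longlonglongrightarrow> ennreal ((cmod (H w))\<^sup>2)"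
      by (intro tendsto_ennrealI) simp
    then show "ennreal ((cmod (H w))\<^sup>2) = liminf (\<lambda>n. ennreal ((exp (- (w / real (Suc n))\<^sup>2 / 4) * cmod (H w))\<^sup>2))"
      by (intro lim_imp_Liminf[symmetric]) auto
  qed
  also have "\<dots> \<le> liminf (\<lambda>n. \<integral>\<^sup>+ w. ennreal ((exp (- (w / real (Suc n))\<^sup>2 / 4) * cmod (H w))\<^sup>2) \<partial>lborel)"
    by (rule nn_integral_liminf) measurable
  also have "\<dots> \<le> liminf (\<lambda>n::nat. ennreal (2 * pi) * L2sq h)"
    by (intro Liminf_mono always_eventually allI damped) simp
  also have "\<dots> = ennreal (2 * pi) * L2sq h"
    by (simp add: Liminf_const)
  finally show ?thesis unfolding H_def .
qed

lemma plancherel_bound_inverse: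
  fixes U :: "real \<Rightarrow> complex"
  assumes U: "integrable lborel U"
  shows "L2sq (\<lambda>x. LINT \<zeta>|lborel. cis (x * \<zeta>) * U \<zeta>) \<le> ennreal (2 * pi) * L2sq U"
proof -
  have [measurable]: "U \<in> borel_measurable borel" using U by auto
  define H where "H \<xi> = (LINT x|lborel. cis (- x * \<xi>) * U x)" for \<xi>
  have [measurable]: "H \<in> borel_measurable borel" unfolding H_def by measurable
  have "L2sq H = L2sq (\<lambda>x. H (0 + -1 * x))"
    unfolding L2sq_def using nn_integral_real_affine[of "\<lambda>x. ennreal ((cmod (H x))\<^sup>2)" "-1" 0] by simp
  also have "(\<lambda>x. H (0 + -1 * x)) = (\<lambda>x. LINT \<zeta>|lborel. cis (x * \<zeta>) * U \<zeta>)"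
    unfolding H_def by (simp add: mult.commute)
  finally show ?thesis
    using plancherel_bound[OF U] unfolding H_def by simp
qed

section \<open>The L^2 Fourier transform as a limit of truncated integrals\<close>

definition L2tail :: "(real \<Rightarrow> complex) \<Rightarrow> real \<Rightarrow> ennreal" where
  "L2tail f r = L2sq (\<lambda>x. if r < \<bar>x\<bar> then f x else 0)"

lemma L2tail_antimono: "r \<le> r' \<Longrightarrow> L2tail f r' \<le> L2tail f r"
  unfolding L2tail_def by (rule L2sq_mono) auto

lemma L2tail_tendsto_0:
  assumes [measurable]: "f \<in> borel_measurable borel" and fin: "L2sq f < \<infinity>"
  shows "(L2tail f \<longlongrightarrow> 0) at_top"
proof -
  have "(\<lambda>n. L2tail f (real n)) \<longlonglongrightarrow> (\<integral>\<^sup>+ x. 0 \<partial>(lborel::real measure))"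
    unfolding L2tail_def L2sq_def
  proof (rule nn_integral_dominated_convergence[where w = "\<lambda>x. ennreal ((cmod (f x))\<^sup>2)"])
    show "AE x in lborel. (\<lambda>n. ennreal ((cmod (if real n < \<bar>x\<bar> then f x else 0))\<^sup>2)) \<longlonglongrightarrow> 0"
    proof (rule AE_I2)
      fix x :: real
      have "\<forall>\<^sub>F n in sequentially. \<bar>x\<bar> \<le> real n"
        using filterlim_real_sequentially by (simp add: filterlim_at_top)
      then have "\<forall>\<^sub>F n in sequentially. ennreal ((cmod (if real n < \<bar>x\<bar> then f x else 0))\<^sup>2) = 0"
        by eventually_elim auto
      then show "(\<lambda>n. ennreal ((cmod (if real n < \<bar>x\<bar> then f x else 0))\<^sup>2)) \<longlonglongrightarrow> 0"
        by (rule tendsto_eventually)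
    qed
  qed (use fin in \<open>auto simp: L2sq_def\<close>)
  then have seq: "(\<lambda>n. L2tail f (real n)) \<longlonglongrightarrow> 0" by simp
  show ?thesis
  proof (rule order_tendstoI)
    fix e :: ennreal assume "0 < e"
    then have "\<forall>\<^sub>F n in sequentially. L2tail f (real n) < e"
      using seq by (rule order_tendstoD(2)[rotated])
    then obtain n where "L2tail f (real n) < e"
      by (auto simp: eventually_sequentially)
    then show "\<forall>\<^sub>F r in at_top. L2tail f r < e"
      using L2tail_antimono by (intro eventually_at_top_linorderI[of "real n"]) (auto intro: le_less_trans)
  qed simp
qed

lemma fourier_trunc_measurable [measurable]:
  assumes [measurable]: "f \<in> borel_measurable borel"
  shows "fourier_trunc f R \<in> borel_measurable borel"
  unfolding fourier_trunc_def set_lebesgue_integral_def by measurable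

text \<open>The part of \<open>f\<close> in an annulus is integrable, so its transform is an
  absolutely convergent integral to which \<open>plancherel_bound\<close> applies. For negative
  \<open>r\<close> the interval \<open>{-r..r}\<close> is empty and the annulus becomes the full
  ball of radius \<open>r'\<close>.\<close>

lemma fourier_trunc_diff:
  assumes f[measurable]: "f \<in> borel_measurable borel" and fin: "L2sq f < \<infinity>" and r: "r \<le> r'"
  shows "fourier_trunc f r' \<xi> - fourier_trunc f r \<xi> =
    (LINT x|lborel. cis (- x * \<xi>) * (if r < \<bar>x\<bar> \<and> \<bar>x\<bar> \<le> r' then f x else 0))"
    and "integrable lborel (\<lambda>x. if r < \<bar>x\<bar> \<and> \<bar>x\<bar> \<le> r' then f x else 0)"
proof -
  have int: "integrable lborel (\<lambda>x. cis (- x * \<xi>) * (indicator {-R..R} x *\<^sub>R f x))" for R \<xi>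
  proof (rule Bochner_Integration.integrable_bound)
    show "integrable lborel (\<lambda>x. indicator {-R..R} x *\<^sub>R f x)"
    proof (rule integrable_L2_compact_support)
      have "L2sq (\<lambda>x. indicator {-R..R} x *\<^sub>R f x) \<le> L2sq f"
        by (rule L2sq_mono) (auto simp: indicator_def)
      with fin show "L2sq (\<lambda>x. indicator {-R..R} x *\<^sub>R f x) < \<infinity>" by auto
      show "R < \<bar>x\<bar> \<Longrightarrow> indicator {-R..R} x *\<^sub>R f x = 0" for x
        by (auto simp: indicator_def)
    qed measurable
  qed (auto simp: norm_mult)
  have eq: "cis (- x * \<xi>) * (indicator {-r'..r'} x *\<^sub>R f x) - cis (- x * \<xi>) * (indicator {-r..r} x *\<^sub>R f x)
      = cis (- x * \<xi>) * (if r < \<bar>x\<bar> \<and> \<bar>x\<bar> \<le> r' then f x else 0)" for x \<xi>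
    using r by (auto simp: indicator_def)
  show "fourier_trunc f r' \<xi> - fourier_trunc f r \<xi> =
    (LINT x|lborel. cis (- x * \<xi>) * (if r < \<bar>x\<bar> \<and> \<bar>x\<bar> \<le> r' then f x else 0))"
  proof -
    have "fourier_trunc f R \<xi> = (LINT x|lborel. cis (- x * \<xi>) * (indicator {-R..R} x *\<^sub>R f x))" for R
      unfolding fourier_trunc_def set_lebesgue_integral_def by (simp only: mult_scaleR_right)
    then show ?thesis
      by (simp only: Bochner_Integration.integral_diff[OF int int, symmetric] eq)
  qed
  have "integrable lborel (\<lambda>x. cis (- x * 0) * (indicator {-r'..r'} x *\<^sub>R f x) - cis (- x * 0) * (indicator {-r..r} x *\<^sub>R f x))"
    by (intro Bochner_Integration.integrable_diff int)
  then show "integrable lborel (\<lambda>x. if r < \<bar>x\<bar> \<and> \<bar>x\<bar> \<le> r' then f x else 0)"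
    unfolding eq by simp
qed

lemma L2sq_fourier_trunc_diff:
  assumes f[measurable]: "f \<in> borel_measurable borel" and fin: "L2sq f < \<infinity>" and r: "r \<le> r'"
  shows "L2sq (\<lambda>\<xi>. fourier_trunc f r' \<xi> - fourier_trunc f r \<xi>) \<le> ennreal (2 * pi) * L2tail f r"
proof -
  have "L2sq (\<lambda>\<xi>. fourier_trunc f r' \<xi> - fourier_trunc f r \<xi>)
      \<le> ennreal (2 * pi) * L2sq (\<lambda>x. if r < \<bar>x\<bar> \<and> \<bar>x\<bar> \<le> r' then f x else 0)"
    unfolding fourier_trunc_diff(1)[OF assms] by (rule plancherel_bound[OF fourier_trunc_diff(2)[OF assms]])
  also have "\<dots> \<le> ennreal (2 * pi) * L2tail f r"
    unfolding L2tail_def by (intro mult_left_mono L2sq_mono) auto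
  finally show ?thesis .
qed

text \<open>The Riesz-Fischer argument in quantitative form. Weighting the increments by 2^k still
  leaves the summable bound 4^(-k), so for almost every x the terms 2^k |d k|^2 are bounded by some
  C; then |d k| <= sqrt C * 2^(-k/2), and the telescoping series converges.\<close>

lemma L2_fast_Cauchy_converges_AE:
  fixes G :: "nat \<Rightarrow> real \<Rightarrow> complex"
  assumes [measurable]: "\<And>k. G k \<in> borel_measurable borel"
    and fast: "\<And>k. L2sq (\<lambda>x. G (Suc k) x - G k x) \<le> ennreal ((1/8)^k)"
  shows "AE x in lborel. convergent (\<lambda>k. G k x)"
proof -
  have "(\<integral>\<^sup>+ x. (\<Sum>k. ennreal (2^k * (cmod (G (Suc k) x - G k x))\<^sup>2)) \<partial>lborel)
      = (\<Sum>k. \<integral>\<^sup>+ x. ennreal (2^k * (cmod (G (Suc k) x - G k x))\<^sup>2) \<partial>lborel)"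
    by (rule nn_integral_suminf) measurable
  also have "\<dots> \<le> (\<Sum>k. ennreal ((1/4)^k))"
  proof (rule suminf_le)
    fix k
    have "(\<integral>\<^sup>+ x. ennreal (2^k * (cmod (G (Suc k) x - G k x))\<^sup>2) \<partial>lborel)
        = ennreal (2^k) * L2sq (\<lambda>x. G (Suc k) x - G k x)"
      unfolding L2sq_def by (simp add: ennreal_mult' nn_integral_cmult)
    also have "\<dots> \<le> ennreal (2^k) * ennreal ((1/8)^k)"
      using fast by (rule mult_left_mono) simp
    also have "\<dots> = ennreal ((1/4)^k)"
      by (simp add: ennreal_mult'[symmetric] flip: power_mult_distrib)
    finally show "(\<integral>\<^sup>+ x. ennreal (2^k * (cmod (G (Suc k) x - G k x))\<^sup>2) \<partial>lborel) \<le> ennreal ((1/4)^k)" .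
  qed auto
  also have "\<dots> = ennreal (\<Sum>k. (1/4)^k)"
    by (intro suminf_ennreal2) (auto intro: summable_geometric)
  finally have "(\<integral>\<^sup>+ x. (\<Sum>k. ennreal (2^k * (cmod (G (Suc k) x - G k x))\<^sup>2)) \<partial>lborel) \<noteq> \<infinity>"
    by (auto simp: top_unique)
  then have "AE x in lborel. (\<Sum>k. ennreal (2^k * (cmod (G (Suc k) x - G k x))\<^sup>2)) \<noteq> \<infinity>"
    by (intro nn_integral_PInf_AE) auto
  then show ?thesis
  proof (eventually_elim)
    case (elim x)
    define d where "d k = G (Suc k) x - G k x" for k
    have "summable (\<lambda>k. 2^k * (cmod (d k))\<^sup>2)"
      using elim unfolding d_def by (intro summable_suminf_not_top) auto
    then obtain C where C: "\<And>k. 2^k * (cmod (d k))\<^sup>2 \<le> C"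
      by (metis (no_types, lifting) Bseq_def abs_le_D1 real_norm_def summable_imp_Bseq)
    have "0 \<le> C" using C[of 0] by (auto intro: order_trans[rotated])
    have "summable (\<lambda>k. sqrt C * (sqrt (1/2))^k)"
      by (intro summable_mult summable_geometric) (simp add: real_sqrt_divide)
    then have "summable d"
    proof (rule summable_comparison_test')
      fix k :: nat
      have "(cmod (d k))\<^sup>2 \<le> C * (1/2)^k"
        using C[of k] by (simp add: power_one_over field_simps)
      then have "cmod (d k) \<le> sqrt (C * (1/2)^k)"
        by (rule real_le_rsqrt)
      then show "norm (d k) \<le> sqrt C * (sqrt (1/2))^k"
        by (simp add: real_sqrt_mult real_sqrt_power)
    qed
    then have "convergent (\<lambda>n. G 0 x + (\<Sum>k<n. d k))"
      by (intro convergent_add convergent_const) (simp add: summable_iff_convergent)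
    also have "(\<lambda>n. G 0 x + (\<Sum>k<n. d k)) = (\<lambda>n. G n x)"
      unfolding d_def by (simp add: sum_lessThan_telescope[of "\<lambda>k. G k x" for x])
    finally show ?case .
  qed
qed

text \<open>\<open>fourier\<close> is defined by choice, so nothing can be said of it before some
  limit is shown to exist. By Plancherel the truncations are Cauchy in L^2; radii chosen with tails
  below 8^(-k) give a sequence that converges almost everywhere, and its limit is a witness.\<close>

lemma fourier_spec:
  assumes f[measurable]: "f \<in> borel_measurable borel" and fin: "L2sq f < \<infinity>"
  shows "fourier f \<in> borel_measurable borel"
    and "((\<lambda>R. L2sq (\<lambda>\<xi>. fourier f \<xi> - fourier_trunc f R \<xi>)) \<longlongrightarrow> 0) at_top"
proof -
  have tail0: "((\<lambda>r. ennreal (2 * pi) * L2tail f r) \<longlongrightarrow> 0) at_top"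
    using tendsto_mult_ennreal[OF tendsto_const[of "ennreal (2 * pi)"] L2tail_tendsto_0[OF assms]] by simp
  have "\<exists>r\<ge>real k. ennreal (2 * pi) * L2tail f r \<le> ennreal ((1/8)^k)" for k
  proof -
    have "\<forall>\<^sub>F r in at_top. ennreal (2 * pi) * L2tail f r < ennreal ((1/8)^k)"
      by (rule order_tendstoD(2)[OF tail0]) simp
    then have "\<forall>\<^sub>F r in at_top. real k \<le> r \<and> ennreal (2 * pi) * L2tail f r < ennreal ((1/8)^k)"
      using eventually_ge_at_top by (rule eventually_conj[rotated])
    then have "\<exists>r. real k \<le> r \<and> ennreal (2 * pi) * L2tail f r < ennreal ((1/8)^k)"
      by (rule eventually_happens'[rotated]) simp
    then show ?thesis by (auto intro: less_imp_le)
  qed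
  then obtain r where r: "\<And>k. real k \<le> r k" "\<And>k. ennreal (2 * pi) * L2tail f (r k) \<le> ennreal ((1/8)^k)"
    by metis
  \<comment> \<open>The radii \<open>r k\<close> come from a choice and need not increase; running
    maxima are monotone, as the comparison of two truncations requires, and keep the tail
    bounds.\<close>
  define \<rho> where "\<rho> k = Max (r ` {..k})" for k
  have \<rho>_ge: "r k \<le> \<rho> k" for k unfolding \<rho>_def by (rule Max_ge) auto
  have \<rho>_mono: "\<rho> k \<le> \<rho> (Suc k)" for k
    unfolding \<rho>_def by (rule Max_mono) auto
  define G where "G k = fourier_trunc f (\<rho> k)" for k
  have [measurable]: "G k \<in> borel_measurable borel" for k unfolding G_def by measurable
  have "L2sq (\<lambda>x. G (Suc k) x - G k x) \<le> ennreal ((1/8)^k)" for k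
  proof -
    have "L2sq (\<lambda>x. G (Suc k) x - G k x) \<le> ennreal (2 * pi) * L2tail f (\<rho> k)"
      unfolding G_def by (rule L2sq_fourier_trunc_diff[OF assms \<rho>_mono])
    also have "\<dots> \<le> ennreal (2 * pi) * L2tail f (r k)"
      by (intro mult_left_mono L2tail_antimono \<rho>_ge) simp
    finally show ?thesis using r(2)[of k] by (rule order_trans)
  qed
  from L2_fast_Cauchy_converges_AE[OF _ this]
  have conv: "AE x in lborel. convergent (\<lambda>k. G k x)" by simp
  define F where "F x = lim (\<lambda>k. G k x)" for x
  have Fm[measurable]: "F \<in> borel_measurable borel"
    unfolding F_def by measurable
  have bound: "L2sq (\<lambda>\<xi>. F \<xi> - fourier_trunc f R \<xi>) \<le> ennreal (2 * pi) * L2tail f R" for R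
  proof -
    have "L2sq (\<lambda>\<xi>. F \<xi> - fourier_trunc f R \<xi>)
        = (\<integral>\<^sup>+ \<xi>. liminf (\<lambda>k. ennreal ((cmod (G k \<xi> - fourier_trunc f R \<xi>))\<^sup>2)) \<partial>lborel)"
      unfolding L2sq_def
    proof (rule nn_integral_cong_AE, use conv in eventually_elim)
      case (elim \<xi>)
      then have "(\<lambda>k. G k \<xi>) \<longlonglongrightarrow> F \<xi>"
        unfolding F_def by (simp add: convergent_LIMSEQ_iff)
      then have "(\<lambda>k. ennreal ((cmod (G k \<xi> - fourier_trunc f R \<xi>))\<^sup>2)) \<longlonglongrightarrow> ennreal ((cmod (F \<xi> - fourier_trunc f R \<xi>))\<^sup>2)"
        by (intro tendsto_ennrealI tendsto_intros)
      then show ?case by (intro lim_imp_Liminf[symmetric]) auto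
    qed
    \<comment> \<open>Fatou along the subsequence bounds the distance from the limit to every single
      truncation, so the convergence holds for the whole family in \<open>R\<close> and not only
      along \<open>\<rho>\<close>.\<close>
    also have "\<dots> \<le> liminf (\<lambda>k. L2sq (\<lambda>\<xi>. G k \<xi> - fourier_trunc f R \<xi>))"
      unfolding L2sq_def by (rule nn_integral_liminf) measurable
    also have "\<dots> \<le> liminf (\<lambda>k::nat. ennreal (2 * pi) * L2tail f R)"
    proof (rule Liminf_mono)
      have "\<forall>\<^sub>F k in sequentially. R \<le> real k"
        using filterlim_real_sequentially by (simp add: filterlim_at_top)
      then show "\<forall>\<^sub>F k in sequentially. L2sq (\<lambda>\<xi>. G k \<xi> - fourier_trunc f R \<xi>) \<le> ennreal (2 * pi) * L2tail f R"
      proof eventually_elim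
        case (elim k)
        then have "R \<le> \<rho> k" using r(1)[of k] \<rho>_ge[of k] by linarith
        then show ?case unfolding G_def by (rule L2sq_fourier_trunc_diff[OF assms])
      qed
    qed
    also have "\<dots> = ennreal (2 * pi) * L2tail f R" by (simp add: Liminf_const)
    finally show ?thesis .
  qed
  have "((\<lambda>R. L2sq (\<lambda>\<xi>. F \<xi> - fourier_trunc f R \<xi>)) \<longlongrightarrow> 0) at_top"
    by (rule tendsto_sandwich[OF _ _ tendsto_const tail0]) (auto intro!: always_eventually bound)
  then have "\<exists>F. F \<in> borel_measurable lborel \<and>
     ((\<lambda>R. \<integral>\<^sup>+ \<xi>. ennreal ((cmod (F \<xi> - fourier_trunc f R \<xi>))\<^sup>2) \<partial>lborel) \<longlongrightarrow> 0) at_top"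
    unfolding L2sq_def using Fm by (intro exI[of _ F]) auto
  from someI_ex[OF this]
  show "fourier f \<in> borel_measurable borel"
    and "((\<lambda>R. L2sq (\<lambda>\<xi>. fourier f \<xi> - fourier_trunc f R \<xi>)) \<longlongrightarrow> 0) at_top"
    unfolding fourier_def[symmetric] L2sq_def by auto
qed

text \<open>A truncation at a larger radius \<open>R\<close> is inserted and \<open>R\<close> sent
  to infinity. The constant is twice that of \<open>plancherel_bound\<close> because of the factor 2
  in \<open>L2sq_add_le\<close>.\<close>

lemma L2sq_fourier_tail:
  assumes f[measurable]: "f \<in> borel_measurable borel" and fin: "L2sq f < \<infinity>"
  shows "L2sq (\<lambda>\<xi>. fourier f \<xi> - fourier_trunc f r \<xi>) \<le> ennreal (4 * pi) * L2tail f r"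
proof -
  note spec = fourier_spec[OF assms]
  note [measurable] = spec(1)
  have "((\<lambda>R. 2 * L2sq (\<lambda>\<xi>. fourier f \<xi> - fourier_trunc f R \<xi>) + ennreal (4 * pi) * L2tail f r) \<longlongrightarrow>
      2 * 0 + ennreal (4 * pi) * L2tail f r) at_top"
    using tendsto_mult_ennreal[OF tendsto_const[of 2] spec(2)]
    by (intro tendsto_add tendsto_const) auto
  moreover have "\<forall>\<^sub>F R in at_top. L2sq (\<lambda>\<xi>. fourier f \<xi> - fourier_trunc f r \<xi>) \<le>
      2 * L2sq (\<lambda>\<xi>. fourier f \<xi> - fourier_trunc f R \<xi>) + ennreal (4 * pi) * L2tail f r"
    using eventually_ge_at_top[of r]
  proof eventually_elim
    case (elim R)
    have "L2sq (\<lambda>\<xi>. fourier f \<xi> - fourier_trunc f r \<xi>)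
        = L2sq (\<lambda>\<xi>. (fourier f \<xi> - fourier_trunc f R \<xi>) + (fourier_trunc f R \<xi> - fourier_trunc f r \<xi>))"
      by simp
    also have "\<dots> \<le> 2 * L2sq (\<lambda>\<xi>. fourier f \<xi> - fourier_trunc f R \<xi>)
        + 2 * L2sq (\<lambda>\<xi>. fourier_trunc f R \<xi> - fourier_trunc f r \<xi>)"
      by (rule L2sq_add_le) measurable
    also have "\<dots> \<le> 2 * L2sq (\<lambda>\<xi>. fourier f \<xi> - fourier_trunc f R \<xi>) + 2 * (ennreal (2 * pi) * L2tail f r)"
      by (intro add_left_mono mult_left_mono L2sq_fourier_trunc_diff[OF assms elim]) simp
    also have "2 * (ennreal (2 * pi) * L2tail f r) = ennreal (4 * pi) * L2tail f r"
      by (simp add: mult.assoc[symmetric] ennreal_mult'[symmetric] flip: ennreal_numeral)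
    finally show ?case .
  qed
  ultimately have "L2sq (\<lambda>\<xi>. fourier f \<xi> - fourier_trunc f r \<xi>) \<le> 2 * 0 + ennreal (4 * pi) * L2tail f r"
    by (rule tendsto_lowerbound) simp
  then show ?thesis by simp
qed

section \<open>Oscillatory integrals\<close>

lemma norm_LINT_bounded_support_le:
  fixes f :: "real \<Rightarrow> 'a::{banach, second_countable_topology}"
  assumes f: "\<And>x. norm (f x) \<le> B * indicator {-L..L} x" and B: "0 \<le> B" and L: "0 \<le> L"
  shows "norm (LINT x|lborel. f x) \<le> 2 * L * B"
proof (cases "integrable lborel f")
  case True
  have "norm (LINT x|lborel. f x) \<le> (LINT x|lborel. norm (f x))"
    by (rule integral_norm_bound)
  also have "\<dots> \<le> (LINT x|lborel. B * indicator {-L..L} x)"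
    using True f by (intro integral_mono integrable_mult_right integrable_real_indicator) (auto simp: emeasure_lborel_Icc_eq)
  also have "\<dots> = 2 * L * B" using L by simp
  finally show ?thesis .
qed (use B L in \<open>simp add: not_integrable_integral_eq\<close>)

lemma integrable_bounded_support:
  fixes f :: "real \<Rightarrow> 'a::{banach, second_countable_topology}"
  assumes [measurable]: "f \<in> borel_measurable borel"
    and f: "\<And>x. norm (f x) \<le> B * indicator {-L..L} x"
  shows "integrable lborel f"
proof (rule Bochner_Integration.integrable_bound)
  show "integrable lborel (\<lambda>x. B * indicator {-L..L::real} x)"
    by (intro integrable_mult_right integrable_real_indicator) (auto simp: emeasure_lborel_Icc_eq)
  show "AE x in lborel. norm (f x) \<le> norm (B * indicator {-L..L} x)"
    by (rule AE_I2) (metis abs_ge_self f order_trans real_norm_def)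
qed measurable

text \<open>Integration by parts is always used in this form: \<open>F\<close> is an amplitude times
  a phase factor divided by the derivative of the phase, and \<open>F'\<close> is the sum of the
  integrand in question, with a large factor, and of better terms.\<close>

lemma LINT_deriv_compact_support_eq_0:
  fixes F F' :: "real \<Rightarrow> complex"
  assumes F: "\<And>x. (F has_vector_derivative F' x) (at x)" and int: "integrable lborel F'"
    and supp: "\<And>x. L < \<bar>x\<bar> \<Longrightarrow> F x = 0" "\<And>x. L < \<bar>x\<bar> \<Longrightarrow> F' x = 0"
  shows "(LINT x|lborel. F' x) = 0"
proof -
  have "(F' has_integral (F (\<bar>L\<bar> + 1) - F (- (\<bar>L\<bar> + 1)))) {- (\<bar>L\<bar> + 1)..\<bar>L\<bar> + 1}"
    by (rule fundamental_theorem_of_calculus) (auto intro: has_vector_derivative_at_within F)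
  then have "(F' has_integral 0) {- (\<bar>L\<bar> + 1)..\<bar>L\<bar> + 1}"
    using supp(1)[of "\<bar>L\<bar> + 1"] supp(1)[of "- (\<bar>L\<bar> + 1)"] by simp
  then have "(F' has_integral 0) UNIV"
    by (rule has_integral_on_superset) (auto intro!: supp(2))
  then show ?thesis
    using has_integral_integral_lborel[OF int] has_integral_unique by blast
qed

lemma has_vector_derivative_cis_compose:
  assumes "(\<theta> has_real_derivative \<theta>') (at x)"
  shows "((\<lambda>x. cis (\<theta> x)) has_vector_derivative (\<i> * of_real \<theta>' * cis (\<theta> x))) (at x)"
proof -
  have "((\<lambda>x. of_real (\<theta> x)) has_vector_derivative complex_of_real \<theta>') (at x)"
    using assms by (intro has_vector_derivative_of_real) (simp add: has_real_derivative_iff_has_vector_derivative)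
  moreover have "((\<lambda>z. exp (\<i> * z)) has_field_derivative \<i> * exp (\<i> * of_real (\<theta> x))) (at (of_real (\<theta> x)))"
    by (auto intro!: derivative_eq_intros)
  ultimately have "(((\<lambda>z. exp (\<i> * z)) \<circ> (\<lambda>x. of_real (\<theta> x))) has_vector_derivative
      of_real \<theta>' * (\<i> * exp (\<i> * of_real (\<theta> x)))) (at x)"
    by (rule field_vector_diff_chain_at)
  then show ?thesis by (simp add: cis_conv_exp mult_ac o_def)
qed

text \<open>Smoothness is recorded in the first variable only, since every integration by parts runs
  in xi with zeta as a parameter. Continuity is demanded jointly: on a compact set it gives bounds
  that are uniform in the parameter.\<close>

primrec Ck_fst :: "nat \<Rightarrow> (real \<times> real \<Rightarrow> complex) \<Rightarrow> bool" where
  "Ck_fst 0 A \<longleftrightarrow> continuous_on UNIV A"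
| "Ck_fst (Suc n) A \<longleftrightarrow> continuous_on UNIV A \<and>
    (\<exists>A'. Ck_fst n A' \<and> (\<forall>\<xi> \<zeta>. ((\<lambda>x. A (x, \<zeta>)) has_vector_derivative A' (\<xi>, \<zeta>)) (at \<xi>)))"

lemma Ck_fst_continuous: "Ck_fst n A \<Longrightarrow> continuous_on UNIV A"
  by (cases n) auto

lemma Ck_fst_Suc_imp: "Ck_fst (Suc n) A \<Longrightarrow> Ck_fst n A"
proof (induction n arbitrary: A)
  case (Suc n)
  then obtain A' where "Ck_fst (Suc n) A'"
    "\<forall>\<xi> \<zeta>. ((\<lambda>x. A (x, \<zeta>)) has_vector_derivative A' (\<xi>, \<zeta>)) (at \<xi>)"
    unfolding Ck_fst.simps(2)[of "Suc n"] by blast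
  then show ?case using Suc.IH[of A'] Suc.prems by auto
qed (simp only: Ck_fst.simps)

lemma Ck_fst_add:
  "Ck_fst n A \<Longrightarrow> Ck_fst n B \<Longrightarrow> Ck_fst n (\<lambda>p. A p + B p)"
proof (induction n arbitrary: A B)
  case (Suc n)
  from Suc.prems obtain A' B' where
    "Ck_fst n A'" "\<And>\<xi> \<zeta>. ((\<lambda>x. A (x, \<zeta>)) has_vector_derivative A' (\<xi>, \<zeta>)) (at \<xi>)"
    "Ck_fst n B'" "\<And>\<xi> \<zeta>. ((\<lambda>x. B (x, \<zeta>)) has_vector_derivative B' (\<xi>, \<zeta>)) (at \<xi>)"
    by auto
  then show ?case using Suc.prems Suc.IH[of A' B']
    by (auto intro!: continuous_on_add exI[of _ "\<lambda>p. A' p + B' p"] has_vector_derivative_add)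
qed (auto intro: continuous_on_add)

lemma Ck_fst_mult:
  "Ck_fst n A \<Longrightarrow> Ck_fst n B \<Longrightarrow> Ck_fst n (\<lambda>p. A p * B p)"
proof (induction n arbitrary: A B)
  case (Suc n)
  from Suc.prems obtain A' B' where AB:
    "Ck_fst n A'" "\<And>\<xi> \<zeta>. ((\<lambda>x. A (x, \<zeta>)) has_vector_derivative A' (\<xi>, \<zeta>)) (at \<xi>)"
    "Ck_fst n B'" "\<And>\<xi> \<zeta>. ((\<lambda>x. B (x, \<zeta>)) has_vector_derivative B' (\<xi>, \<zeta>)) (at \<xi>)"
    by auto
  have "Ck_fst n (\<lambda>p. A p * B' p + A' p * B p)"
    using AB Ck_fst_Suc_imp[OF Suc.prems(1)] Ck_fst_Suc_imp[OF Suc.prems(2)]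
    by (intro Ck_fst_add Suc.IH)
  then show ?case using Suc.prems AB
    by (auto intro!: continuous_on_mult exI[of _ "\<lambda>p. A p * B' p + A' p * B p"] has_vector_derivative_mult)
qed (auto intro: continuous_on_mult)

lemma Ck_fst_cnj: "Ck_fst n A \<Longrightarrow> Ck_fst n (\<lambda>p. cnj (A p))"
proof (induction n arbitrary: A)
  case (Suc n)
  then obtain A' where
    "Ck_fst n A'" "\<And>\<xi> \<zeta>. ((\<lambda>x. A (x, \<zeta>)) has_vector_derivative A' (\<xi>, \<zeta>)) (at \<xi>)"
    by auto
  then show ?case using Suc
    by (auto intro!: continuous_on_cnj exI[of _ "\<lambda>p. cnj (A' p)"] has_vector_derivative_cnj)
qed (auto intro: continuous_on_cnj)

lemma Ck_fst_const: "Ck_fst n (\<lambda>p. c)"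
  by (induction n arbitrary: c) (auto intro!: exI[of _ "\<lambda>p. 0"])

text \<open>An integration by parts replaces the pair $(A, j)$ by $(A', j+1)$ and $(A\beta', j+2)$. Keeping the
  powers of $\beta - \mu$ apart from the amplitude makes the constants uniform in $\mu$.\<close>

lemma nonstationary_phase:
  fixes \<Phi> \<beta> \<beta>' :: "real \<times> real \<Rightarrow> real"
  assumes \<Phi>: "\<And>\<xi> \<zeta>. ((\<lambda>x. \<Phi> (x, \<zeta>)) has_real_derivative \<beta> (\<xi>, \<zeta>)) (at \<xi>)"
    and \<beta>: "\<And>\<xi> \<zeta>. ((\<lambda>x. \<beta> (x, \<zeta>)) has_real_derivative \<beta>' (\<xi>, \<zeta>)) (at \<xi>)"
    and \<beta>': "\<And>n. Ck_fst n (\<lambda>p. of_real (\<beta>' p))"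
    and K: "compact K" and \<epsilon>: "0 < \<epsilon>" "\<And>p. p \<in> K \<Longrightarrow> \<epsilon> \<le> \<bar>\<beta> p\<bar>"
  shows "Ck_fst N A \<Longrightarrow> (\<And>p. p \<notin> K \<Longrightarrow> A p = 0) \<Longrightarrow>
    \<exists>C\<ge>0. \<forall>\<zeta> \<mu> \<tau>. \<bar>\<mu>\<bar> \<le> \<epsilon> / 2 \<longrightarrow> \<tau> \<noteq> 0 \<longrightarrow>
      cmod (LINT \<xi>|lborel. A (\<xi>, \<zeta>) * of_real (inverse (\<beta> (\<xi>, \<zeta>) - \<mu>) ^ j) * cis (\<tau> * (\<Phi> (\<xi>, \<zeta>) - \<mu> * \<xi>)))
        \<le> C / \<bar>\<tau>\<bar> ^ N"
proof -
  obtain L where L0: "0 < L" and L: "\<And>p. p \<in> K \<Longrightarrow> norm p \<le> L"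
    using compact_imp_bounded[OF K] by (auto simp: bounded_pos)
  have KL: "(\<xi>, \<zeta>) \<notin> K" if "L < \<bar>\<xi>\<bar>" for \<xi> \<zeta>
    using L[of "(\<xi>, \<zeta>)"] that norm_fst_le[of \<xi> \<zeta>] by auto
  define T where "T j A \<zeta> \<mu> \<tau> \<xi> =
      A (\<xi>, \<zeta>) * of_real (inverse (\<beta> (\<xi>, \<zeta>) - \<mu>) ^ j) * cis (\<tau> * (\<Phi> (\<xi>, \<zeta>) - \<mu> * \<xi>))"
    for j and A :: "real \<times> real \<Rightarrow> complex" and \<zeta> \<mu> \<tau> \<xi>
  have bound: "\<exists>M\<ge>0. \<forall>\<zeta> \<mu> \<tau> \<xi>. \<bar>\<mu>\<bar> \<le> \<epsilon> / 2 \<longrightarrow> cmod (T j A \<zeta> \<mu> \<tau> \<xi>) \<le> M * indicator {-L..L} \<xi>"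
    if A: "continuous_on UNIV A" and A0: "\<And>p. p \<notin> K \<Longrightarrow> A p = 0" for j A
  proof -
    have "compact (A ` K)"
      using A K by (intro compact_continuous_image) (auto intro: continuous_on_subset)
    then obtain M where M0: "0 < M" and M: "\<And>p. p \<in> K \<Longrightarrow> cmod (A p) \<le> M"
      using compact_imp_bounded[of "A ` K"] by (auto simp: bounded_pos)
    have "cmod (T j A \<zeta> \<mu> \<tau> \<xi>) \<le> (M * inverse (\<epsilon> / 2) ^ j) * indicator {-L..L} \<xi>"
      if "\<bar>\<mu>\<bar> \<le> \<epsilon> / 2" for \<zeta> \<mu> \<tau> \<xi>
    proof (cases "(\<xi>, \<zeta>) \<in> K")
      case True
      then have "\<epsilon> / 2 \<le> \<bar>\<beta> (\<xi>, \<zeta>) - \<mu>\<bar>" using \<epsilon>(2)[OF True] that by linarith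
      then have "\<bar>inverse (\<beta> (\<xi>, \<zeta>) - \<mu>)\<bar> \<le> inverse (\<epsilon> / 2)"
        using \<epsilon>(1) unfolding abs_inverse by (intro le_imp_inverse_le) auto
      then have "\<bar>inverse (\<beta> (\<xi>, \<zeta>) - \<mu>)\<bar> ^ j \<le> inverse (\<epsilon> / 2) ^ j"
        by (intro power_mono) auto
      then have "cmod (T j A \<zeta> \<mu> \<tau> \<xi>) \<le> M * inverse (\<epsilon> / 2) ^ j"
        unfolding T_def using M[OF True] M0 by (auto simp: norm_mult norm_power norm_inverse simp del: inverse_divide of_real_diff intro!: mult_mono)
      moreover have "\<xi> \<in> {-L..L}" using True KL[of \<xi> \<zeta>] by force
      ultimately show ?thesis by simp
    next
      case False
      then show ?thesis using M0 \<epsilon>(1) by (simp add: T_def A0)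
    qed
    moreover have "0 \<le> M * inverse (\<epsilon> / 2) ^ j" using M0 \<epsilon>(1) by simp
    ultimately show ?thesis by blast
  qed
  have cont_\<beta>: "continuous_on UNIV (\<lambda>x. \<beta> (x, \<zeta>))" "continuous_on UNIV (\<lambda>x. \<Phi> (x, \<zeta>))" for \<zeta>
    by (rule DERIV_continuous_on, rule has_field_derivative_at_within, rule \<beta> \<Phi>)+
  have intT: "integrable lborel (T j A \<zeta> \<mu> \<tau>)"
    if A: "continuous_on UNIV A" and A0: "\<And>p. p \<notin> K \<Longrightarrow> A p = 0" and \<mu>: "\<bar>\<mu>\<bar> \<le> \<epsilon> / 2" for j A \<zeta> \<mu> \<tau>
  proof -
    have "continuous_on UNIV (\<lambda>x. A (x, \<zeta>))"
      by (rule continuous_on_compose2[OF A]) (auto intro!: continuous_intros)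
    then have [measurable]: "(\<lambda>x. A (x, \<zeta>)) \<in> borel_measurable borel"
      "(\<lambda>x. \<beta> (x, \<zeta>)) \<in> borel_measurable borel" "(\<lambda>x. \<Phi> (x, \<zeta>)) \<in> borel_measurable borel"
      using cont_\<beta> by (auto intro: borel_measurable_continuous_onI)
    have "T j A \<zeta> \<mu> \<tau> \<in> borel_measurable borel"
      unfolding T_def by measurable
    moreover obtain M where "\<And>\<xi>. cmod (T j A \<zeta> \<mu> \<tau> \<xi>) \<le> M * indicator {-L..L} \<xi>"
      using bound[OF A A0, of j] \<mu> by blast
    ultimately show ?thesis by (rule integrable_bounded_support)
  qed
  have main: "Ck_fst N A \<Longrightarrow> (\<And>p. p \<notin> K \<Longrightarrow> A p = 0) \<Longrightarrow>
    \<exists>C\<ge>0. \<forall>\<zeta> \<mu> \<tau>. \<bar>\<mu>\<bar> \<le> \<epsilon> / 2 \<longrightarrow> \<tau> \<noteq> 0 \<longrightarrow> cmod (LINT \<xi>|lborel. T j A \<zeta> \<mu> \<tau> \<xi>) \<le> C / \<bar>\<tau>\<bar> ^ N"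
    for A j
  proof (induction N arbitrary: A j)
    case 0
    then obtain M where "0 \<le> M" and M: "\<And>\<zeta> \<mu> \<tau> \<xi>. \<bar>\<mu>\<bar> \<le> \<epsilon> / 2 \<Longrightarrow> cmod (T j A \<zeta> \<mu> \<tau> \<xi>) \<le> M * indicator {-L..L} \<xi>"
      using bound[of A j] unfolding Ck_fst.simps by blast
    then have "cmod (LINT \<xi>|lborel. T j A \<zeta> \<mu> \<tau> \<xi>) \<le> 2 * L * M" if "\<bar>\<mu>\<bar> \<le> \<epsilon> / 2" for \<zeta> \<mu> \<tau>
      using that L0 by (intro norm_LINT_bounded_support_le) auto
    with \<open>0 \<le> M\<close> L0 show ?case by (intro exI[of _ "2 * L * M"]) auto
  next
    case (Suc N)
    from Suc.prems(1) obtain A' where A': "Ck_fst N A'"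
      and dA: "\<And>\<xi> \<zeta>. ((\<lambda>x. A (x, \<zeta>)) has_vector_derivative A' (\<xi>, \<zeta>)) (at \<xi>)"
      by auto
    have A0: "A p = 0" if "p \<notin> K" for p using Suc.prems(2) that .
    \<comment> \<open>Openness means that an amplitude vanishing off \<open>K\<close> vanishes near
      every point off \<open>K\<close>, so its derivative is supported in \<open>K\<close> too and
      the induction hypothesis applies to it.\<close>
    have off: "open {x. (x, \<zeta>) \<notin> K}" for \<zeta>
      using compact_imp_closed[OF K] 
      by (auto simp: Collect_neg_eq intro!: open_Compl closed_vimage[where f = "\<lambda>x. (x, \<zeta>)" and s = K, unfolded vimage_def] continuous_intros)
    have A'0: "A' p = 0" if "p \<notin> K" for p
    proof -
      obtain \<xi> \<zeta> where p: "p = (\<xi>, \<zeta>)" by force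
      have "((\<lambda>x. 0) has_vector_derivative A' (\<xi>, \<zeta>)) (at \<xi>)"
        using that unfolding p
        by (intro has_vector_derivative_transform_within_open[OF dA off[of \<zeta>]]) (auto simp: A0)
      moreover have "((\<lambda>x. 0) has_vector_derivative 0) (at \<xi>)" by (rule has_vector_derivative_const)
      ultimately show ?thesis unfolding p by (rule vector_derivative_unique_at)
    qed
    define B where "B p = A p * of_real (\<beta>' p)" for p
    have B: "Ck_fst N B"
      unfolding B_def by (rule Ck_fst_mult[OF Ck_fst_Suc_imp[OF Suc.prems(1)] \<beta>'])
    have B0: "B p = 0" if "p \<notin> K" for p unfolding B_def using A0[OF that] by simp
    obtain C1 where C1: "0 \<le> C1" "\<And>\<zeta> \<mu> \<tau>. \<bar>\<mu>\<bar> \<le> \<epsilon> / 2 \<Longrightarrow> \<tau> \<noteq> 0 \<Longrightarrow> cmod (LINT \<xi>|lborel. T (Suc j) A' \<zeta> \<mu> \<tau> \<xi>) \<le> C1 / \<bar>\<tau>\<bar> ^ N"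
      using Suc.IH[OF A' A'0] by blast
    obtain C2 where C2: "0 \<le> C2" "\<And>\<zeta> \<mu> \<tau>. \<bar>\<mu>\<bar> \<le> \<epsilon> / 2 \<Longrightarrow> \<tau> \<noteq> 0 \<Longrightarrow> cmod (LINT \<xi>|lborel. T (j + 2) B \<zeta> \<mu> \<tau> \<xi>) \<le> C2 / \<bar>\<tau>\<bar> ^ N"
      using Suc.IH[OF B B0] by blast
    have "cmod (LINT \<xi>|lborel. T j A \<zeta> \<mu> \<tau> \<xi>) \<le> (C1 + real (Suc j) * C2) / \<bar>\<tau>\<bar> ^ Suc N"
      if \<mu>: "\<bar>\<mu>\<bar> \<le> \<epsilon> / 2" and \<tau>: "\<tau> \<noteq> 0" for \<zeta> \<mu> \<tau>
    proof -
      \<comment> \<open>\<open>F'\<close> is the derivative of \<open>T (Suc j) A\<close>. The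
        additional inverse power is there because the phase releases the factor tau (beta - mu),
        which cancels it and returns \<open>T j A\<close>; the middle term comes from
        differentiating that inverse power.\<close>
      define F' where "F' \<xi> = T (Suc j) A' \<zeta> \<mu> \<tau> \<xi> - of_nat (Suc j) * T (j + 2) B \<zeta> \<mu> \<tau> \<xi>
        + \<i> * of_real \<tau> * T j A \<zeta> \<mu> \<tau> \<xi>" for \<xi>
      have i1: "integrable lborel (T (Suc j) A' \<zeta> \<mu> \<tau>)"
        by (rule intT[OF Ck_fst_continuous[OF A'] A'0 \<mu>])
      have i2: "integrable lborel (T (j + 2) B \<zeta> \<mu> \<tau>)"
        by (rule intT[OF Ck_fst_continuous[OF B] B0 \<mu>])
      have i3: "integrable lborel (T j A \<zeta> \<mu> \<tau>)"
        by (rule intT[OF Ck_fst_continuous[OF Suc.prems(1)] A0 \<mu>])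
      have dF: "(T (Suc j) A \<zeta> \<mu> \<tau> has_vector_derivative F' \<xi>) (at \<xi>)" for \<xi>
      proof (cases "(\<xi>, \<zeta>) \<in> K")
        case True
        then have nz: "\<beta> (\<xi>, \<zeta>) - \<mu> \<noteq> 0" using \<epsilon>(1) \<epsilon>(2)[OF True] \<mu> by auto
        define u where "u = inverse (\<beta> (\<xi>, \<zeta>) - \<mu>)"
        have "((\<lambda>x. inverse (\<beta> (x, \<zeta>) - \<mu>) ^ Suc j) has_real_derivative
            (- (real (Suc j) * \<beta>' (\<xi>, \<zeta>) * u ^ (j + 2)))) (at \<xi>)"
        proof -
          have "((\<lambda>x. \<beta> (x, \<zeta>) - \<mu>) has_real_derivative \<beta>' (\<xi>, \<zeta>)) (at \<xi>)"
            using DERIV_diff[OF \<beta> DERIV_const] by simp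
          from DERIV_inverse'[OF this nz]
          have "((\<lambda>x. inverse (\<beta> (x, \<zeta>) - \<mu>)) has_real_derivative - (u * \<beta>' (\<xi>, \<zeta>) * u)) (at \<xi>)"
            by (simp add: u_def)
          from DERIV_power_Suc[OF this, of j] show ?thesis
            by (simp add: u_def mult_ac)
        qed
        then have d1: "((\<lambda>x. of_real (inverse (\<beta> (x, \<zeta>) - \<mu>) ^ Suc j)) has_vector_derivative
            complex_of_real (- (real (Suc j) * \<beta>' (\<xi>, \<zeta>) * u ^ (j + 2)))) (at \<xi>)"
          by (intro has_vector_derivative_of_real) (simp add: has_real_derivative_iff_has_vector_derivative)
        have d2: "((\<lambda>x. cis (\<tau> * (\<Phi> (x, \<zeta>) - \<mu> * x))) has_vector_derivative
            (\<i> * of_real (\<tau> * (\<beta> (\<xi>, \<zeta>) - \<mu>)) * cis (\<tau> * (\<Phi> (\<xi>, \<zeta>) - \<mu> * \<xi>)))) (at \<xi>)"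
          by (rule has_vector_derivative_cis_compose) (auto intro!: derivative_eq_intros \<Phi>)
        have u1: "complex_of_real (\<beta> (\<xi>, \<zeta>) - \<mu>) * of_real (u ^ Suc j) = of_real (u ^ j)"
        proof -
          have "(\<beta> (\<xi>, \<zeta>) - \<mu>) * u ^ Suc j = u ^ j" using nz by (simp add: u_def)
          then show ?thesis by (simp only: of_real_mult[symmetric])
        qed
        have "F' \<xi> = A (\<xi>, \<zeta>) * of_real (u ^ Suc j) * (\<i> * of_real (\<tau> * (\<beta> (\<xi>, \<zeta>) - \<mu>)) * cis (\<tau> * (\<Phi> (\<xi>, \<zeta>) - \<mu> * \<xi>)))
          + (A (\<xi>, \<zeta>) * complex_of_real (- (real (Suc j) * \<beta>' (\<xi>, \<zeta>) * u ^ (j + 2))) + A' (\<xi>, \<zeta>) * of_real (u ^ Suc j)) * cis (\<tau> * (\<Phi> (\<xi>, \<zeta>) - \<mu> * \<xi>))"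
          unfolding F'_def T_def B_def u_def[symmetric] u1[symmetric]
          by (simp add: distrib_left distrib_right right_diff_distrib[where a = "cis z" for z] mult_ac del: of_real_diff of_real_power power_Suc of_nat_Suc)
        then show ?thesis
          unfolding T_def u_def
          using has_vector_derivative_mult[OF has_vector_derivative_mult[OF dA d1] d2] by (simp only: u_def)
      next
        case False
        have "((\<lambda>x. 0) has_vector_derivative 0) (at \<xi>)" by (rule has_vector_derivative_const)
        then have "(T (Suc j) A \<zeta> \<mu> \<tau> has_vector_derivative 0) (at \<xi>)"
          by (rule has_vector_derivative_transform_within_open[OF _ off[of \<zeta>]]) (use False in \<open>auto simp: T_def A0\<close>)
        moreover have "F' \<xi> = 0" unfolding F'_def T_def using False by (simp add: A0 A'0 B0)
        ultimately show ?thesis by simp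
      qed
      have "(LINT \<xi>|lborel. F' \<xi>) = 0"
      proof (rule LINT_deriv_compact_support_eq_0[OF dF])
        show "integrable lborel F'" unfolding F'_def using i1 i2 i3 by auto
        show "T (Suc j) A \<zeta> \<mu> \<tau> x = 0" "F' x = 0" if "L < \<bar>x\<bar>" for x
          unfolding F'_def T_def using KL[OF that, of \<zeta>] by (simp_all add: A0 A'0 B0)
      qed
      moreover have "(LINT \<xi>|lborel. F' \<xi>) = (LINT \<xi>|lborel. T (Suc j) A' \<zeta> \<mu> \<tau> \<xi>)
          - of_nat (Suc j) * (LINT \<xi>|lborel. T (j + 2) B \<zeta> \<mu> \<tau> \<xi>) + \<i> * of_real \<tau> * (LINT \<xi>|lborel. T j A \<zeta> \<mu> \<tau> \<xi>)"
        unfolding F'_def using i1 i2 i3 by (simp del: of_nat_Suc)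
      ultimately have "\<i> * of_real \<tau> * (LINT \<xi>|lborel. T j A \<zeta> \<mu> \<tau> \<xi>) =
          of_nat (Suc j) * (LINT \<xi>|lborel. T (j + 2) B \<zeta> \<mu> \<tau> \<xi>) - (LINT \<xi>|lborel. T (Suc j) A' \<zeta> \<mu> \<tau> \<xi>)"
        by (simp add: algebra_simps)
      then have "\<bar>\<tau>\<bar> * cmod (LINT \<xi>|lborel. T j A \<zeta> \<mu> \<tau> \<xi>) =
          cmod (of_nat (Suc j) * (LINT \<xi>|lborel. T (j + 2) B \<zeta> \<mu> \<tau> \<xi>) - (LINT \<xi>|lborel. T (Suc j) A' \<zeta> \<mu> \<tau> \<xi>))"
        by (metis (no_types) mult_1 norm_ii norm_mult norm_of_real)
      also have "\<dots> \<le> real (Suc j) * cmod (LINT \<xi>|lborel. T (j + 2) B \<zeta> \<mu> \<tau> \<xi>) + cmod (LINT \<xi>|lborel. T (Suc j) A' \<zeta> \<mu> \<tau> \<xi>)"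
        by (rule order_trans[OF norm_triangle_ineq4]) (simp add: norm_mult del: of_nat_Suc)
      also have "\<dots> \<le> real (Suc j) * (C2 / \<bar>\<tau>\<bar> ^ N) + C1 / \<bar>\<tau>\<bar> ^ N"
        using C1(2)[OF \<mu> \<tau>] C2(2)[OF \<mu> \<tau>] by (intro add_mono mult_left_mono) auto
      finally show ?thesis using \<tau> by (simp add: field_simps)
    qed
    moreover have "0 \<le> C1 + real (Suc j) * C2" using C1(1) C2(1) by simp
    ultimately show ?case by blast
  qed
  show "Ck_fst N A \<Longrightarrow> (\<And>p. p \<notin> K \<Longrightarrow> A p = 0) \<Longrightarrow>
    \<exists>C\<ge>0. \<forall>\<zeta> \<mu> \<tau>. \<bar>\<mu>\<bar> \<le> \<epsilon> / 2 \<longrightarrow> \<tau> \<noteq> 0 \<longrightarrow>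
      cmod (LINT \<xi>|lborel. A (\<xi>, \<zeta>) * of_real (inverse (\<beta> (\<xi>, \<zeta>) - \<mu>) ^ j) * cis (\<tau> * (\<Phi> (\<xi>, \<zeta>) - \<mu> * \<xi>)))
        \<le> C / \<bar>\<tau>\<bar> ^ N"
    by (rule main[unfolded T_def])
qed

section \<open>Dispersive decay at a fixed interaction time\<close>

lemma smooth_fun_DERIV:
  assumes "smooth_fun f"
  shows "((deriv ^^ k) f has_real_derivative (deriv ^^ Suc k) f x) (at x)"
  using assms by (simp add: smooth_fun_def DERIV_deriv_iff_real_differentiable)

lemma smooth_fun_continuous_on:
  assumes "smooth_fun f"
  shows "continuous_on A ((deriv ^^ k) f)"
  by (rule DERIV_continuous_on, rule has_field_derivative_at_within, rule smooth_fun_DERIV[OF assms])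

lemma norm_LINT_mult_le_L2:
  fixes V W :: "real \<Rightarrow> complex"
  assumes [measurable]: "V \<in> borel_measurable borel" "W \<in> borel_measurable borel"
    and V: "L2sq V \<le> ennreal (v\<^sup>2)" and W: "L2sq W \<le> ennreal (w\<^sup>2)" and vw: "0 \<le> v" "0 \<le> w"
  shows "cmod (LINT x|lborel. V x * W x) \<le> v * w"
proof (cases "integrable lborel (\<lambda>x. V x * W x)")
  case True
  have "(ennreal (cmod (LINT x|lborel. V x * W x)))\<^sup>2 \<le> (\<integral>\<^sup>+ x. ennreal (cmod (V x * W x)) \<partial>lborel)\<^sup>2"
    by (intro power_mono integral_norm_bound_ennreal[OF True]) auto
  also have "\<dots> = (\<integral>\<^sup>+ x. ennreal (cmod (V x)) * ennreal (cmod (W x)) \<partial>lborel)\<^sup>2"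
    by (simp add: norm_mult ennreal_mult')
  also have "\<dots> \<le> (\<integral>\<^sup>+ x. (ennreal (cmod (V x)))\<^sup>2 \<partial>lborel) * (\<integral>\<^sup>+ x. (ennreal (cmod (W x)))\<^sup>2 \<partial>lborel)"
    by (rule Cauchy_Schwarz_nn_integral) auto
  also have "\<dots> = L2sq V * L2sq W" by (simp add: L2sq_def ennreal_power)
  also have "\<dots> \<le> ennreal (v\<^sup>2) * ennreal (w\<^sup>2)" by (intro mult_mono V W) auto
  also have "\<dots> = ennreal ((v * w)\<^sup>2)" by (simp add: ennreal_mult'[symmetric] power_mult_distrib)
  finally have "(cmod (LINT x|lborel. V x * W x))\<^sup>2 \<le> (v * w)\<^sup>2"
    by (simp add: ennreal_power)
  then show ?thesis by (rule power2_le_imp_le) (use vw in simp)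
qed (use vw in \<open>simp add: not_integrable_integral_eq\<close>)

lemma nn_integral_abs_powr_finite:
  assumes \<theta>: "\<theta> < 1" and L: "0 \<le> L"
  shows "(\<integral>\<^sup>+ y. ennreal (\<bar>y\<bar> powr (- \<theta>)) * indicator {-L..L} y \<partial>lborel) < \<infinity>"
proof -
  have half: "(\<integral>\<^sup>+ y. ennreal (y powr (- \<theta>)) * indicator {0..L} y \<partial>lborel) = ennreal (L powr (1 - \<theta>) / (1 - \<theta>))"
  proof -
    have "((\<lambda>y. y powr (- \<theta>)) has_integral (L powr (- \<theta> + 1) / (- \<theta> + 1))) {0..L}"
      using \<theta> L by (intro has_integral_powr_from_0) auto
    then have "(\<integral>\<^sup>+ y. ennreal (indicator {0..L} y * y powr (- \<theta>)) \<partial>lborel) = ennreal (L powr (- \<theta> + 1) / (- \<theta> + 1))"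
      by (intro nn_integral_has_integral_lebesgue) auto
    moreover have "ennreal (indicator {0..L} y * y powr (- \<theta>)) = ennreal (y powr (- \<theta>)) * indicator {0..L} y" for y
      by (auto simp: indicator_def)
    ultimately show ?thesis by simp
  qed
  define h where "h y = ennreal (y powr (- \<theta>)) * indicator {0..L} y" for y :: real
  have [measurable]: "h \<in> borel_measurable borel" unfolding h_def by measurable
  have "(\<integral>\<^sup>+ y. ennreal (\<bar>y\<bar> powr (- \<theta>)) * indicator {-L..L} y \<partial>lborel) \<le> (\<integral>\<^sup>+ y. h y + h (0 - y) \<partial>lborel)"
    by (intro nn_integral_mono) (auto simp: h_def indicator_def abs_if)
  also have "\<dots> = (\<integral>\<^sup>+ y. h y \<partial>lborel) + (\<integral>\<^sup>+ y. h (0 - y) \<partial>lborel)"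
    by (rule nn_integral_add) measurable
  also have "\<dots> = (\<integral>\<^sup>+ y. h y \<partial>lborel) + (\<integral>\<^sup>+ y. h y \<partial>lborel)"
    by (simp only: nn_integral_lborel_diff[of h 0, OF \<open>h \<in> borel_measurable borel\<close>])
  also have "\<dots> < \<infinity>" using half by (simp add: h_def)
  finally show ?thesis .
qed

text \<open>The hypotheses with their constants extracted once, so that everything below is uniform
  in f, g and t. \<open>D j k\<close> are the mixed partial derivatives of the symbol, and
  \<open>\<epsilon>\<close> is the quantitative absence of space resonances: in the difference of
  the two partial derivatives of the phase the terms from \<open>a\<close> cancel, and b'(xi) -
  c'(eta) remains.\<close>

locale interaction =
  fixes a b c :: "real \<Rightarrow> real" and m :: "real \<times> real \<Rightarrow> complex"
    and D :: "nat \<Rightarrow> nat \<Rightarrow> real \<times> real \<Rightarrow> complex" and L M \<kappa> \<epsilon> :: real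
  assumes a: "smooth_fun a" and b: "smooth_fun b" and c: "smooth_fun c"
    and \<kappa>: "0 < \<kappa>" "\<And>x. \<kappa> \<le> \<bar>deriv (deriv a) x\<bar>"
    and D0: "D 0 0 = m" and D_cont: "\<And>j k. continuous_on UNIV (D j k)"
    and D_fst: "\<And>j k x y. ((\<lambda>x'. D j k (x', y)) has_vector_derivative D (Suc j) k (x, y)) (at x)"
    and D_snd: "\<And>j k x y. ((\<lambda>y'. D j k (x, y')) has_vector_derivative D j (Suc k) (x, y)) (at y)"
    and supp_compact: "compact (supp m)"
    and L: "0 < L" "\<And>\<xi> \<eta>. m (\<xi>, \<eta>) \<noteq> 0 \<Longrightarrow> \<bar>\<xi>\<bar> \<le> L \<and> \<bar>\<eta>\<bar> \<le> L"
    and M: "0 < M" "\<And>p. cmod (m p) \<le> M"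
    and \<epsilon>: "0 < \<epsilon>" "\<And>\<xi> \<eta>. (\<xi>, \<eta>) \<in> supp m \<Longrightarrow> \<epsilon> \<le> \<bar>deriv b \<xi> - deriv c \<eta>\<bar>"
begin

lemma m_measurable [measurable]: "m \<in> borel_measurable borel"
  using D_cont[of 0 0] unfolding D0 by (rule borel_measurable_continuous_onI)

lemma m_measurable_pair [measurable]: "m \<in> borel_measurable (lborel \<Otimes>\<^sub>M lborel)"
  by (simp add: lborel_prod)

lemma abc_measurable [measurable]:
  "a \<in> borel_measurable borel" "b \<in> borel_measurable borel" "c \<in> borel_measurable borel"
  using smooth_fun_continuous_on[OF a, of UNIV 0] smooth_fun_continuous_on[OF b, of UNIV 0]
    smooth_fun_continuous_on[OF c, of UNIV 0]
  by (auto intro: borel_measurable_continuous_onI)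

lemma m_bound: "cmod (m (\<xi>, \<eta>)) \<le> M * indicator {-L..L} \<xi> * indicator {-L..L} \<eta>"
  using L(2)[of \<xi> \<eta>] M by (cases "m (\<xi>, \<eta>) = 0") (auto simp: indicator_def)

text \<open>The kernel in (xi, xi') of T*T for the operator with kernel e^(i(y(xi+eta) + s
  a(xi+eta))) m(xi, eta). The phase difference s (a(xi+eta) - a(xi'+eta)) has eta-derivative at
  least s \<open>\<kappa>\<close> |xi - xi'| by the mean value theorem, so one integration by parts
  in eta gains 1/(s |xi - xi'|). The linear term in y only contributes a factor independent of eta,
  whence the uniformity in y.\<close>

lemma dispersive_kernel:
  "\<exists>C\<ge>0. \<forall>s y \<xi> \<xi>'. 0 < s \<longrightarrow>
    cmod (LINT \<eta>|lborel. cis (y * (\<xi> + \<eta>) + s * a (\<xi> + \<eta>)) * m (\<xi>, \<eta>) *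
        cnj (cis (y * (\<xi>' + \<eta>) + s * a (\<xi>' + \<eta>)) * m (\<xi>', \<eta>)))
      \<le> C / (1 + s * \<bar>\<xi> - \<xi>'\<bar>)"
proof -
  define a1 a2 a3 where "a1 = deriv a" and "a2 = deriv a1" and "a3 = deriv a2"
  have da: "(a has_real_derivative a1 x) (at x)" "(a1 has_real_derivative a2 x) (at x)"
    "(a2 has_real_derivative a3 x) (at x)" for x
    using smooth_fun_DERIV[OF a, of 0 x] smooth_fun_DERIV[OF a, of 1 x] smooth_fun_DERIV[OF a, of 2 x]
    by (auto simp: a1_def a2_def a3_def eval_nat_numeral)
  \<comment> \<open>The sum of two frequencies in [-L, L] stays in [-2L, 2L]; only there is a bound
    on the third derivative available.\<close>
  have "continuous_on {-2*L..2*L} a3"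
    using smooth_fun_continuous_on[OF a, of _ 3] by (simp add: a1_def a2_def a3_def eval_nat_numeral)
  then have "compact (a3 ` {-2*L..2*L})" by (intro compact_continuous_image) auto
  then obtain A3 where A3: "0 < A3" "\<And>x. x \<in> {-2*L..2*L} \<Longrightarrow> \<bar>a3 x\<bar> \<le> A3"
    using compact_imp_bounded[of "a3 ` {-2*L..2*L}"] by (auto simp: bounded_pos)
  have "compact (D 0 1 ` ({-L..L} \<times> {-L..L}))"
    by (intro compact_continuous_image compact_Times continuous_on_subset[OF D_cont]) auto
  then obtain M1 where M1: "0 < M1" "\<And>p. p \<in> {-L..L} \<times> {-L..L} \<Longrightarrow> cmod (D 0 1 p) \<le> M1"
    using compact_imp_bounded[of "D 0 1 ` ({-L..L} \<times> {-L..L})"] by (auto simp: bounded_pos)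
  \<comment> \<open>Length of the integration interval times the two remainder terms of one
    integration by parts: derivative on the amplitude, of size 2 M M1 / kappa, and derivative on the
    denominator, of size M^2 A3 / kappa^2. \<open>C\<close> adds the trivial bound, which covers
    small s |xi - xi'|.\<close>
  define C1 where "C1 = 2 * L * (2 * M * M1 / \<kappa> + M * M * A3 / \<kappa>\<^sup>2)"
  define C where "C = C1 + 2 * L * (M * M)"
  have C10: "0 \<le> C1" unfolding C1_def using L M M1 A3 \<kappa> by simp
  have C0: "0 \<le> C" unfolding C_def using C10 L M by simp
  have main: "cmod (LINT \<eta>|lborel. m (\<xi>, \<eta>) * cnj (m (\<xi>', \<eta>)) * cis (s * (a (\<xi> + \<eta>) - a (\<xi>' + \<eta>))))
      \<le> C / (1 + s * \<bar>\<xi> - \<xi>'\<bar>)" if s: "0 < s" for s \<xi> \<xi>'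
  proof (cases "\<bar>\<xi>\<bar> \<le> L \<and> \<bar>\<xi>'\<bar> \<le> L")
    case False
    then have "m (\<xi>, \<eta>) * cnj (m (\<xi>', \<eta>)) = 0" for \<eta>
      using L(2) by auto
    then show ?thesis using C0 s by (simp only: mult_zero_left) simp
  next
    case True
    define G where "G \<eta> = m (\<xi>, \<eta>) * cnj (m (\<xi>', \<eta>))" for \<eta>
    define G' where "G' \<eta> = D 0 1 (\<xi>, \<eta>) * cnj (m (\<xi>', \<eta>)) + m (\<xi>, \<eta>) * cnj (D 0 1 (\<xi>', \<eta>))" for \<eta>
    define E where "E \<eta> = cis (s * (a (\<xi> + \<eta>) - a (\<xi>' + \<eta>)))" for \<eta>
    define J where "J = (LINT \<eta>|lborel. G \<eta> * E \<eta>)"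
    have "D 0 1 \<in> borel_measurable borel"
      using D_cont[of 0 1] by (rule borel_measurable_continuous_onI)
    then have [measurable]: "D 0 1 \<in> borel_measurable (borel \<Otimes>\<^sub>M borel)" "m \<in> borel_measurable (borel \<Otimes>\<^sub>M borel)"
      by (auto simp: borel_prod)
    have [measurable]: "E \<in> borel_measurable borel" unfolding E_def by measurable
    have [measurable]: "G \<in> borel_measurable borel" unfolding G_def by measurable
    have [measurable]: "G' \<in> borel_measurable borel" unfolding G'_def by measurable
    have Gb: "cmod (G \<eta>) \<le> M * M * indicator {-L..L} \<eta>" for \<eta>
    proof (cases "\<bar>\<eta>\<bar> \<le> L")
      case True
      then show ?thesis using M by (auto simp: G_def norm_mult indicator_def intro!: mult_mono)
    next
      case False
      then have "m (\<xi>, \<eta>) = 0" using L(2) by blast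
      then show ?thesis using M by (simp add: G_def)
    qed
    have G'b: "cmod (G' \<eta>) \<le> 2 * M * M1 * indicator {-L..L} \<eta>" for \<eta>
    proof (cases "\<bar>\<eta>\<bar> \<le> L")
      case in_L: True
      have "cmod (G' \<eta>) \<le> cmod (D 0 1 (\<xi>, \<eta>) * cnj (m (\<xi>', \<eta>))) + cmod (m (\<xi>, \<eta>) * cnj (D 0 1 (\<xi>', \<eta>)))"
        unfolding G'_def by (rule norm_triangle_ineq)
      also have "\<dots> \<le> M1 * M + M * M1"
      proof -
        have "cmod (D 0 1 (\<xi>, \<eta>)) \<le> M1" "cmod (D 0 1 (\<xi>', \<eta>)) \<le> M1"
          using True in_L by (auto intro!: M1(2) simp del: One_nat_def)
        then show ?thesis
          unfolding norm_mult complex_mod_cnj using M M1(1)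
          by (intro add_mono mult_mono) auto
      qed
      finally show ?thesis using in_L by (auto simp: indicator_def)
    next
      case False
      then have "m (\<xi>, \<eta>) = 0" "m (\<xi>', \<eta>) = 0" using L(2) by blast+
      then show ?thesis using M M1 by (simp add: G'_def)
    qed
    have triv: "cmod J \<le> 2 * L * (M * M)"
      unfolding J_def using Gb L M by (intro norm_LINT_bounded_support_le) (auto simp: norm_mult E_def)
    have decay: "cmod J * (s * \<bar>\<xi> - \<xi>'\<bar>) \<le> C1"
    proof (cases "\<xi> = \<xi>'")
      case neq: False
      define y where "y = \<bar>\<xi> - \<xi>'\<bar>"
      have y: "0 < y" using neq by (simp add: y_def)
      \<comment> \<open>\<open>\<Delta>\<close> is at least kappa y while \<open>\<Delta>'\<close>
        is at most A3 y. So both 1/\<open>\<Delta>\<close> and the quotient of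
        \<open>\<Delta>'\<close> by the square of \<open>\<Delta>\<close> are O(1/y), which is why a
        single integration by parts loses nothing as y tends to 0.\<close>
      define \<Delta> where "\<Delta> \<eta> = a1 (\<xi> + \<eta>) - a1 (\<xi>' + \<eta>)" for \<eta>
      define \<Delta>' where "\<Delta>' \<eta> = a2 (\<xi> + \<eta>) - a2 (\<xi>' + \<eta>)" for \<eta>
      have \<Delta>_lower: "\<kappa> * y \<le> \<bar>\<Delta> \<eta>\<bar>" for \<eta>
      proof -
        have *: "\<kappa> * \<bar>u - v\<bar> \<le> \<bar>a1 u - a1 v\<bar>" if uv: "v < u" for u v
        proof -
          obtain z where "a1 u - a1 v = (u - v) * a2 z"
            using MVT2[OF uv, of a1 a2] da(2) by blast
          then show ?thesis using \<kappa>(2)[of z] uv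
            by (simp add: abs_mult a2_def a1_def mult.commute mult_right_mono)
        qed
        show ?thesis
          using *[of "\<xi>' + \<eta>" "\<xi> + \<eta>"] *[of "\<xi> + \<eta>" "\<xi>' + \<eta>"] neq
          unfolding \<Delta>_def y_def by (cases "\<xi> < \<xi>'") (auto simp: abs_minus_commute)
      qed
      have \<Delta>nz: "\<Delta> \<eta> \<noteq> 0" for \<eta> using \<Delta>_lower[of \<eta>] \<kappa>(1) y by (metis abs_zero mult_pos_pos not_le)
      have \<Delta>'_upper: "\<bar>\<Delta>' \<eta>\<bar> \<le> A3 * y" if "\<bar>\<eta>\<bar> \<le> L" for \<eta>
      proof -
        have *: "\<bar>a2 u - a2 v\<bar> \<le> A3 * \<bar>u - v\<bar>" if uv: "v < u" "v \<in> {-2*L..2*L}" "u \<in> {-2*L..2*L}" for u v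
        proof -
          obtain z where "v < z" "z < u" "a2 u - a2 v = (u - v) * a3 z"
            using MVT2[OF uv(1), of a2 a3] da(3) by blast
          then show ?thesis using A3(2)[of z] uv by (simp add: abs_mult mult.commute mult_right_mono)
        qed
        show ?thesis
          using *[of "\<xi>' + \<eta>" "\<xi> + \<eta>"] *[of "\<xi> + \<eta>" "\<xi>' + \<eta>"] neq that True
          unfolding \<Delta>'_def y_def by (cases "\<xi> < \<xi>'") (auto simp: abs_minus_commute)
      qed
      have cont1: "continuous_on UNIV (\<lambda>\<eta>. a1 (r + \<eta>))" "continuous_on UNIV (\<lambda>\<eta>. a2 (r + \<eta>))" for r
        using smooth_fun_continuous_on[OF a, of UNIV 1] smooth_fun_continuous_on[OF a, of UNIV 2]
        by (auto simp: a1_def a2_def eval_nat_numeral intro!: continuous_on_compose2[of UNIV _ UNIV "\<lambda>\<eta>. r + \<eta>"] continuous_intros)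
      then have [measurable]: "\<Delta> \<in> borel_measurable borel" "\<Delta>' \<in> borel_measurable borel"
        unfolding \<Delta>_def \<Delta>'_def by (auto intro!: borel_measurable_continuous_onI continuous_on_diff)
      \<comment> \<open>\<open>R\<close> collects the terms where the derivative does not fall on
        the oscillating factor. In the remaining term \<open>\<Delta>\<close> cancels, leaving i s
        times the integrand of \<open>J\<close>.\<close>
      define R where "R \<eta> = (G' \<eta> * of_real (inverse (\<Delta> \<eta>)) - G \<eta> * of_real (\<Delta>' \<eta> * (inverse (\<Delta> \<eta>))\<^sup>2)) * E \<eta>" for \<eta>
      define F' where "F' \<eta> = R \<eta> + \<i> * of_real s * (G \<eta> * E \<eta>)" for \<eta>
      have inv\<Delta>: "\<bar>inverse (\<Delta> \<eta>)\<bar> \<le> 1 / (\<kappa> * y)" for \<eta>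
        unfolding abs_inverse divide_inverse mult_1 using \<Delta>_lower[of \<eta>] \<kappa>(1) y
        by (intro le_imp_inverse_le) auto
      have Rb: "cmod (R \<eta>) \<le> (C1 / (2 * L) / y) * indicator {-L..L} \<eta>" for \<eta>
      proof (cases "\<bar>\<eta>\<bar> \<le> L")
        case in_L: True
        have "cmod (R \<eta>) \<le> cmod (G' \<eta>) * \<bar>inverse (\<Delta> \<eta>)\<bar> + cmod (G \<eta>) * (\<bar>\<Delta>' \<eta>\<bar> * \<bar>inverse (\<Delta> \<eta>)\<bar>\<^sup>2)"
          unfolding R_def E_def norm_mult norm_cis mult_1_right
          by (rule order_trans[OF norm_triangle_ineq4]) (simp add: norm_mult abs_mult norm_inverse norm_power)
        also have "\<dots> \<le> (2 * M * M1) * (1 / (\<kappa> * y)) + (M * M) * ((A3 * y) * (1 / (\<kappa> * y))\<^sup>2)"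
        proof -
          have "cmod (G' \<eta>) \<le> 2 * M * M1" "cmod (G \<eta>) \<le> M * M"
            using G'b[of \<eta>] Gb[of \<eta>] in_L by (simp_all add: indicator_def abs_le_iff minus_le_iff)
          then show ?thesis
            using inv\<Delta>[of \<eta>] \<Delta>'_upper[OF in_L] M M1 A3 y \<kappa>
            by (intro add_mono mult_mono power_mono) auto
        qed
        also have "\<dots> = C1 / (2 * L) / y"
          unfolding C1_def using y \<kappa> L by (simp add: field_simps power2_eq_square)
        finally show ?thesis using in_L by (auto simp: indicator_def)
      next
        case False
        then have "indicator {-L..L} \<eta> = (0::real)" by (auto simp: indicator_def)
        then have "G \<eta> = 0" "G' \<eta> = 0" using Gb[of \<eta>] G'b[of \<eta>] by simp_all
        then show ?thesis using C10 L y by (simp add: R_def)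
      qed
      have intR: "integrable lborel R"
        by (rule integrable_bounded_support[OF _ Rb]) (unfold R_def, measurable)
      have intGE: "integrable lborel (\<lambda>\<eta>. G \<eta> * E \<eta>)"
        by (rule integrable_bounded_support[where B = "M * M" and L = L]) (use Gb in \<open>auto simp: norm_mult E_def\<close>)
      have dF: "((\<lambda>\<eta>. G \<eta> * of_real (inverse (\<Delta> \<eta>)) * E \<eta>) has_vector_derivative F' \<eta>) (at \<eta>)" for \<eta>
      proof -
        have dG: "(G has_vector_derivative G' \<eta>) (at \<eta>)"
          unfolding G_def G'_def
          using has_vector_derivative_mult[OF D_snd[of 0 0 \<xi> \<eta>] has_vector_derivative_cnj[OF D_snd[of 0 0 \<xi>' \<eta>]]]
          by (simp add: D0 add.commute)
        have d\<Delta>: "(\<Delta> has_real_derivative \<Delta>' \<eta>) (at \<eta>)"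
          unfolding \<Delta>_def \<Delta>'_def
          using da(2)[of "\<xi> + \<eta>"] da(2)[of "\<xi>' + \<eta>"]
          by (intro DERIV_diff) (simp_all add: DERIV_shift[of a1 _ _ \<xi>] DERIV_shift[of a1 _ _ \<xi>'] add.commute)
        have "((\<lambda>\<eta>. inverse (\<Delta> \<eta>)) has_real_derivative (- (\<Delta>' \<eta> * (inverse (\<Delta> \<eta>))\<^sup>2))) (at \<eta>)"
          using DERIV_inverse'[OF d\<Delta> \<Delta>nz] by (simp add: power2_eq_square mult_ac)
        then have di: "((\<lambda>\<eta>. of_real (inverse (\<Delta> \<eta>))) has_vector_derivative complex_of_real (- (\<Delta>' \<eta> * (inverse (\<Delta> \<eta>))\<^sup>2))) (at \<eta>)"
          by (intro has_vector_derivative_of_real) (simp add: has_real_derivative_iff_has_vector_derivative)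
        have "((\<lambda>\<eta>. a (\<xi> + \<eta>) - a (\<xi>' + \<eta>)) has_real_derivative \<Delta> \<eta>) (at \<eta>)"
          unfolding \<Delta>_def
          using da(1)[of "\<xi> + \<eta>"] da(1)[of "\<xi>' + \<eta>"]
          by (intro DERIV_diff) (simp_all add: DERIV_shift[of a _ _ \<xi>] DERIV_shift[of a _ _ \<xi>'] add.commute)
        then have dE: "(E has_vector_derivative (\<i> * of_real (s * \<Delta> \<eta>) * E \<eta>)) (at \<eta>)"
          unfolding E_def by (intro has_vector_derivative_cis_compose DERIV_cmult)
        have c1: "complex_of_real (\<Delta> \<eta>) * complex_of_real (inverse (\<Delta> \<eta>)) = 1"
          using \<Delta>nz[of \<eta>] by simp
        have "F' \<eta> = G \<eta> * of_real (inverse (\<Delta> \<eta>)) * (\<i> * of_real (s * \<Delta> \<eta>) * E \<eta>) +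
            (G \<eta> * complex_of_real (- (\<Delta>' \<eta> * (inverse (\<Delta> \<eta>))\<^sup>2)) + G' \<eta> * of_real (inverse (\<Delta> \<eta>))) * E \<eta>"
        proof -
          have eq: "G \<eta> * of_real (inverse (\<Delta> \<eta>)) * (\<i> * of_real (s * \<Delta> \<eta>) * E \<eta>)
              = \<i> * of_real s * (G \<eta> * E \<eta>) * (complex_of_real (\<Delta> \<eta>) * complex_of_real (inverse (\<Delta> \<eta>)))"
            by (simp add: mult_ac)
          show ?thesis unfolding F'_def R_def eq c1
            by (simp add: left_diff_distrib distrib_right)
        qed
        then show ?thesis
          using has_vector_derivative_mult[OF has_vector_derivative_mult[OF dG di] dE] by simp
      qed
      have "(LINT \<eta>|lborel. F' \<eta>) = 0"
      proof (rule LINT_deriv_compact_support_eq_0[OF dF])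
        show "integrable lborel F'" unfolding F'_def using intR intGE by auto
        show "G x * of_real (inverse (\<Delta> x)) * E x = 0" if "L < \<bar>x\<bar>" for x
        proof -
          from that have "indicator {-L..L} x = (0::real)" by (auto simp: indicator_def)
          with Gb[of x] show ?thesis by simp
        qed
        show "F' x = 0" if "L < \<bar>x\<bar>" for x
        proof -
          from that have "indicator {-L..L} x = (0::real)" by (auto simp: indicator_def)
          with Gb[of x] Rb[of x] show ?thesis by (simp add: F'_def)
        qed
      qed
      moreover have "(LINT \<eta>|lborel. F' \<eta>) = (LINT \<eta>|lborel. R \<eta>) + \<i> * of_real s * J"
        unfolding F'_def J_def using intR intGE by simp
      ultimately have "\<i> * of_real s * J = - (LINT \<eta>|lborel. R \<eta>)"
        by (simp add: eq_neg_iff_add_eq_0 add.commute)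
      then have "s * cmod J = cmod (LINT \<eta>|lborel. R \<eta>)"
        using s by (metis abs_of_pos mult_1 norm_ii norm_minus_cancel norm_mult norm_of_real)
      also have "\<dots> \<le> 2 * L * (C1 / (2 * L) / y)"
        using Rb C10 L y by (intro norm_LINT_bounded_support_le) auto
      finally show ?thesis using y L by (simp add: y_def field_simps)
    qed (use C10 in simp)
    have pos: "0 < 1 + s * \<bar>\<xi> - \<xi>'\<bar>" using s by (simp add: add_pos_nonneg)
    have "cmod J * (1 + s * \<bar>\<xi> - \<xi>'\<bar>) \<le> C"
      using triv decay unfolding C_def by (simp add: distrib_left)
    then show ?thesis unfolding J_def G_def E_def using pos by (simp add: pos_le_divide_eq)
  qed
  have eq: "cis (y * (\<xi> + \<eta>) + s * a (\<xi> + \<eta>)) * m (\<xi>, \<eta>) * cnj (cis (y * (\<xi>' + \<eta>) + s * a (\<xi>' + \<eta>)) * m (\<xi>', \<eta>))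
      = cis (y * (\<xi> - \<xi>')) * (m (\<xi>, \<eta>) * cnj (m (\<xi>', \<eta>)) * cis (s * (a (\<xi> + \<eta>) - a (\<xi>' + \<eta>))))"
    for s y \<xi> \<xi>' \<eta>
  proof -
    have "cis (y * (\<xi> + \<eta>) + s * a (\<xi> + \<eta>)) * cnj (cis (y * (\<xi>' + \<eta>) + s * a (\<xi>' + \<eta>)))
        = cis (y * (\<xi> - \<xi>')) * cis (s * (a (\<xi> + \<eta>) - a (\<xi>' + \<eta>)))"
      unfolding cis_cnj cis_mult by (rule arg_cong[of _ _ cis]) (simp add: algebra_simps)
    then show ?thesis by (simp add: mult_ac)
  qed
  show ?thesis
    unfolding eq using main C0 by (intro exI[of _ C]) (auto simp: norm_mult)
qed

end

lemma Ck_fst_of_smooth_fst: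
  assumes "smooth_fun f"
  shows "Ck_fst n (\<lambda>p. of_real ((deriv ^^ k) f (fst p)))"
proof (induction n arbitrary: k)
  case 0
  show ?case
    by (auto intro!: continuous_intros continuous_on_compose2[OF smooth_fun_continuous_on[OF assms, of UNIV]])
next
  case (Suc n)
  have "continuous_on UNIV (\<lambda>p::real \<times> real. complex_of_real ((deriv ^^ k) f (fst p)))"
    by (auto intro!: continuous_intros continuous_on_compose2[OF smooth_fun_continuous_on[OF assms, of UNIV]])
  moreover have "((\<lambda>x. complex_of_real ((deriv ^^ k) f (fst (x, \<zeta>)))) has_vector_derivative
      complex_of_real ((deriv ^^ Suc k) f (fst (\<xi>, \<zeta>)))) (at \<xi>)" for \<xi> \<zeta> :: real
    using smooth_fun_DERIV[OF assms, of k \<xi>]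
    by (intro has_vector_derivative_of_real) (simp add: has_real_derivative_iff_has_vector_derivative)
  ultimately show ?case using Suc.IH[of "Suc k"] unfolding Ck_fst.simps by blast
qed

lemma Ck_fst_of_smooth_diff:
  assumes "smooth_fun f"
  shows "Ck_fst n (\<lambda>p. of_real ((deriv ^^ k) f (snd p - fst p)))"
proof (induction n arbitrary: k)
  case 0
  show ?case
    by (auto intro!: continuous_intros continuous_on_compose2[OF smooth_fun_continuous_on[OF assms, of UNIV]])
next
  case (Suc n)
  have "continuous_on UNIV (\<lambda>p::real \<times> real. complex_of_real ((deriv ^^ k) f (snd p - fst p)))"
    by (auto intro!: continuous_intros continuous_on_compose2[OF smooth_fun_continuous_on[OF assms, of UNIV]])
  moreover have "((\<lambda>x. complex_of_real ((deriv ^^ k) f (snd (x, \<zeta>) - fst (x, \<zeta>)))) has_vector_derivative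
      (- 1) * complex_of_real ((deriv ^^ Suc k) f (snd (\<xi>, \<zeta>) - fst (\<xi>, \<zeta>)))) (at \<xi>)" for \<xi> \<zeta> :: real
  proof -
    have "((\<lambda>x. (deriv ^^ k) f (\<zeta> - x)) has_real_derivative ((deriv ^^ Suc k) f (\<zeta> - \<xi>)) * (0 - 1)) (at \<xi>)"
      by (rule DERIV_chain2[OF smooth_fun_DERIV[OF assms, of k]]) (intro DERIV_diff DERIV_const DERIV_ident)
    then have "((\<lambda>x. complex_of_real ((deriv ^^ k) f (\<zeta> - x))) has_vector_derivative complex_of_real (((deriv ^^ Suc k) f (\<zeta> - \<xi>)) * (0 - 1))) (at \<xi>)"
      by (intro has_vector_derivative_of_real) (simp add: has_real_derivative_iff_has_vector_derivative)
    then show ?thesis by simp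
  qed
  moreover have "Ck_fst n (\<lambda>p. (- 1) * complex_of_real ((deriv ^^ Suc k) f (snd p - fst p)))"
    by (rule Ck_fst_mult[OF Ck_fst_const Suc.IH])
  ultimately show ?case unfolding Ck_fst.simps by blast
qed

lemma L2sq_unimodular_mult:
  "(\<And>x. cmod (u x) = 1) \<Longrightarrow> L2sq (\<lambda>x. u x * F x) = L2sq F"
  by (simp add: L2sq_def norm_mult)

context interaction
begin

text \<open>The operator in \<open>V\<close> is bounded by \<open>TTstar_bound\<close>, and
  Cauchy-Schwarz then pairs the result with \<open>W\<close>. The kernel bound 1/(1 + s|z|) is
  weakened to (s|z|)^(- theta), which is integrable near 0 with an integral that scales exactly like
  s^(- theta); the norm of T is the square root of this. The distance of \<open>\<theta>\<close>
  from 1 is the first contribution to delta.\<close>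

lemma dispersive_estimate:
  assumes \<theta>: "0 < \<theta>" "\<theta> < 1"
  shows "\<exists>C\<ge>0. \<forall>s y V W v w. 0 < s \<longrightarrow> V \<in> borel_measurable borel \<longrightarrow> W \<in> borel_measurable borel \<longrightarrow>
    L2sq V \<le> ennreal (v\<^sup>2) \<longrightarrow> L2sq W \<le> ennreal (w\<^sup>2) \<longrightarrow> 0 \<le> v \<longrightarrow> 0 \<le> w \<longrightarrow>
    cmod (LINT p|lborel. (case p of (\<xi>, \<eta>) \<Rightarrow> cis (y * (\<xi> + \<eta>) + s * a (\<xi> + \<eta>)) * m (\<xi>, \<eta>) * V \<xi> * W \<eta>))
      \<le> C * s powr (- \<theta> / 2) * v * w"
proof -
  obtain C0 where C0: "0 \<le> C0" and kernel: "\<And>s y \<xi> \<xi>'. 0 < s \<Longrightarrow>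
    cmod (LINT \<eta>|lborel. cis (y * (\<xi> + \<eta>) + s * a (\<xi> + \<eta>)) * m (\<xi>, \<eta>) *
        cnj (cis (y * (\<xi>' + \<eta>) + s * a (\<xi>' + \<eta>)) * m (\<xi>', \<eta>)))
      \<le> C0 / (1 + s * \<bar>\<xi> - \<xi>'\<bar>)"
    using dispersive_kernel by blast
  define J where "J = enn2real (\<integral>\<^sup>+ y. ennreal (\<bar>y\<bar> powr (- \<theta>)) * indicator {-(2*L)..2*L} y \<partial>lborel)"
  have J: "(\<integral>\<^sup>+ y. ennreal (\<bar>y\<bar> powr (- \<theta>)) * indicator {-(2*L)..2*L} y \<partial>lborel) = ennreal J" and J0: "0 \<le> J"
    unfolding J_def using nn_integral_abs_powr_finite[of \<theta> "2 * L"] \<theta> L by (auto intro: ennreal_enn2real[symmetric])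
  define C where "C = sqrt (C0 * J)"
  have "cmod (LINT p|lborel. (case p of (\<xi>, \<eta>) \<Rightarrow> cis (y * (\<xi> + \<eta>) + s * a (\<xi> + \<eta>)) * m (\<xi>, \<eta>) * V \<xi> * W \<eta>))
      \<le> C * s powr (- \<theta> / 2) * v * w"
    if s: "0 < s" and [measurable]: "V \<in> borel_measurable borel" "W \<in> borel_measurable borel"
      and V: "L2sq V \<le> ennreal (v\<^sup>2)" and W: "L2sq W \<le> ennreal (w\<^sup>2)" and vw: "0 \<le> v" "0 \<le> w" for s y V W v w
  proof -
    define Th where "Th \<eta> \<xi> = cis (y * (\<xi> + \<eta>) + s * a (\<xi> + \<eta>)) * m (\<xi>, \<eta>)" for \<eta> \<xi>
    \<comment> \<open>The symbol vanishes outside the box, so cutting off changes nothing in the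
      integral; it makes both functions integrable, as \<open>TTstar_bound\<close> and Fubini
      require.\<close>
    define VL where "VL \<xi> = indicator {-L..L} \<xi> *\<^sub>R V \<xi>" for \<xi>
    define WL where "WL \<xi> = indicator {-L..L} \<xi> *\<^sub>R W \<xi>" for \<xi>
    have [measurable]: "VL \<in> borel_measurable borel" "WL \<in> borel_measurable borel"
      unfolding VL_def WL_def by measurable
    have Th_meas[measurable]: "(\<lambda>(\<eta>, \<xi>). Th \<eta> \<xi>) \<in> borel_measurable (lborel \<Otimes>\<^sub>M lborel)"
      unfolding Th_def by measurable
    have VL: "L2sq VL \<le> ennreal (v\<^sup>2)"
      by (rule order_trans[OF L2sq_mono V]) (simp add: VL_def indicator_def)
    have WL: "L2sq WL \<le> ennreal (w\<^sup>2)"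
      by (rule order_trans[OF L2sq_mono W]) (simp add: WL_def indicator_def)
    have VLi: "integrable lborel VL"
      by (rule integrable_L2_compact_support[OF _ le_less_trans[OF VL], of L]) (auto simp: VL_def indicator_def)
    have WLi: "integrable lborel WL"
      by (rule integrable_L2_compact_support[OF _ le_less_trans[OF WL], of L]) (auto simp: WL_def indicator_def)
    define I where "I \<eta> = (LINT \<xi>|lborel. Th \<eta> \<xi> * VL \<xi>)" for \<eta>
    have [measurable]: "I \<in> borel_measurable borel" unfolding I_def by measurable
    \<comment> \<open>The cutoff to |z| <= 2L is legitimate because the kernel vanishes unless both
      frequencies lie in [-L, L], and it is needed since the power with exponent - theta is not
      integrable at infinity.\<close>
    define k where "k z = C0 * (1 + s * \<bar>z\<bar>) powr (- \<theta>) * indicator {-(2*L)..2*L} z" for z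
    have kS: "(\<integral>\<^sup>+ z. ennreal (k z) \<partial>lborel) \<le> ennreal (C0 * s powr (- \<theta>) * J)"
    proof -
      have "(\<integral>\<^sup>+ z. ennreal (k z) \<partial>lborel) \<le> (\<integral>\<^sup>+ z. ennreal (C0 * s powr (- \<theta>)) * (ennreal (\<bar>z\<bar> powr (- \<theta>)) * indicator {-(2*L)..2*L} z) \<partial>lborel)"
      proof (rule nn_integral_mono_AE)
        have "AE z in lborel. z \<noteq> (0::real)" by (rule AE_lborel_singleton)
        then show "AE z in lborel. ennreal (k z) \<le> ennreal (C0 * s powr (- \<theta>)) * (ennreal (\<bar>z\<bar> powr (- \<theta>)) * indicator {-(2*L)..2*L} z)"
        proof eventually_elim
          case (elim z)
          have "(1 + s * \<bar>z\<bar>) powr (- \<theta>) \<le> (s * \<bar>z\<bar>) powr (- \<theta>)"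
            using elim s \<theta> by (intro powr_mono2') auto
          also have "\<dots> = s powr (- \<theta>) * \<bar>z\<bar> powr (- \<theta>)"
            using s by (simp add: powr_mult)
          finally have "C0 * (1 + s * \<bar>z\<bar>) powr (- \<theta>) \<le> (C0 * s powr (- \<theta>)) * \<bar>z\<bar> powr (- \<theta>)"
            using C0 by (simp add: mult_left_mono mult.assoc)
          then have "ennreal (C0 * (1 + s * \<bar>z\<bar>) powr (- \<theta>)) \<le> ennreal (C0 * s powr (- \<theta>)) * ennreal (\<bar>z\<bar> powr (- \<theta>))"
            using C0 by (simp add: ennreal_mult'[symmetric] ennreal_leI)
          then show ?case by (auto simp: k_def indicator_def)
        qed
      qed
      also have "\<dots> = ennreal (C0 * s powr (- \<theta>)) * ennreal J"
        by (subst nn_integral_cmult) (auto simp: J)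
      finally show ?thesis using C0 J0 by (simp add: ennreal_mult'[symmetric])
    qed
    have "L2sq I \<le> ennreal (C0 * s powr (- \<theta>) * J) * L2sq VL"
      unfolding L2sq_def I_def
    proof (rule TTstar_bound[where \<theta> = "\<lambda>\<eta>. M * indicator {-L..L} \<eta>" and k = k, OF Th_meas _ _ VLi _ _ kS])
      show "cmod (Th \<eta> \<xi>) \<le> M * indicator {-L..L} \<eta>" for \<eta> \<xi>
        using m_bound[of \<xi> \<eta>] M(2)[of "(\<xi>, \<eta>)"] by (auto simp: Th_def norm_mult indicator_def split: if_splits)
      show "integrable lborel (\<lambda>\<eta>. (M * indicator {-L..L} \<eta>)\<^sup>2)"
        by (rule integrable_bounded_support[where B = "M\<^sup>2" and L = L]) (auto simp: indicator_def)
      show "cmod (LINT \<eta>|lborel. Th \<eta> \<xi> * cnj (Th \<eta> \<xi>')) \<le> k (\<xi> - \<xi>')" for \<xi> \<xi>'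
      proof (cases "\<bar>\<xi> - \<xi>'\<bar> \<le> 2 * L")
        case True
        have "cmod (LINT \<eta>|lborel. Th \<eta> \<xi> * cnj (Th \<eta> \<xi>')) \<le> C0 / (1 + s * \<bar>\<xi> - \<xi>'\<bar>)"
          unfolding Th_def by (rule kernel[OF s])
        also have "\<dots> = C0 * (1 + s * \<bar>\<xi> - \<xi>'\<bar>) powr (- 1)"
          using s by (simp add: powr_minus_divide add_nonneg_nonneg)
        also have "\<dots> \<le> C0 * (1 + s * \<bar>\<xi> - \<xi>'\<bar>) powr (- \<theta>)"
          using C0 s \<theta> by (intro mult_left_mono powr_mono) auto
        also have "\<dots> = k (\<xi> - \<xi>')"
          using True by (auto simp: k_def indicator_def abs_le_iff)
        finally show ?thesis .
      next
        case False
        have "Th \<eta> \<xi> * cnj (Th \<eta> \<xi>') = 0" for \<eta>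
        proof (cases "m (\<xi>, \<eta>) = 0 \<or> m (\<xi>', \<eta>) = 0")
          case nz: False
          then have "\<bar>\<xi>\<bar> \<le> L" "\<bar>\<xi>'\<bar> \<le> L" using L(2) by blast+
          then have "\<bar>\<xi> - \<xi>'\<bar> \<le> 2 * L" by linarith
          with False show ?thesis by simp
        qed (auto simp: Th_def)
        then have "cmod (LINT \<eta>|lborel. Th \<eta> \<xi> * cnj (Th \<eta> \<xi>')) = 0" by (simp only:) simp
        also have "0 \<le> k (\<xi> - \<xi>')" using C0 by (simp add: k_def)
        finally show ?thesis .
      qed
    qed (unfold k_def, measurable)
    also have "\<dots> \<le> ennreal (C0 * s powr (- \<theta>) * J) * ennreal (v\<^sup>2)"
      by (intro mult_left_mono VL) simp
    also have "\<dots> = ennreal ((C * s powr (- \<theta> / 2) * v)\<^sup>2)"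
    proof -
      have "(s powr (- \<theta> / 2))\<^sup>2 = s powr (- \<theta>)"
        using s by (simp add: power2_eq_square flip: powr_add)
      then show ?thesis
        unfolding C_def using C0 J0 by (simp add: ennreal_mult'[symmetric] power_mult_distrib mult_ac)
    qed
    finally have I: "L2sq I \<le> ennreal ((C * s powr (- \<theta> / 2) * v)\<^sup>2)" .
    have eq: "cis (y * (\<xi> + \<eta>) + s * a (\<xi> + \<eta>)) * m (\<xi>, \<eta>) * V \<xi> * W \<eta> = Th \<eta> \<xi> * VL \<xi> * WL \<eta>" for \<xi> \<eta>
      using m_bound[of \<xi> \<eta>] by (auto simp: Th_def VL_def WL_def indicator_def split: if_splits)
    have int: "integrable (lborel \<Otimes>\<^sub>M lborel) (\<lambda>(\<xi>, \<eta>). Th \<eta> \<xi> * VL \<xi> * WL \<eta>)"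
    proof (rule Bochner_Integration.integrable_bound)
      show "integrable (lborel \<Otimes>\<^sub>M lborel) (\<lambda>(\<xi>, \<eta>). (of_real M * VL \<xi>) * WL \<eta>)"
        using VLi WLi by (intro integrable_pair_mult) auto
      show "(\<lambda>(\<xi>, \<eta>). Th \<eta> \<xi> * VL \<xi> * WL \<eta>) \<in> borel_measurable (lborel \<Otimes>\<^sub>M lborel)"
        unfolding Th_def by measurable
      show "AE p in lborel \<Otimes>\<^sub>M lborel. norm (case p of (\<xi>, \<eta>) \<Rightarrow> Th \<eta> \<xi> * VL \<xi> * WL \<eta>)
          \<le> norm (case p of (\<xi>, \<eta>) \<Rightarrow> (of_real M * VL \<xi>) * WL \<eta>)"
        using M by (intro AE_I2) (auto simp: Th_def norm_mult intro!: mult_right_mono)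
    qed
    have "(LINT p|lborel. (case p of (\<xi>, \<eta>) \<Rightarrow> cis (y * (\<xi> + \<eta>) + s * a (\<xi> + \<eta>)) * m (\<xi>, \<eta>) * V \<xi> * W \<eta>))
        = (LINT p|(lborel \<Otimes>\<^sub>M lborel). (case p of (\<xi>, \<eta>) \<Rightarrow> Th \<eta> \<xi> * VL \<xi> * WL \<eta>))"
      unfolding eq lborel_prod ..
    also have "\<dots> = (LINT \<eta>|lborel. LINT \<xi>|lborel. Th \<eta> \<xi> * VL \<xi> * WL \<eta>)"
      by (rule lborel_pair.integral_snd[OF int, symmetric])
    also have "\<dots> = (LINT \<eta>|lborel. I \<eta> * WL \<eta>)"
      unfolding I_def by simp
    finally show ?thesis
      using norm_LINT_mult_le_L2[OF _ _ I WL _ vw(2)] C0 J0 vw by (simp add: C_def)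
  qed
  moreover have "0 \<le> C" unfolding C_def using C0 J0 by simp
  ultimately show ?thesis by blast
qed

section \<open>Non-stationary phase at a fixed output frequency\<close>

lemma Ck_fst_symbol: "Ck_fst n (\<lambda>p. D j k (fst p, snd p - fst p))"
proof (induction n arbitrary: j k)
  case 0
  show ?case
    by (auto intro!: continuous_intros continuous_on_compose2[OF D_cont])
next
  case (Suc n)
  have "continuous_on UNIV (\<lambda>p::real \<times> real. D j k (fst p, snd p - fst p))"
    by (auto intro!: continuous_intros continuous_on_compose2[OF D_cont])
  moreover have "((\<lambda>x. D j k (fst (x, \<zeta>), snd (x, \<zeta>) - fst (x, \<zeta>))) has_vector_derivative
      D (Suc j) k (fst (\<xi>, \<zeta>), snd (\<xi>, \<zeta>) - fst (\<xi>, \<zeta>)) + (- 1) * D j (Suc k) (fst (\<xi>, \<zeta>), snd (\<xi>, \<zeta>) - fst (\<xi>, \<zeta>))) (at \<xi>)" for \<xi> \<zeta> :: real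
  proof -
    define \<eta> where "\<eta> = \<zeta> - \<xi>"
    \<comment> \<open>At fixed zeta both arguments of the symbol move with xi, so the chain rule
      needs a total derivative and not only partial ones; it exists because the partial derivatives
      are continuous.\<close>
    have "((\<lambda>(x, y). D j k (x, y)) has_derivative
        (\<lambda>(tx, ty). tx *\<^sub>R D (Suc j) k (\<xi>, \<eta>) + blinfun_apply (blinfun_scaleR_left (D j (Suc k) (\<xi>, \<eta>))) ty)) (at (\<xi>, \<eta>) within UNIV \<times> UNIV)"
    proof (rule has_derivative_partialsI)
      show "((\<lambda>x. D j k (x, \<eta>)) has_derivative (\<lambda>tx. tx *\<^sub>R D (Suc j) k (\<xi>, \<eta>))) (at \<xi> within UNIV)"
        using D_fst[of j k \<eta> \<xi>] by (simp add: has_vector_derivative_def)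
      show "((\<lambda>y. D j k (x, y)) has_derivative blinfun_apply (blinfun_scaleR_left (D j (Suc k) (x, y)))) (at y within UNIV)" for x y
        using D_snd[of j k x y] by (simp add: has_vector_derivative_def)
      have "isCont (D j (Suc k)) (\<xi>, \<eta>)"
        using D_cont[of j "Suc k"] by (simp add: continuous_on_eq_continuous_at)
      then show "continuous (at (\<xi>, \<eta>) within UNIV \<times> UNIV) (\<lambda>(x, y). blinfun_scaleR_left (D j (Suc k) (x, y)))"
      proof -
        have "(\<lambda>(x, y). blinfun_scaleR_left (D j (Suc k) (x, y))) = (\<lambda>p. blinfun_scaleR_left (D j (Suc k) p))"
          by auto
        then show ?thesis
          using bounded_linear.continuous[OF bounded_linear_blinfun_scaleR_left] \<open>isCont (D j (Suc k)) (\<xi>, \<eta>)\<close> by simp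
      qed
    qed auto
    then have "((\<lambda>p. D j k p) has_derivative
        (\<lambda>(tx, ty). tx *\<^sub>R D (Suc j) k (\<xi>, \<eta>) + ty *\<^sub>R D j (Suc k) (\<xi>, \<eta>))) (at (\<xi>, \<zeta> - \<xi>))"
      by (simp add: \<eta>_def)
    moreover have "((\<lambda>x. (x, \<zeta> - x)) has_derivative (\<lambda>h. (h, - h))) (at \<xi>)"
      by (auto intro!: derivative_eq_intros)
    ultimately have "((\<lambda>x. D j k (x, \<zeta> - x)) has_derivative
        (\<lambda>h. case (h, - h) of (tx, ty) \<Rightarrow> tx *\<^sub>R D (Suc j) k (\<xi>, \<eta>) + ty *\<^sub>R D j (Suc k) (\<xi>, \<eta>))) (at \<xi>)"
      by (rule has_derivative_compose[rotated])
    then show ?thesis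
      by (simp add: has_vector_derivative_def \<eta>_def scaleR_right_diff_distrib)
  qed
  moreover have "Ck_fst n (\<lambda>p. D (Suc j) k (fst p, snd p - fst p) + (- 1) * D j (Suc k) (fst p, snd p - fst p))"
    by (intro Ck_fst_add Ck_fst_mult Ck_fst_const Suc.IH)
  ultimately show ?case unfolding Ck_fst.simps by blast
qed

text \<open>With zeta = xi + eta fixed, the xi-derivative of b(xi) + c(zeta - xi) is b'(xi) -
  c'(zeta - xi), which is at least \<open>\<epsilon>\<close> in modulus on the support. A slope
  \<open>\<mu>\<close> of at most half that size leaves the phase nonstationary, so linear phases
  coming from spatial translations are admissible.\<close>

lemma nonstationary_fiber:
  assumes A: "\<And>n. Ck_fst n A" and A0: "\<And>\<xi> \<zeta>. m (\<xi>, \<zeta> - \<xi>) = 0 \<Longrightarrow> A (\<xi>, \<zeta>) = 0"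
  shows "\<exists>C\<ge>0. \<forall>\<zeta> \<mu> \<tau>. \<bar>\<mu>\<bar> \<le> \<epsilon> / 2 \<longrightarrow> \<tau> \<noteq> 0 \<longrightarrow>
    cmod (LINT \<xi>|lborel. A (\<xi>, \<zeta>) * cis (\<tau> * (b \<xi> + c (\<zeta> - \<xi>) - \<mu> * \<xi>))) \<le> C / \<bar>\<tau>\<bar> ^ N"
proof -
  \<comment> \<open>The support of the symbol in the variables (xi, zeta); as a continuous image it
    is compact.\<close>
  define K where "K = (\<lambda>p. (fst p, fst p + snd p)) ` supp m"
  have K: "compact K" unfolding K_def
    by (intro compact_continuous_image supp_compact continuous_intros)
  have AK: "A p = 0" if "p \<notin> K" for p
  proof -
    obtain \<xi> \<zeta> where p: "p = (\<xi>, \<zeta>)" by force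
    have "m (\<xi>, \<zeta> - \<xi>) = 0"
    proof (rule ccontr)
      assume "m (\<xi>, \<zeta> - \<xi>) \<noteq> 0"
      then have "(\<xi>, \<zeta> - \<xi>) \<in> supp m"
        unfolding supp_def using closure_subset[of "{p. m p \<noteq> 0}"] by auto
      then have "p \<in> K" unfolding K_def p by force
      with that show False by simp
    qed
    then show ?thesis using A0 p by simp
  qed
  have db: "(b has_real_derivative deriv b x) (at x)" "(deriv b has_real_derivative deriv (deriv b) x) (at x)"
    and dc: "(c has_real_derivative deriv c x) (at x)" "(deriv c has_real_derivative deriv (deriv c) x) (at x)" for x
    using smooth_fun_DERIV[OF b, of 0 x] smooth_fun_DERIV[OF b, of 1 x]
      smooth_fun_DERIV[OF c, of 0 x] smooth_fun_DERIV[OF c, of 1 x] by simp_all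
  have neg: "((\<lambda>x. \<zeta> - x) has_real_derivative - 1) (at \<xi>)" for \<zeta> \<xi> :: real
    by (auto intro!: derivative_eq_intros)
  have "\<exists>C\<ge>0. \<forall>\<zeta> \<mu> \<tau>. \<bar>\<mu>\<bar> \<le> \<epsilon> / 2 \<longrightarrow> \<tau> \<noteq> 0 \<longrightarrow>
      cmod (LINT \<xi>|lborel. A (\<xi>, \<zeta>) * of_real (inverse ((\<lambda>p. deriv b (fst p) - deriv c (snd p - fst p)) (\<xi>, \<zeta>) - \<mu>) ^ 0)
        * cis (\<tau> * ((\<lambda>p. b (fst p) + c (snd p - fst p)) (\<xi>, \<zeta>) - \<mu> * \<xi>))) \<le> C / \<bar>\<tau>\<bar> ^ N"
  proof (rule nonstationary_phase[where \<beta>' = "\<lambda>p. deriv (deriv b) (fst p) + deriv (deriv c) (snd p - fst p)", OF _ _ _ K \<epsilon>(1) _ A AK])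
    show "((\<lambda>x. (\<lambda>p. b (fst p) + c (snd p - fst p)) (x, \<zeta>)) has_real_derivative
        (\<lambda>p. deriv b (fst p) - deriv c (snd p - fst p)) (\<xi>, \<zeta>)) (at \<xi>)" for \<xi> \<zeta>
      using DERIV_add[OF db(1)[of \<xi>] DERIV_chain2[OF dc(1) neg[of \<zeta> \<xi>]]] by simp
    show "((\<lambda>x. (\<lambda>p. deriv b (fst p) - deriv c (snd p - fst p)) (x, \<zeta>)) has_real_derivative
        (\<lambda>p. deriv (deriv b) (fst p) + deriv (deriv c) (snd p - fst p)) (\<xi>, \<zeta>)) (at \<xi>)" for \<xi> \<zeta>
      using DERIV_diff[OF db(2)[of \<xi>] DERIV_chain2[OF dc(2) neg[of \<zeta> \<xi>]]] by simp
    show "Ck_fst n (\<lambda>p. complex_of_real (deriv (deriv b) (fst p) + deriv (deriv c) (snd p - fst p)))" for n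
      using Ck_fst_add[OF Ck_fst_of_smooth_fst[OF b, of n 2] Ck_fst_of_smooth_diff[OF c, of n 2]]
      by (simp add: eval_nat_numeral)
    show "\<epsilon> \<le> \<bar>(\<lambda>p. deriv b (fst p) - deriv c (snd p - fst p)) p\<bar>" if "p \<in> K" for p
      using that \<epsilon>(2) unfolding K_def by auto
  qed
  then show ?thesis by simp
qed

text \<open>Arbitrary order of decay with a slope \<open>\<mu>\<close>: the input for late
  interaction times.\<close>

lemma nonstationary_symbol:
  "\<exists>C\<ge>0. \<forall>\<zeta> \<mu> \<tau>. \<bar>\<mu>\<bar> \<le> \<epsilon> / 2 \<longrightarrow> \<tau> \<noteq> 0 \<longrightarrow>
    cmod (LINT \<xi>|lborel. m (\<xi>, \<zeta> - \<xi>) * cis (\<tau> * (b \<xi> + c (\<zeta> - \<xi>) - \<mu> * \<xi>))) \<le> C / \<bar>\<tau>\<bar> ^ N"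
  using nonstationary_fiber[of "\<lambda>p. m (fst p, snd p - fst p)" N] Ck_fst_symbol[of _ 0 0, unfolded D0] by simp

text \<open>The squared modulus of the symbol appears because this is a kernel of T*T in the time
  variable. Two integrations by parts, combined with the trivial bound near \<open>\<tau>\<close> =
  0, make it integrable over all times, so Schur's test has a constant independent of the length of
  the time interval.\<close>

lemma nonstationary_symbol_sq:
  "\<exists>C\<ge>0. \<forall>\<zeta> \<tau>.
    cmod (LINT \<xi>|lborel. m (\<xi>, \<zeta> - \<xi>) * cnj (m (\<xi>, \<zeta> - \<xi>)) * cis (\<tau> * (b \<xi> + c (\<zeta> - \<xi>)))) \<le> C / (1 + \<tau>\<^sup>2)"
proof -
  have "\<And>n. Ck_fst n (\<lambda>p. m (fst p, snd p - fst p) * cnj (m (fst p, snd p - fst p)))"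
    using Ck_fst_symbol[of _ 0 0, unfolded D0] by (intro Ck_fst_mult Ck_fst_cnj)
  from nonstationary_fiber[OF this, of 2]
  obtain C where C: "0 \<le> C" and decay: "\<And>\<zeta> \<mu> \<tau>. \<bar>\<mu>\<bar> \<le> \<epsilon> / 2 \<Longrightarrow> \<tau> \<noteq> 0 \<Longrightarrow>
    cmod (LINT \<xi>|lborel. m (\<xi>, \<zeta> - \<xi>) * cnj (m (\<xi>, \<zeta> - \<xi>)) * cis (\<tau> * (b \<xi> + c (\<zeta> - \<xi>) - \<mu> * \<xi>))) \<le> C / \<bar>\<tau>\<bar> ^ 2"
    by auto
  have "cmod (LINT \<xi>|lborel. m (\<xi>, \<zeta> - \<xi>) * cnj (m (\<xi>, \<zeta> - \<xi>)) * cis (\<tau> * (b \<xi> + c (\<zeta> - \<xi>)))) \<le> (2 * L * (M * M) + C) / (1 + \<tau>\<^sup>2)" for \<zeta> \<tau>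
  proof -
    define J where "J = cmod (LINT \<xi>|lborel. m (\<xi>, \<zeta> - \<xi>) * cnj (m (\<xi>, \<zeta> - \<xi>)) * cis (\<tau> * (b \<xi> + c (\<zeta> - \<xi>))))"
    have "J \<le> 2 * L * (M * M)" unfolding J_def
    proof (rule norm_LINT_bounded_support_le)
      fix \<xi>
      have "cmod (m (\<xi>, \<zeta> - \<xi>)) \<le> M * indicator {-L..L} \<xi>"
        using m_bound[of \<xi> "\<zeta> - \<xi>"] M by (auto simp: indicator_def split: if_splits)
      then show "cmod (m (\<xi>, \<zeta> - \<xi>) * cnj (m (\<xi>, \<zeta> - \<xi>)) * cis (\<tau> * (b \<xi> + c (\<zeta> - \<xi>)))) \<le> M * M * indicator {-L..L} \<xi>"
        using M(1) by (auto simp: norm_mult indicator_def intro!: mult_mono split: if_splits)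
    qed (use L M in auto)
    moreover have "J * \<tau>\<^sup>2 \<le> C"
    proof (cases "\<tau> = 0")
      case False
      then show ?thesis using decay[of 0 \<tau> \<zeta>] \<epsilon>(1) unfolding J_def by (simp add: field_simps)
    qed (use C in simp)
    ultimately have "J * (1 + \<tau>\<^sup>2) \<le> 2 * L * (M * M) + C" by (simp add: distrib_left)
    then show ?thesis unfolding J_def by (subst pos_le_divide_eq) (auto intro: add_pos_nonneg)
  qed
  moreover have "0 \<le> 2 * L * (M * M) + C" using L M C by simp
  ultimately show ?thesis by blast
qed

end

section \<open>The Duhamel integral\<close>

text \<open>The substitution zeta = xi + eta has unit Jacobian. Integrability is carried over first,
  since the order of integration is exchanged afterwards to make zeta the outer variable.\<close>

lemma integral_shear:
  fixes h :: "real \<times> real \<Rightarrow> complex"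
  assumes h: "integrable (lborel \<Otimes>\<^sub>M lborel) h"
  shows "(LINT p|(lborel \<Otimes>\<^sub>M lborel). h p) = (LINT \<zeta>|lborel. LINT \<xi>|lborel. h (\<xi>, \<zeta> - \<xi>))"
proof -
  have [measurable]: "h \<in> borel_measurable (lborel \<Otimes>\<^sub>M lborel)" using h by auto
  then have [measurable]: "h \<in> borel_measurable (borel \<Otimes>\<^sub>M borel)" by (simp cong: measurable_cong_sets)
  have sm: "(\<lambda>(\<xi>, \<zeta>). h (\<xi>, \<zeta> - \<xi>)) \<in> borel_measurable (lborel \<Otimes>\<^sub>M lborel)"
    by measurable
  have "(\<integral>\<^sup>+ \<xi>. \<integral>\<^sup>+ \<zeta>. ennreal (norm (case (\<xi>, \<zeta>) of (\<xi>, \<zeta>) \<Rightarrow> h (\<xi>, \<zeta> - \<xi>))) \<partial>lborel \<partial>lborel)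
      = (\<integral>\<^sup>+ \<xi>. \<integral>\<^sup>+ \<eta>. ennreal (norm (h (\<xi>, \<eta>))) \<partial>lborel \<partial>lborel)"
  proof (rule nn_integral_cong)
    fix \<xi> :: real
    show "(\<integral>\<^sup>+ \<zeta>. ennreal (norm (case (\<xi>, \<zeta>) of (\<xi>, \<zeta>) \<Rightarrow> h (\<xi>, \<zeta> - \<xi>))) \<partial>lborel)
      = (\<integral>\<^sup>+ \<eta>. ennreal (norm (h (\<xi>, \<eta>))) \<partial>lborel)"
      using nn_integral_lborel_diff(2)[of "\<lambda>\<eta>. ennreal (norm (h (\<xi>, \<eta>)))" \<xi>] by simp
  qed
  also have "\<dots> = (\<integral>\<^sup>+ p. ennreal (norm (h p)) \<partial>(lborel \<Otimes>\<^sub>M lborel))"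
    by (rule lborel.nn_integral_fst) measurable
  also have "\<dots> < \<infinity>" using h by (simp add: integrable_iff_bounded)
  finally have sint: "integrable (lborel \<Otimes>\<^sub>M lborel) (\<lambda>(\<xi>, \<zeta>). h (\<xi>, \<zeta> - \<xi>))"
    by (rule integrable_pairI[OF sm])
  have "(LINT p|(lborel \<Otimes>\<^sub>M lborel). h p) = (LINT \<xi>|lborel. LINT \<eta>|lborel. h (\<xi>, \<eta>))"
    by (rule lborel_pair.integral_fst'[OF h, symmetric])
  also have "\<dots> = (LINT \<xi>|lborel. LINT \<zeta>|lborel. h (\<xi>, \<zeta> - \<xi>))"
  proof (rule Bochner_Integration.integral_cong[OF refl])
    fix \<xi> :: real
    show "(LINT \<eta>|lborel. h (\<xi>, \<eta>)) = (LINT \<zeta>|lborel. h (\<xi>, \<zeta> - \<xi>))"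
      using lborel_integral_real_affine[of 1 "\<lambda>\<eta>. h (\<xi>, \<eta>)" "- \<xi>"] by simp
  qed
  also have "\<dots> = (LINT \<zeta>|lborel. LINT \<xi>|lborel. h (\<xi>, \<zeta> - \<xi>))"
    using lborel_pair.Fubini_integral[OF sint] by simp
  finally show ?thesis .
qed

lemma nn_integral_inverse_1_plus_square_finite:
  "(\<integral>\<^sup>+ y. ennreal (1 / (1 + y\<^sup>2)) \<partial>(lborel::real measure)) < \<infinity>"
proof -
  have "integrable lborel (\<lambda>y::real. inverse (1 + y\<^sup>2))"
    using integrable_inverse_1_plus_square by (simp add: set_integrable_def einterval_def)
  then have "(\<integral>\<^sup>+ y. ennreal (norm (inverse (1 + y\<^sup>2))) \<partial>(lborel::real measure)) < \<infinity>"
    by (simp add: integrable_iff_bounded)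
  moreover have "norm (inverse (1 + y\<^sup>2)) = 1 / (1 + y\<^sup>2)" for y :: real
    by (simp add: inverse_eq_divide)
  ultimately show ?thesis by simp
qed

context interaction
begin

definition integrand :: "(real \<Rightarrow> complex) \<Rightarrow> (real \<Rightarrow> complex) \<Rightarrow> real \<Rightarrow> real \<Rightarrow> real \<Rightarrow> real \<times> real \<Rightarrow> complex" where
  "integrand F G t x \<tau> p = (case p of (\<xi>, \<eta>) \<Rightarrow>
      cis (x * (\<xi> + \<eta>)) * cis ((t - \<tau>) * a (\<xi> + \<eta>)) *
      cis (\<tau> * b \<xi>) * F \<xi> * cis (\<tau> * c \<eta>) * G \<eta> * m (\<xi>, \<eta>))"

text \<open>The solution without the factor -i, bilinear in two arbitrary functions in place of the
  transforms of the data, and over an arbitrary set of interaction times, so that both frequency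
  functions and times can be decomposed.\<close>

definition duhamel :: "(real \<Rightarrow> complex) \<Rightarrow> (real \<Rightarrow> complex) \<Rightarrow> real \<Rightarrow> real set \<Rightarrow> real \<Rightarrow> complex" where
  "duhamel F G t A x = (LINT \<tau>:A|lborel. LINT p|lborel. integrand F G t x \<tau> p)"

text \<open>The spatial Fourier transform of \<open>duhamel\<close> at the output frequency
  \<open>\<zeta>\<close>, up to normalisation, with the time integral carried out innermost.\<close>

definition fiber :: "(real \<Rightarrow> complex) \<Rightarrow> (real \<Rightarrow> complex) \<Rightarrow> real \<Rightarrow> real set \<Rightarrow> real \<Rightarrow> complex" where
  "fiber F G t A \<zeta> = cis (t * a \<zeta>) * (LINT \<xi>|lborel. F \<xi> * G (\<zeta> - \<xi>) *
     (m (\<xi>, \<zeta> - \<xi>) * (LINT \<tau>|lborel. indicator A \<tau> *\<^sub>R cis (\<tau> * (b \<xi> + c (\<zeta> - \<xi>) - a \<zeta>)))))"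

lemma integrable_cutoff:
  assumes [measurable]: "V \<in> borel_measurable borel" and fin: "L2sq V < \<infinity>"
  shows "integrable lborel (\<lambda>\<xi>. indicator {-L..L} \<xi> *\<^sub>R V \<xi>)"
proof (rule integrable_L2_compact_support[where r = L])
  have "L2sq (\<lambda>\<xi>. indicator {-L..L} \<xi> *\<^sub>R V \<xi>) \<le> L2sq V"
    by (rule L2sq_mono) (simp add: indicator_def)
  with fin show "L2sq (\<lambda>\<xi>. indicator {-L..L} \<xi> *\<^sub>R V \<xi>) < \<infinity>" by simp
qed (auto simp: indicator_def)

lemma integrand_norm_le:
  "norm (integrand F G t x \<tau> (\<xi>, \<eta>)) \<le> M * (cmod (indicator {-L..L} \<xi> *\<^sub>R F \<xi>) * cmod (indicator {-L..L} \<eta> *\<^sub>R G \<eta>))"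
proof -
  have "cmod (F \<xi>) * cmod (G \<eta>) * cmod (m (\<xi>, \<eta>)) \<le> cmod (F \<xi>) * cmod (G \<eta>) * (M * indicator {-L..L} \<xi> * indicator {-L..L} \<eta>)"
    by (intro mult_left_mono m_bound) auto
  then show ?thesis by (simp add: integrand_def norm_mult mult_ac)
qed

lemma integrand_measurable:
  assumes [measurable]: "F \<in> borel_measurable borel" "G \<in> borel_measurable borel"
  shows "(\<lambda>(\<tau>, p). integrand F G t x \<tau> p) \<in> borel_measurable (lborel \<Otimes>\<^sub>M lborel)"
proof -
  have "(\<lambda>(\<tau>, p). integrand F G t x \<tau> p) \<in> borel_measurable (lborel \<Otimes>\<^sub>M (lborel \<Otimes>\<^sub>M lborel))"
    unfolding integrand_def by measurable
  then show ?thesis by (simp add: lborel_prod)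
qed

lemma integrable_dominant:
  assumes [measurable]: "F \<in> borel_measurable borel" "G \<in> borel_measurable borel"
    and fin: "L2sq F < \<infinity>" "L2sq G < \<infinity>"
  shows "integrable lborel (\<lambda>(\<xi>, \<eta>). M * (cmod (indicator {-L..L} \<xi> *\<^sub>R F \<xi>) * cmod (indicator {-L..L} \<eta> *\<^sub>R G \<eta>)))"
proof -
  have "integrable (lborel \<Otimes>\<^sub>M lborel) (\<lambda>(\<xi>, \<eta>). (M * cmod (indicator {-L..L} \<xi> *\<^sub>R F \<xi>)) * cmod (indicator {-L..L} \<eta> *\<^sub>R G \<eta>))"
    using fin by (intro integrable_pair_mult integrable_mult_right integrable_norm integrable_cutoff) auto
  then show ?thesis by (simp add: lborel_prod mult.assoc)
qed

lemma integrand_integrable: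
  assumes [measurable]: "F \<in> borel_measurable borel" "G \<in> borel_measurable borel"
    and fin: "L2sq F < \<infinity>" "L2sq G < \<infinity>"
  shows "integrable lborel (integrand F G t x \<tau>)"
proof (rule Bochner_Integration.integrable_bound[OF integrable_dominant[OF assms]])
  have "(\<lambda>p. (\<lambda>(\<tau>, p). integrand F G t x \<tau> p) (\<tau>, p)) \<in> borel_measurable lborel"
    by (rule measurable_compose_Pair1[OF _ integrand_measurable]) simp_all
  then show "integrand F G t x \<tau> \<in> borel_measurable lborel" by simp
  show "AE p in lborel. norm (integrand F G t x \<tau> p) \<le> norm (case p of (\<xi>, \<eta>) \<Rightarrow>
      M * (cmod (indicator {-L..L} \<xi> *\<^sub>R F \<xi>) * cmod (indicator {-L..L} \<eta> *\<^sub>R G \<eta>)))"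
    using integrand_norm_le M(1) by (intro AE_I2) (auto simp: abs_mult simp del: norm_scaleR)
qed

text \<open>The symbol confines both frequencies to [-L, L], where L^2 functions are integrable, and
  the time set is bounded. All exchanges of time and frequency integrals, and additivity in the time
  set and in the pieces, rest on this.\<close>

lemma duhamel_integrable:
  assumes [measurable]: "F \<in> borel_measurable borel" "G \<in> borel_measurable borel"
    and fin: "L2sq F < \<infinity>" "L2sq G < \<infinity>" and A[measurable]: "A \<in> sets borel" and At: "A \<subseteq> {0..t}"
  shows "integrable (lborel \<Otimes>\<^sub>M lborel) (\<lambda>(\<tau>, p). indicator A \<tau> *\<^sub>R integrand F G t x \<tau> p)"
proof (rule Bochner_Integration.integrable_bound)
  have "integrable lborel (indicator {0..t} :: real \<Rightarrow> real)"
    by (intro integrable_real_indicator) (auto simp: emeasure_lborel_Icc_eq)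
  from integrable_pair_mult[OF this integrable_dominant[OF assms(1-4)]]
  show "integrable (lborel \<Otimes>\<^sub>M lborel) (\<lambda>(\<tau>, p). indicator {0..t} \<tau> * (case p of (\<xi>, \<eta>) \<Rightarrow>
      M * (cmod (indicator {-L..L} \<xi> *\<^sub>R F \<xi>) * cmod (indicator {-L..L} \<eta> *\<^sub>R G \<eta>))))" .
  note [measurable] = integrand_measurable[OF assms(1,2)]
  show "(\<lambda>(\<tau>, p). indicator A \<tau> *\<^sub>R integrand F G t x \<tau> p) \<in> borel_measurable (lborel \<Otimes>\<^sub>M lborel)"
    by measurable
  show "AE z in lborel \<Otimes>\<^sub>M lborel. norm (case z of (\<tau>, p) \<Rightarrow> indicator A \<tau> *\<^sub>R integrand F G t x \<tau> p)
      \<le> norm (case z of (\<tau>, p) \<Rightarrow> indicator {0..t} \<tau> * (case p of (\<xi>, \<eta>) \<Rightarrow>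
      M * (cmod (indicator {-L..L} \<xi> *\<^sub>R F \<xi>) * cmod (indicator {-L..L} \<eta> *\<^sub>R G \<eta>))))"
  proof (rule AE_I2, clarify)
    fix \<tau> \<xi> \<eta>
    have "norm (indicator A \<tau> *\<^sub>R integrand F G t x \<tau> (\<xi>, \<eta>)) \<le> indicator {0..t} \<tau> * norm (integrand F G t x \<tau> (\<xi>, \<eta>))"
      using At by (auto simp: indicator_def)
    also have "\<dots> \<le> indicator {0..t} \<tau> * (M * (cmod (indicator {-L..L} \<xi> *\<^sub>R F \<xi>) * cmod (indicator {-L..L} \<eta> *\<^sub>R G \<eta>)))"
      by (intro mult_left_mono integrand_norm_le) auto
    also have "\<dots> \<le> norm \<dots>" by simp
    finally show "norm (indicator A \<tau> *\<^sub>R integrand F G t x \<tau> (\<xi>, \<eta>)) \<le> norm (indicator {0..t} \<tau> *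
      (M * (cmod (indicator {-L..L} \<xi> *\<^sub>R F \<xi>) * cmod (indicator {-L..L} \<eta> *\<^sub>R G \<eta>))))" .
  qed
qed

text \<open>Fubini moves the time integral inside, where the phase in tau is b + c - a, and the
  shear makes the output frequency the outer variable. The result is an inverse Fourier integral,
  open to Plancherel.\<close>

lemma duhamel_fiber:
  assumes FG[measurable]: "F \<in> borel_measurable borel" "G \<in> borel_measurable borel"
    and fin: "L2sq F < \<infinity>" "L2sq G < \<infinity>" and A[measurable]: "A \<in> sets borel" and At: "A \<subseteq> {0..t}"
  shows "duhamel F G t A x = (LINT \<zeta>|lborel. cis (x * \<zeta>) * fiber F G t A \<zeta>)"
proof -
  note int = duhamel_integrable[OF assms, of x]
  define E where "E \<xi> \<zeta> = (LINT \<tau>|lborel. indicator A \<tau> *\<^sub>R cis (\<tau> * (b \<xi> + c (\<zeta> - \<xi>) - a \<zeta>)))" for \<xi> \<zeta>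
  define h where "h = (\<lambda>(\<xi>, \<eta>). cis (x * (\<xi> + \<eta>)) * cis (t * a (\<xi> + \<eta>)) * (F \<xi> * G \<eta> * (m (\<xi>, \<eta>) * E \<xi> (\<xi> + \<eta>))))"
  have inner: "(LINT \<tau>|lborel. indicator A \<tau> *\<^sub>R integrand F G t x \<tau> p) = h p" for p
  proof -
    obtain \<xi> \<eta> where p: "p = (\<xi>, \<eta>)" by force
    have "(LINT \<tau>|lborel. indicator A \<tau> *\<^sub>R integrand F G t x \<tau> p)
      = (LINT \<tau>|lborel. (cis (x * (\<xi> + \<eta>)) * cis (t * a (\<xi> + \<eta>)) * (F \<xi> * G \<eta> * m (\<xi>, \<eta>))) *
          (indicator A \<tau> *\<^sub>R cis (\<tau> * (b \<xi> + c (\<xi> + \<eta> - \<xi>) - a (\<xi> + \<eta>)))))"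
    proof (rule Bochner_Integration.integral_cong[OF refl])
      fix \<tau>
      have "cis ((t - \<tau>) * a (\<xi> + \<eta>)) * cis (\<tau> * b \<xi>) * cis (\<tau> * c \<eta>)
          = cis (t * a (\<xi> + \<eta>)) * cis (\<tau> * (b \<xi> + c (\<xi> + \<eta> - \<xi>) - a (\<xi> + \<eta>)))"
        unfolding cis_mult by (rule arg_cong[of _ _ cis]) (simp add: algebra_simps)
      then have "integrand F G t x \<tau> p = (cis (x * (\<xi> + \<eta>)) * cis (t * a (\<xi> + \<eta>)) * (F \<xi> * G \<eta> * m (\<xi>, \<eta>))) *
          cis (\<tau> * (b \<xi> + c (\<xi> + \<eta> - \<xi>) - a (\<xi> + \<eta>)))"
        unfolding integrand_def p by (simp add: mult_ac)
      then show "indicator A \<tau> *\<^sub>R integrand F G t x \<tau> p = (cis (x * (\<xi> + \<eta>)) * cis (t * a (\<xi> + \<eta>)) * (F \<xi> * G \<eta> * m (\<xi>, \<eta>))) *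
          (indicator A \<tau> *\<^sub>R cis (\<tau> * (b \<xi> + c (\<xi> + \<eta> - \<xi>) - a (\<xi> + \<eta>))))" by simp
    qed
    also have "\<dots> = (cis (x * (\<xi> + \<eta>)) * cis (t * a (\<xi> + \<eta>)) * (F \<xi> * G \<eta> * m (\<xi>, \<eta>))) * E \<xi> (\<xi> + \<eta>)"
      unfolding E_def by (rule integral_mult_right_zero)
    finally show ?thesis unfolding h_def p by (simp add: mult_ac)
  qed
  have "integrable lborel h"
    using lborel_pair.integrable_snd[OF int] unfolding inner .
  then have hint: "integrable (lborel \<Otimes>\<^sub>M lborel) h" by (simp add: lborel_prod)
  have "duhamel F G t A x = (LINT \<tau>|lborel. LINT p|lborel. indicator A \<tau> *\<^sub>R integrand F G t x \<tau> p)"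
    unfolding duhamel_def set_lebesgue_integral_def by simp
  also have "\<dots> = (LINT p|lborel. h p)"
    using lborel_pair.Fubini_integral[OF int] unfolding inner by simp
  also have "\<dots> = (LINT \<zeta>|lborel. LINT \<xi>|lborel. h (\<xi>, \<zeta> - \<xi>))"
    using integral_shear[OF hint] by (simp add: lborel_prod)
  also have "\<dots> = (LINT \<zeta>|lborel. cis (x * \<zeta>) * fiber F G t A \<zeta>)"
    unfolding h_def fiber_def E_def by (simp add: mult.assoc)
  finally show ?thesis .
qed

lemma fiber_measurable:
  assumes [measurable]: "F \<in> borel_measurable borel" "G \<in> borel_measurable borel" "A \<in> sets borel"
  shows "fiber F G t A \<in> borel_measurable borel"
proof -
  have [measurable]: "m \<in> borel_measurable (borel \<Otimes>\<^sub>M borel)" by (simp add: borel_prod)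
  show ?thesis unfolding fiber_def by measurable
qed

lemma fiber_support: "2 * L < \<bar>\<zeta>\<bar> \<Longrightarrow> fiber F G t A \<zeta> = 0"
proof -
  assume \<zeta>: "2 * L < \<bar>\<zeta>\<bar>"
  have "m (\<xi>, \<zeta> - \<xi>) = 0" for \<xi>
  proof (rule ccontr)
    assume "m (\<xi>, \<zeta> - \<xi>) \<noteq> 0"
    then have "\<bar>\<xi>\<bar> \<le> L" "\<bar>\<zeta> - \<xi>\<bar> \<le> L" using L(2) by blast+
    with \<zeta> show False by linarith
  qed
  then show ?thesis by (simp add: fiber_def)
qed

text \<open>Estimating the time integral trivially would give T^2. For fixed zeta the symbol times
  the time integral is instead an operator from functions of tau to functions of xi, applied to the
  indicator of \<open>A\<close>; its norm is bounded independently of \<open>A\<close>, so its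
  output has squared norm O(T). Cauchy-Schwarz in xi separates it from F(xi) G(zeta - xi), whose
  squared norm integrates over zeta to \<open>L2sq F * L2sq G\<close>.\<close>

lemma L2sq_fiber_bound:
  "\<exists>C\<ge>0. \<forall>F G t A T. F \<in> borel_measurable borel \<longrightarrow> G \<in> borel_measurable borel \<longrightarrow>
    A \<in> sets borel \<longrightarrow> A \<subseteq> {0..t} \<longrightarrow> emeasure lborel A \<le> ennreal T \<longrightarrow>
    L2sq (fiber F G t A) \<le> ennreal (C * T) * (L2sq F * L2sq G)"
proof -
  obtain C0 where C0: "0 \<le> C0" and kernel: "\<And>\<zeta> \<tau>.
    cmod (LINT \<xi>|lborel. m (\<xi>, \<zeta> - \<xi>) * cnj (m (\<xi>, \<zeta> - \<xi>)) * cis (\<tau> * (b \<xi> + c (\<zeta> - \<xi>)))) \<le> C0 / (1 + \<tau>\<^sup>2)"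
    using nonstationary_symbol_sq by blast
  define J where "J = enn2real (\<integral>\<^sup>+ y. ennreal (1 / (1 + y\<^sup>2)) \<partial>(lborel::real measure))"
  have J: "(\<integral>\<^sup>+ y. ennreal (1 / (1 + y\<^sup>2)) \<partial>(lborel::real measure)) = ennreal J" and J0: "0 \<le> J"
    unfolding J_def using nn_integral_inverse_1_plus_square_finite by (auto intro: ennreal_enn2real[symmetric])
  have "L2sq (fiber F G t A) \<le> ennreal (C0 * J * T) * (L2sq F * L2sq G)"
    if [measurable]: "F \<in> borel_measurable borel" "G \<in> borel_measurable borel" and A[measurable]: "A \<in> sets borel"
      and At: "A \<subseteq> {0..t}" and T: "emeasure lborel A \<le> ennreal T" for F G t A T
  proof -
    have [measurable]: "m \<in> borel_measurable (borel \<Otimes>\<^sub>M borel)" by (simp add: borel_prod)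
    have kS: "(\<integral>\<^sup>+ y. ennreal (C0 / (1 + y\<^sup>2)) \<partial>lborel) \<le> ennreal (C0 * J)"
    proof -
      have "ennreal (C0 / (1 + y\<^sup>2)) = ennreal C0 * ennreal (1 / (1 + y\<^sup>2))" for y :: real
        using C0 by (simp add: ennreal_mult'[symmetric])
      then show ?thesis using C0 by (simp add: nn_integral_cmult J ennreal_mult')
    qed
    define Th where "Th \<zeta> \<xi> \<tau> = m (\<xi>, \<zeta> - \<xi>) * cis (\<tau> * (b \<xi> + c (\<zeta> - \<xi>) - a \<zeta>))" for \<zeta> \<xi> \<tau>
    have Aint: "integrable lborel (\<lambda>\<tau>. complex_of_real (indicator A \<tau>))"
    proof -
      have "emeasure lborel A < \<infinity>" using T by (rule le_less_trans) simp
      then have "integrable lborel (indicator A :: real \<Rightarrow> real)" by (intro integrable_real_indicator) auto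
      then show ?thesis by simp
    qed
    have E: "(\<integral>\<^sup>+ \<xi>. ennreal ((cmod (LINT \<tau>|lborel. Th \<zeta> \<xi> \<tau> * of_real (indicator A \<tau>)))\<^sup>2) \<partial>lborel) \<le> ennreal (C0 * J * T)" for \<zeta>
    proof -
      \<comment> \<open>The roles in \<open>TTstar_bound\<close>: xi is the output variable, tau the
        input variable, and the input function is the indicator of the time set, whose squared L^2
        norm is the measure of \<open>A\<close>.\<close>
      have "(\<integral>\<^sup>+ \<xi>. ennreal ((cmod (LINT \<tau>|lborel. Th \<zeta> \<xi> \<tau> * of_real (indicator A \<tau>)))\<^sup>2) \<partial>lborel)
          \<le> ennreal (C0 * J) * (\<integral>\<^sup>+ \<tau>. ennreal ((cmod (of_real (indicator A \<tau>)))\<^sup>2) \<partial>lborel)"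
      proof (rule TTstar_bound[where \<theta> = "\<lambda>\<xi>. M * indicator {-L..L} \<xi>" and k = "\<lambda>y. C0 / (1 + y\<^sup>2)", OF _ _ _ Aint _ _ kS])
        show "(\<lambda>(\<xi>, \<tau>). Th \<zeta> \<xi> \<tau>) \<in> borel_measurable (lborel \<Otimes>\<^sub>M lborel)"
          unfolding Th_def by measurable
        show "cmod (Th \<zeta> \<xi> \<tau>) \<le> M * indicator {-L..L} \<xi>" for \<xi> \<tau>
          using m_bound[of \<xi> "\<zeta> - \<xi>"] M by (auto simp: Th_def norm_mult indicator_def split: if_splits)
        show "integrable lborel (\<lambda>\<xi>. (M * indicator {-L..L} \<xi>)\<^sup>2)"
          by (rule integrable_bounded_support[where B = "M\<^sup>2" and L = L]) (auto simp: indicator_def)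
        show "cmod (LINT \<xi>|lborel. Th \<zeta> \<xi> \<tau> * cnj (Th \<zeta> \<xi> \<tau>')) \<le> C0 / (1 + (\<tau> - \<tau>')\<^sup>2)" for \<tau> \<tau>'
        proof -
          \<comment> \<open>At fixed zeta the term with \<open>a\<close> does not depend on xi; it
            leaves the integral as a factor of modulus 1, and the kernel of
            \<open>nonstationary_symbol_sq\<close> remains.\<close>
          have "Th \<zeta> \<xi> \<tau> * cnj (Th \<zeta> \<xi> \<tau>') = cis (- ((\<tau> - \<tau>') * a \<zeta>)) *
              (m (\<xi>, \<zeta> - \<xi>) * cnj (m (\<xi>, \<zeta> - \<xi>)) * cis ((\<tau> - \<tau>') * (b \<xi> + c (\<zeta> - \<xi>))))" for \<xi>
          proof -
            have "cis (\<tau> * (b \<xi> + c (\<zeta> - \<xi>) - a \<zeta>)) * cnj (cis (\<tau>' * (b \<xi> + c (\<zeta> - \<xi>) - a \<zeta>)))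
              = cis (- ((\<tau> - \<tau>') * a \<zeta>)) * cis ((\<tau> - \<tau>') * (b \<xi> + c (\<zeta> - \<xi>)))"
              unfolding cis_cnj cis_mult by (rule arg_cong[of _ _ cis]) (simp add: algebra_simps)
            then show ?thesis unfolding Th_def by (simp add: mult_ac)
          qed
          then show ?thesis using kernel[of \<zeta> "\<tau> - \<tau>'"] by (simp add: norm_mult)
        qed
      qed measurable
      also have "(\<integral>\<^sup>+ \<tau>. ennreal ((cmod (of_real (indicator A \<tau>)))\<^sup>2) \<partial>lborel) = (\<integral>\<^sup>+ \<tau>. indicator A \<tau> \<partial>lborel)"
        by (intro nn_integral_cong) (auto simp: indicator_def)
      also have "\<dots> = emeasure lborel A" by simp
      also have "ennreal (C0 * J) * emeasure lborel A \<le> ennreal (C0 * J) * ennreal T"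
        by (intro mult_left_mono T) simp
      also have "\<dots> = ennreal (C0 * J * T)" using C0 J0 by (simp add: ennreal_mult'[symmetric])
      finally show ?thesis .
    qed
    define W where "W \<zeta> \<xi> = (LINT \<tau>|lborel. Th \<zeta> \<xi> \<tau> * of_real (indicator A \<tau>))" for \<zeta> \<xi>
    have W: "m (\<xi>, \<zeta> - \<xi>) * (LINT \<tau>|lborel. indicator A \<tau> *\<^sub>R cis (\<tau> * (b \<xi> + c (\<zeta> - \<xi>) - a \<zeta>))) = W \<zeta> \<xi>" for \<zeta> \<xi>
      unfolding W_def Th_def by (subst integral_mult_right_zero[symmetric]) (simp add: scaleR_conv_of_real mult_ac)
    have [measurable]: "W \<zeta> \<in> borel_measurable borel" for \<zeta>
      unfolding W_def Th_def by measurable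
    have pt: "ennreal ((cmod (fiber F G t A \<zeta>))\<^sup>2) \<le> ennreal (C0 * J * T) * (\<integral>\<^sup>+ \<xi>. ennreal ((cmod (F \<xi>))\<^sup>2) * ennreal ((cmod (G (\<zeta> - \<xi>)))\<^sup>2) \<partial>lborel)" for \<zeta>
    proof -
      have "ennreal (cmod (fiber F G t A \<zeta>)) \<le> (\<integral>\<^sup>+ \<xi>. ennreal (cmod (F \<xi> * G (\<zeta> - \<xi>) * W \<zeta> \<xi>)) \<partial>lborel)"
      proof (cases "integrable lborel (\<lambda>\<xi>. F \<xi> * G (\<zeta> - \<xi>) * W \<zeta> \<xi>)")
        case True
        then show ?thesis unfolding fiber_def W norm_mult norm_cis mult_1
          using integral_norm_bound_ennreal[OF True] by (simp add: norm_mult)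
      qed (simp add: fiber_def W not_integrable_integral_eq)
      then have "(ennreal (cmod (fiber F G t A \<zeta>)))\<^sup>2 \<le> (\<integral>\<^sup>+ \<xi>. ennreal (cmod (F \<xi> * G (\<zeta> - \<xi>) * W \<zeta> \<xi>)) \<partial>lborel)\<^sup>2"
        by (rule power_mono) simp
      also have "\<dots> = (\<integral>\<^sup>+ \<xi>. ennreal (cmod (F \<xi> * G (\<zeta> - \<xi>))) * ennreal (cmod (W \<zeta> \<xi>)) \<partial>lborel)\<^sup>2"
        by (simp add: norm_mult ennreal_mult')
      also have "\<dots> \<le> (\<integral>\<^sup>+ \<xi>. (ennreal (cmod (F \<xi> * G (\<zeta> - \<xi>))))\<^sup>2 \<partial>lborel) * (\<integral>\<^sup>+ \<xi>. (ennreal (cmod (W \<zeta> \<xi>)))\<^sup>2 \<partial>lborel)"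
        by (rule Cauchy_Schwarz_nn_integral) measurable
      also have "\<dots> \<le> (\<integral>\<^sup>+ \<xi>. ennreal ((cmod (F \<xi>))\<^sup>2) * ennreal ((cmod (G (\<zeta> - \<xi>)))\<^sup>2) \<partial>lborel) * ennreal (C0 * J * T)"
      proof (rule mult_mono)
        show "(\<integral>\<^sup>+ \<xi>. (ennreal (cmod (W \<zeta> \<xi>)))\<^sup>2 \<partial>lborel) \<le> ennreal (C0 * J * T)"
          using E[of \<zeta>] unfolding W_def by (simp add: ennreal_power)
      qed (simp_all add: ennreal_power norm_mult power_mult_distrib ennreal_mult')
      finally show ?thesis by (simp add: ennreal_power mult.commute)
    qed
    have "L2sq (fiber F G t A) \<le> (\<integral>\<^sup>+ \<zeta>. ennreal (C0 * J * T) * (\<integral>\<^sup>+ \<xi>. ennreal ((cmod (F \<xi>))\<^sup>2) * ennreal ((cmod (G (\<zeta> - \<xi>)))\<^sup>2) \<partial>lborel) \<partial>lborel)"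
      unfolding L2sq_def by (intro nn_integral_mono pt)
    also have "\<dots> = ennreal (C0 * J * T) * (\<integral>\<^sup>+ \<zeta>. \<integral>\<^sup>+ \<xi>. ennreal ((cmod (F \<xi>))\<^sup>2) * ennreal ((cmod (G (\<zeta> - \<xi>)))\<^sup>2) \<partial>lborel \<partial>lborel)"
      by (rule nn_integral_cmult) measurable
    also have "(\<integral>\<^sup>+ \<zeta>. \<integral>\<^sup>+ \<xi>. ennreal ((cmod (F \<xi>))\<^sup>2) * ennreal ((cmod (G (\<zeta> - \<xi>)))\<^sup>2) \<partial>lborel \<partial>lborel)
        = (\<integral>\<^sup>+ \<xi>. \<integral>\<^sup>+ \<zeta>. ennreal ((cmod (F \<xi>))\<^sup>2) * ennreal ((cmod (G (\<zeta> - \<xi>)))\<^sup>2) \<partial>lborel \<partial>lborel)"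
      by (rule lborel_pair.Fubini') measurable
    also have "\<dots> = (\<integral>\<^sup>+ \<xi>. ennreal ((cmod (F \<xi>))\<^sup>2) * L2sq G \<partial>lborel)"
      unfolding L2sq_def
      by (simp add: nn_integral_cmult nn_integral_lborel_diff(2)[of "\<lambda>\<eta>. ennreal ((cmod (G \<eta>))\<^sup>2)"])
    also have "\<dots> = L2sq F * L2sq G"
      unfolding L2sq_def by (rule nn_integral_multc) measurable
    finally show ?thesis .
  qed
  moreover have "0 \<le> C0 * J" using C0 J0 by simp
  ultimately show ?thesis by blast
qed

end

section \<open>Sup and L^2 bounds for early and late interaction times\<close>

lemma nn_integral_time_weight:
  fixes \<alpha> t T :: real
  assumes \<alpha>: "0 \<le> \<alpha>" "\<alpha> \<le> 1 / 2" and t: "0 < t" and T: "0 \<le> T" "T \<le> t / 2 \<or> T = t"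
  shows "(\<integral>\<^sup>+ \<tau>. ennreal ((t - \<tau>) powr (- \<alpha>)) * indicator {0..T} \<tau> \<partial>lborel) \<le> ennreal (2 * T * t powr (- \<alpha>))"
  using T(2)
proof
  assume half: "T \<le> t / 2"
  \<comment> \<open>Early times stay at distance at least t/2 from t, so the weight is almost
    constant; the factor lost is 2^alpha <= 2.\<close>
  have "(\<integral>\<^sup>+ \<tau>. ennreal ((t - \<tau>) powr (- \<alpha>)) * indicator {0..T} \<tau> \<partial>lborel)
      \<le> (\<integral>\<^sup>+ \<tau>. ennreal (2 * t powr (- \<alpha>)) * indicator {0..T} \<tau> \<partial>lborel)"
  proof (intro nn_integral_mono)
    fix \<tau>
    show "ennreal ((t - \<tau>) powr (- \<alpha>)) * indicator {0..T} \<tau> \<le> ennreal (2 * t powr (- \<alpha>)) * indicator {0..T} \<tau>"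
    proof (cases "\<tau> \<in> {0..T}")
      case True
      have "(t - \<tau>) powr (- \<alpha>) \<le> (t / 2) powr (- \<alpha>)"
        using True half t \<alpha> by (intro powr_mono2') auto
      also have "\<dots> = t powr (- \<alpha>) * 2 powr \<alpha>"
        using t by (simp add: powr_divide powr_minus_divide)
      also have "\<dots> \<le> t powr (- \<alpha>) * 2 powr 1"
        using \<alpha> by (intro mult_left_mono powr_mono) auto
      finally show ?thesis using True by (simp add: ennreal_leI mult.commute)
    qed simp
  qed
  also have "\<dots> = ennreal (2 * t powr (- \<alpha>)) * ennreal T"
    using T(1) by (simp add: nn_integral_cmult_indicator)
  also have "\<dots> = ennreal (2 * T * t powr (- \<alpha>))"
    using T(1) by (simp add: ennreal_mult'[symmetric] mult_ac)
  finally show ?thesis .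
next
  assume Tt: "T = t"
  \<comment> \<open>Over the whole interval the singularity at tau = t is integrable; the factor
    lost is 1/(1 - alpha) <= 2, so both cases share one constant.\<close>
  have "(\<integral>\<^sup>+ \<tau>. ennreal ((t - \<tau>) powr (- \<alpha>)) * indicator {0..T} \<tau> \<partial>lborel)
      = (\<integral>\<^sup>+ \<tau>. ennreal (indicator {0..t} (t - \<tau>) * (t - \<tau>) powr (- \<alpha>)) \<partial>lborel)"
    by (intro nn_integral_cong) (auto simp: Tt indicator_def)
  also have "\<dots> = (\<integral>\<^sup>+ y. ennreal (indicator {0..t} y * y powr (- \<alpha>)) \<partial>lborel)"
    using nn_integral_lborel_diff(1)[of "\<lambda>y. ennreal (indicator {0..t} y * y powr (- \<alpha>))" t] by simp
  also have "\<dots> = ennreal (t powr (- \<alpha> + 1) / (- \<alpha> + 1))"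
    using \<alpha> t has_integral_powr_from_0[of "- \<alpha>" t] by (intro nn_integral_has_integral_lebesgue) auto
  also have "\<dots> \<le> ennreal (2 * T * t powr (- \<alpha>))"
  proof (rule ennreal_leI)
    have "t powr (- \<alpha> + 1) / (- \<alpha> + 1) \<le> t powr (- \<alpha> + 1) / (1 / 2)"
      using \<alpha> by (intro divide_left_mono) auto
    also have "\<dots> = 2 * T * t powr (- \<alpha>)" using powr_add[of t "- \<alpha>" 1] t Tt by simp
    finally show "t powr (- \<alpha> + 1) / (- \<alpha> + 1) \<le> 2 * T * t powr (- \<alpha>)" .
  qed
  finally show ?thesis .
qed

lemma norm_LINT_le_LINT:
  fixes f :: "'a \<Rightarrow> 'b::{banach, second_countable_topology}"
  assumes g: "integrable N g" and fg: "\<And>x. norm (f x) \<le> g x"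
  shows "norm (LINT x|N. f x) \<le> (LINT x|N. g x)"
proof (cases "integrable N f")
  case True
  have "norm (LINT x|N. f x) \<le> (LINT x|N. norm (f x))" by (rule integral_norm_bound)
  also have "\<dots> \<le> (LINT x|N. g x)" using True g fg by (intro integral_mono) auto
  finally show ?thesis .
next
  case False
  have "0 \<le> (LINT x|N. g x)" using order_trans[OF norm_ge_zero fg] by (intro Bochner_Integration.integral_nonneg) auto
  with False show ?thesis by (simp add: not_integrable_integral_eq)
qed

lemma L1_le_L2_of_support:
  fixes f :: "real \<Rightarrow> complex"
  assumes [measurable]: "f \<in> borel_measurable borel" and f: "L2sq f \<le> ennreal (v\<^sup>2)" "0 \<le> v"
    and R: "0 \<le> R" and supp: "\<And>x. R < \<bar>x\<bar> \<Longrightarrow> f x = 0"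
  shows "integrable lborel f" and "(LINT x|lborel. cmod (f x)) \<le> sqrt (2 * R) * v"
proof -
  show int: "integrable lborel f"
    using le_less_trans[OF f(1)] by (intro integrable_L2_compact_support[OF _ _ supp]) auto
  have "cmod (LINT x|lborel. of_real (indicator {-R..R} x) * of_real (cmod (f x))) \<le> sqrt (2 * R) * v"
  proof (rule norm_LINT_mult_le_L2)
    have "L2sq (\<lambda>x. of_real (indicator {-R..R} x)) = (\<integral>\<^sup>+ x. indicator {-R..R} x \<partial>lborel)"
      unfolding L2sq_def by (intro nn_integral_cong) (auto simp: indicator_def)
    also have "\<dots> = ennreal (2 * R)" using R by simp
    finally show "L2sq (\<lambda>x. of_real (indicator {-R..R} x)) \<le> ennreal ((sqrt (2 * R))\<^sup>2)" using R by simp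
    show "L2sq (\<lambda>x. of_real (cmod (f x))) \<le> ennreal (v\<^sup>2)" using f(1) by (simp add: L2sq_def)
  qed (use f R in auto)
  moreover have "of_real (indicator {-R..R} x) * of_real (cmod (f x)) = complex_of_real (cmod (f x))" for x
    using supp[of x] by (cases "R < \<bar>x\<bar>") (auto simp: indicator_def)
  ultimately have "cmod (complex_of_real (LINT x|lborel. cmod (f x))) \<le> sqrt (2 * R) * v"
    using int by (simp only: integral_of_real[OF integrable_norm[OF int]])
  then show "(LINT x|lborel. cmod (f x)) \<le> sqrt (2 * R) * v" by simp
qed

text \<open>An integral against the transform of \<open>f\<close> is an average, over points y of
  the support of \<open>f\<close>, of oscillatory integrals with an additional phase. It is applied
  once to each of the two data, and reduces them to the linear phases that
  \<open>nonstationary_symbol\<close> can absorb.\<close>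

lemma norm_LINT_oscillatory_average_le:
  fixes f Q :: "real \<Rightarrow> complex"
  assumes f: "integrable lborel f" and Q: "integrable lborel Q"
    and \<phi>[measurable]: "(\<lambda>(y, \<xi>). \<phi> y \<xi>) \<in> borel_measurable (lborel \<Otimes>\<^sub>M lborel)"
    and B: "\<And>y. f y \<noteq> 0 \<Longrightarrow> cmod (LINT \<xi>|lborel. cis (\<phi> y \<xi>) * Q \<xi>) \<le> B"
  shows "cmod (LINT \<xi>|lborel. (LINT y|lborel. cis (\<phi> y \<xi>) * f y) * Q \<xi>) \<le> B * (LINT y|lborel. cmod (f y))"
proof -
  have [measurable]: "f \<in> borel_measurable borel" "Q \<in> borel_measurable borel" using f Q by auto
  have int: "integrable (lborel \<Otimes>\<^sub>M lborel) (\<lambda>(y, \<xi>). cis (\<phi> y \<xi>) * f y * Q \<xi>)"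
  proof (rule Bochner_Integration.integrable_bound[OF integrable_pair_mult[OF f Q]])
    show "(\<lambda>(y, \<xi>). cis (\<phi> y \<xi>) * f y * Q \<xi>) \<in> borel_measurable (lborel \<Otimes>\<^sub>M lborel)"
      by measurable
  qed (auto simp: norm_mult)
  have "(LINT \<xi>|lborel. (LINT y|lborel. cis (\<phi> y \<xi>) * f y) * Q \<xi>) = (LINT \<xi>|lborel. LINT y|lborel. cis (\<phi> y \<xi>) * f y * Q \<xi>)"
    by simp
  also have "\<dots> = (LINT y|lborel. LINT \<xi>|lborel. cis (\<phi> y \<xi>) * f y * Q \<xi>)"
    by (rule lborel_pair.Fubini_integral[OF int])
  also have "\<dots> = (LINT y|lborel. f y * (LINT \<xi>|lborel. cis (\<phi> y \<xi>) * Q \<xi>))"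
    by (subst integral_mult_right_zero[symmetric]) (simp only: mult_ac)
  finally have eq: "(LINT \<xi>|lborel. (LINT y|lborel. cis (\<phi> y \<xi>) * f y) * Q \<xi>) = (LINT y|lborel. f y * (LINT \<xi>|lborel. cis (\<phi> y \<xi>) * Q \<xi>))" .
  have "cmod (LINT y|lborel. f y * (LINT \<xi>|lborel. cis (\<phi> y \<xi>) * Q \<xi>)) \<le> (LINT y|lborel. B * cmod (f y))"
  proof (rule norm_LINT_le_LINT)
    show "integrable lborel (\<lambda>y. B * cmod (f y))" using f by simp
    show "cmod (f y * (LINT \<xi>|lborel. cis (\<phi> y \<xi>) * Q \<xi>)) \<le> B * cmod (f y)" for y
      using B[of y] by (cases "f y = 0") (auto simp: norm_mult mult.commute mult_right_mono)
  qed
  then show ?thesis unfolding eq by simp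
qed

context interaction
begin

text \<open>\<open>dispersive_estimate\<close> with s = t - tau is integrated in time. The free
  evolutions of the two inputs are unimodular factors in xi and in eta, so they can be put into
  \<open>V\<close> and \<open>W\<close> without changing the L^2 norms.\<close>

lemma duhamel_sup_bound:
  assumes \<theta>: "0 < \<theta>" "\<theta> < 1"
  shows "\<exists>C\<ge>0. \<forall>F G v w t T x. F \<in> borel_measurable borel \<longrightarrow> G \<in> borel_measurable borel \<longrightarrow>
    L2sq F \<le> ennreal (v\<^sup>2) \<longrightarrow> L2sq G \<le> ennreal (w\<^sup>2) \<longrightarrow> 0 \<le> v \<longrightarrow> 0 \<le> w \<longrightarrow>
    0 < t \<longrightarrow> 0 \<le> T \<longrightarrow> T \<le> t / 2 \<or> T = t \<longrightarrow>
    cmod (duhamel F G t {0..T} x) \<le> C * T * t powr (- \<theta> / 2) * v * w"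
proof -
  obtain C where C: "0 \<le> C" and disp: "\<And>s y V W v w. 0 < s \<Longrightarrow> V \<in> borel_measurable borel \<Longrightarrow> W \<in> borel_measurable borel \<Longrightarrow>
    L2sq V \<le> ennreal (v\<^sup>2) \<Longrightarrow> L2sq W \<le> ennreal (w\<^sup>2) \<Longrightarrow> 0 \<le> v \<Longrightarrow> 0 \<le> w \<Longrightarrow>
    cmod (LINT p|lborel. (case p of (\<xi>, \<eta>) \<Rightarrow> cis (y * (\<xi> + \<eta>) + s * a (\<xi> + \<eta>)) * m (\<xi>, \<eta>) * V \<xi> * W \<eta>))
      \<le> C * s powr (- \<theta> / 2) * v * w"
    using dispersive_estimate[OF \<theta>] by blast
  have "cmod (duhamel F G t {0..T} x) \<le> 2 * C * T * t powr (- \<theta> / 2) * v * w"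
    if [measurable]: "F \<in> borel_measurable borel" "G \<in> borel_measurable borel"
      and F: "L2sq F \<le> ennreal (v\<^sup>2)" and G: "L2sq G \<le> ennreal (w\<^sup>2)" and vw: "0 \<le> v" "0 \<le> w"
      and t: "0 < t" and T: "0 \<le> T" "T \<le> t / 2 \<or> T = t" for F G v w t T x
  proof -
    define I where "I \<tau> = (LINT p|lborel. integrand F G t x \<tau> p)" for \<tau>
    have I: "cmod (I \<tau>) \<le> C * (t - \<tau>) powr (- \<theta> / 2) * v * w" if "\<tau> < t" for \<tau>
    proof -
      have eq: "integrand F G t x \<tau> p = (case p of (\<xi>, \<eta>) \<Rightarrow> cis (x * (\<xi> + \<eta>) + (t - \<tau>) * a (\<xi> + \<eta>)) * m (\<xi>, \<eta>)
          * (cis (\<tau> * b \<xi>) * F \<xi>) * (cis (\<tau> * c \<eta>) * G \<eta>))" for p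
        by (simp add: integrand_def cis_mult[symmetric] mult_ac split: prod.split)
      show ?thesis unfolding I_def eq
        by (rule disp) (use that F G vw in \<open>simp_all add: L2sq_unimodular_mult\<close>)
    qed
    have "ennreal (cmod (duhamel F G t {0..T} x)) \<le> (\<integral>\<^sup>+ \<tau>. ennreal (cmod (indicator {0..T} \<tau> *\<^sub>R I \<tau>)) \<partial>lborel)"
    proof (cases "integrable lborel (\<lambda>\<tau>. indicator {0..T} \<tau> *\<^sub>R I \<tau>)")
      case True
      show ?thesis unfolding duhamel_def set_lebesgue_integral_def I_def[symmetric]
        by (rule integral_norm_bound_ennreal[OF True])
    qed (simp add: duhamel_def set_lebesgue_integral_def I_def[symmetric] not_integrable_integral_eq)
    also have "\<dots> \<le> (\<integral>\<^sup>+ \<tau>. ennreal (C * v * w) * (ennreal ((t - \<tau>) powr (- (\<theta> / 2))) * indicator {0..T} \<tau>) \<partial>lborel)"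
    proof (rule nn_integral_mono_AE)
      \<comment> \<open>The dispersive estimate needs tau < t strictly; the endpoint, which occurs
        when \<open>T\<close> = t, is a null set.\<close>
      have "AE \<tau> in lborel. \<tau> \<noteq> t" by (rule AE_lborel_singleton)
      then show "AE \<tau> in lborel. ennreal (cmod (indicator {0..T} \<tau> *\<^sub>R I \<tau>)) \<le>
          ennreal (C * v * w) * (ennreal ((t - \<tau>) powr (- (\<theta> / 2))) * indicator {0..T} \<tau>)"
      proof eventually_elim
        case (elim \<tau>)
        show ?case
        proof (cases "\<tau> \<in> {0..T}")
          case True
          then have "\<tau> < t" using elim T t by auto
          from I[OF this] have "cmod (I \<tau>) \<le> (C * v * w) * (t - \<tau>) powr (- (\<theta> / 2))" by (simp add: mult_ac)
          then have "ennreal (cmod (I \<tau>)) \<le> ennreal (C * v * w) * ennreal ((t - \<tau>) powr (- (\<theta> / 2)))"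
            using C vw by (simp add: ennreal_mult'[symmetric] ennreal_leI)
          then show ?thesis using True by simp
        qed simp
      qed
    qed
    also have "\<dots> = ennreal (C * v * w) * (\<integral>\<^sup>+ \<tau>. ennreal ((t - \<tau>) powr (- (\<theta> / 2))) * indicator {0..T} \<tau> \<partial>lborel)"
      by (rule nn_integral_cmult) measurable
    also have "\<dots> \<le> ennreal (C * v * w) * ennreal (2 * T * t powr (- (\<theta> / 2)))"
      using \<theta> by (intro mult_left_mono nn_integral_time_weight t T) auto
    also have "\<dots> = ennreal (2 * C * T * t powr (- \<theta> / 2) * v * w)"
      using C vw by (simp add: ennreal_mult'[symmetric] mult_ac)
    finally show ?thesis using C vw T by (subst (asm) ennreal_le_iff) auto
  qed
  then show ?thesis using C by (intro exI[of _ "2 * C"]) auto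
qed

lemma fiber_integrable:
  assumes "F \<in> borel_measurable borel" "G \<in> borel_measurable borel" "A \<in> sets borel"
    and "L2sq (fiber F G t A) < \<infinity>"
  shows "integrable lborel (fiber F G t A)"
  using assms fiber_measurable fiber_support
  by (intro integrable_L2_compact_support[where r = "2 * L"]) auto

lemma L2sq_duhamel_le_fiber:
  assumes FG: "F \<in> borel_measurable borel" "G \<in> borel_measurable borel"
    and fin: "L2sq F < \<infinity>" "L2sq G < \<infinity>" and A: "A \<in> sets borel" "A \<subseteq> {0..t}"
    and U: "L2sq (fiber F G t A) < \<infinity>"
  shows "L2sq (duhamel F G t A) \<le> ennreal (2 * pi) * L2sq (fiber F G t A)"
  using plancherel_bound_inverse[OF fiber_integrable[OF FG A(1) U]]
  unfolding duhamel_fiber[OF FG fin A, symmetric] .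

lemma duhamel_L2_bound:
  "\<exists>C\<ge>0. \<forall>F G v w t T. F \<in> borel_measurable borel \<longrightarrow> G \<in> borel_measurable borel \<longrightarrow>
    L2sq F \<le> ennreal (v\<^sup>2) \<longrightarrow> L2sq G \<le> ennreal (w\<^sup>2) \<longrightarrow> 0 \<le> T \<longrightarrow> T \<le> t \<longrightarrow>
    L2sq (duhamel F G t {0..T}) \<le> ennreal ((C * sqrt T * v * w)\<^sup>2)"
proof -
  obtain C where C: "0 \<le> C" and fb: "\<And>F G t A T. F \<in> borel_measurable borel \<Longrightarrow> G \<in> borel_measurable borel \<Longrightarrow>
    A \<in> sets borel \<Longrightarrow> A \<subseteq> {0..t} \<Longrightarrow> emeasure lborel A \<le> ennreal T \<Longrightarrow>
    L2sq (fiber F G t A) \<le> ennreal (C * T) * (L2sq F * L2sq G)"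
    using L2sq_fiber_bound by blast
  have "L2sq (duhamel F G t {0..T}) \<le> ennreal ((sqrt (2 * pi * C) * sqrt T * v * w)\<^sup>2)"
    if FG: "F \<in> borel_measurable borel" "G \<in> borel_measurable borel"
      and F: "L2sq F \<le> ennreal (v\<^sup>2)" and G: "L2sq G \<le> ennreal (w\<^sup>2)" and T: "0 \<le> T" "T \<le> t" for F G v w t T
  proof -
    have "L2sq (fiber F G t {0..T}) \<le> ennreal (C * T) * (L2sq F * L2sq G)"
      using FG T by (intro fb) auto
    also have "\<dots> \<le> ennreal (C * T) * (ennreal (v\<^sup>2) * ennreal (w\<^sup>2))"
      by (intro mult_mono F G) auto
    also have "\<dots> = ennreal (C * T * (v\<^sup>2 * w\<^sup>2))"
      using C T by (simp add: ennreal_mult'[symmetric])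
    finally have fib: "L2sq (fiber F G t {0..T}) \<le> ennreal (C * T * (v\<^sup>2 * w\<^sup>2))" .
    have "L2sq (duhamel F G t {0..T}) \<le> ennreal (2 * pi) * L2sq (fiber F G t {0..T})"
      using FG T le_less_trans[OF F] le_less_trans[OF G] le_less_trans[OF fib]
      by (intro L2sq_duhamel_le_fiber) auto
    also have "\<dots> \<le> ennreal (2 * pi) * ennreal (C * T * (v\<^sup>2 * w\<^sup>2))"
      by (intro mult_left_mono fib) simp
    also have "\<dots> = ennreal ((sqrt (2 * pi * C) * sqrt T * v * w)\<^sup>2)"
      using C T by (simp add: ennreal_mult'[symmetric] power_mult_distrib mult_ac)
    finally show ?thesis .
  qed
  then show ?thesis using C by (intro exI[of _ "sqrt (2 * pi * C)"]) auto
qed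

text \<open>The fiber lives on |zeta| <= 2L, a set of measure 4L, so a pointwise bound controls its
  L^1 and L^2 norms at once; the former gives the sup norm, the latter the L^2 norm with the factor
  2 pi of Plancherel.\<close>

lemma duhamel_bounds_of_fiber_bound:
  assumes FG: "F \<in> borel_measurable borel" "G \<in> borel_measurable borel"
    and fin: "L2sq F < \<infinity>" "L2sq G < \<infinity>" and A: "A \<in> sets borel" "A \<subseteq> {0..t}"
    and B: "\<And>\<zeta>. cmod (fiber F G t A \<zeta>) \<le> B"
  shows "cmod (duhamel F G t A x) \<le> 4 * L * B"
    and "L2sq (duhamel F G t A) \<le> ennreal ((sqrt (8 * pi * L) * B)\<^sup>2)"
proof -
  have B0: "0 \<le> B" using order_trans[OF norm_ge_zero B] .
  have Bi: "cmod (fiber F G t A \<zeta>) \<le> B * indicator {- (2 * L)..2 * L} \<zeta>" for \<zeta>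
    using B[of \<zeta>] fiber_support[of \<zeta> F G t A] by (cases "2 * L < \<bar>\<zeta>\<bar>") (auto simp: indicator_def)
  have "cmod (duhamel F G t A x) \<le> 2 * (2 * L) * B"
    unfolding duhamel_fiber[OF FG fin A]
    by (rule norm_LINT_bounded_support_le) (use Bi B0 L in \<open>auto simp: norm_mult\<close>)
  then show "cmod (duhamel F G t A x) \<le> 4 * L * B" by simp
  have "L2sq (fiber F G t A) \<le> (\<integral>\<^sup>+ \<zeta>. ennreal (B\<^sup>2) * indicator {- (2 * L)..2 * L} \<zeta> \<partial>lborel)"
    unfolding L2sq_def
  proof (rule nn_integral_mono)
    fix \<zeta>
    have "(cmod (fiber F G t A \<zeta>))\<^sup>2 \<le> (B * indicator {- (2 * L)..2 * L} \<zeta>)\<^sup>2"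
      by (intro power_mono Bi) simp
    then show "ennreal ((cmod (fiber F G t A \<zeta>))\<^sup>2) \<le> ennreal (B\<^sup>2) * indicator {- (2 * L)..2 * L} \<zeta>"
      by (cases "\<zeta> \<in> {- (2 * L)..2 * L}") (auto simp: ennreal_leI)
  qed
  also have "\<dots> = ennreal (B\<^sup>2) * ennreal (4 * L)"
    using L by (simp add: nn_integral_cmult_indicator)
  also have "\<dots> = ennreal (B\<^sup>2 * (4 * L))" by (simp add: ennreal_mult'[symmetric])
  finally have fib: "L2sq (fiber F G t A) \<le> ennreal (B\<^sup>2 * (4 * L))" .
  have "L2sq (duhamel F G t A) \<le> ennreal (2 * pi) * L2sq (fiber F G t A)"
    using le_less_trans[OF fib] by (intro L2sq_duhamel_le_fiber FG fin A) auto
  also have "\<dots> \<le> ennreal (2 * pi) * ennreal (B\<^sup>2 * (4 * L))"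
    by (intro mult_left_mono fib) simp
  also have "\<dots> = ennreal ((sqrt (8 * pi * L) * B)\<^sup>2)"
    using L by (simp add: ennreal_mult'[symmetric] power_mult_distrib mult_ac)
  finally show "L2sq (duhamel F G t A) \<le> ennreal ((sqrt (8 * pi * L) * B)\<^sup>2)" .
qed

text \<open>Writing both transforms as integrals over $|y|, |z| \le R$ adds $-(y - z)\xi$ to the phase, that is,
  $\mu = (y - z)/\tau$, which is at most $\epsilon/2$ for $\tau > T$.\<close>

lemma fiber_late_bound:
  "\<exists>C\<ge>0. \<forall>f g v w R T t \<zeta>. f \<in> borel_measurable borel \<longrightarrow> g \<in> borel_measurable borel \<longrightarrow>
    L2sq f \<le> ennreal (v\<^sup>2) \<longrightarrow> L2sq g \<le> ennreal (w\<^sup>2) \<longrightarrow> 0 \<le> v \<longrightarrow> 0 \<le> w \<longrightarrow>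
    (\<forall>x. R < \<bar>x\<bar> \<longrightarrow> f x = 0 \<and> g x = 0) \<longrightarrow> 0 < R \<longrightarrow> 4 * R / \<epsilon> \<le> T \<longrightarrow> T \<le> t \<longrightarrow>
    cmod (fiber (\<lambda>\<xi>. LINT y|lborel. cis (- y * \<xi>) * f y) (\<lambda>\<xi>. LINT y|lborel. cis (- y * \<xi>) * g y) t {T<..t} \<zeta>)
      \<le> C * t * R * v * w / T ^ N"
proof -
  obtain C where C: "0 \<le> C" and decay: "\<And>\<zeta> \<mu> \<tau>. \<bar>\<mu>\<bar> \<le> \<epsilon> / 2 \<Longrightarrow> \<tau> \<noteq> 0 \<Longrightarrow>
    cmod (LINT \<xi>|lborel. m (\<xi>, \<zeta> - \<xi>) * cis (\<tau> * (b \<xi> + c (\<zeta> - \<xi>) - \<mu> * \<xi>))) \<le> C / \<bar>\<tau>\<bar> ^ N"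
    using nonstationary_symbol[of N] by blast
  have "cmod (fiber (\<lambda>\<xi>. LINT y|lborel. cis (- y * \<xi>) * f y) (\<lambda>\<xi>. LINT y|lborel. cis (- y * \<xi>) * g y) t {T<..t} \<zeta>)
      \<le> 2 * C * t * R * v * w / T ^ N"
    if [measurable]: "f \<in> borel_measurable borel" "g \<in> borel_measurable borel"
      and f: "L2sq f \<le> ennreal (v\<^sup>2)" and g: "L2sq g \<le> ennreal (w\<^sup>2)" and vw: "0 \<le> v" "0 \<le> w"
      and supp: "\<forall>x. R < \<bar>x\<bar> \<longrightarrow> f x = 0 \<and> g x = 0" and R: "0 < R" and RT: "4 * R / \<epsilon> \<le> T" and T: "T \<le> t"
    for f g v w R T t \<zeta>
  proof -
    have T0: "0 < T" using R RT \<epsilon>(1) by (smt (verit) divide_pos_pos)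
    define F where "F \<xi> = (LINT y|lborel. cis (- y * \<xi>) * f y)" for \<xi>
    define G where "G \<xi> = (LINT y|lborel. cis (- y * \<xi>) * g y)" for \<xi>
    define f1 where "f1 = (LINT y|lborel. cmod (f y))"
    define g1 where "g1 = (LINT y|lborel. cmod (g y))"
    have fi: "integrable lborel f" and f1: "f1 \<le> sqrt (2 * R) * v"
      unfolding f1_def using L1_le_L2_of_support[of f v R] f vw R supp by auto
    have gi: "integrable lborel g" and g1: "g1 \<le> sqrt (2 * R) * w"
      unfolding g1_def using L1_le_L2_of_support[of g w R] g vw R supp by auto
    have pos: "0 \<le> f1" "0 \<le> g1" unfolding f1_def g1_def by (auto intro: Bochner_Integration.integral_nonneg)
    \<comment> \<open>Passing from L^2 to L^1 on [-R, R] costs sqrt (2R) for each of the two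
      functions; this is the factor R in the bound.\<close>
    have fg1: "f1 * g1 \<le> 2 * R * v * w"
    proof -
      have "f1 * g1 \<le> (sqrt (2 * R) * v) * (sqrt (2 * R) * w)"
        using f1 g1 pos vw R by (intro mult_mono) auto
      also have "\<dots> = (sqrt (2 * R) * sqrt (2 * R)) * v * w" by (simp only: mult_ac)
      also have "\<dots> = 2 * R * v * w" using R by simp
      finally show ?thesis .
    qed
    have Fb: "cmod (F \<xi>) \<le> f1" for \<xi>
      unfolding F_def f1_def by (rule order_trans[OF integral_norm_bound]) (simp add: norm_mult)
    have Gb: "cmod (G \<xi>) \<le> g1" for \<xi>
      unfolding G_def g1_def by (rule order_trans[OF integral_norm_bound]) (simp add: norm_mult)
    have [measurable]: "F \<in> borel_measurable borel" "G \<in> borel_measurable borel"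
      unfolding F_def G_def by measurable
    have [measurable]: "m \<in> borel_measurable (borel \<Otimes>\<^sub>M borel)" by (simp add: borel_prod)
    define Q where "Q \<tau> \<xi> = m (\<xi>, \<zeta> - \<xi>) * cis (\<tau> * (b \<xi> + c (\<zeta> - \<xi>) - a \<zeta>))" for \<tau> \<xi>
    have mb: "cmod (m (\<xi>, \<zeta> - \<xi>)) \<le> M * indicator {-L..L} \<xi>" for \<xi>
      using m_bound[of \<xi> "\<zeta> - \<xi>"] M by (auto simp: indicator_def split: if_splits)
    have [measurable]: "Q \<tau> \<in> borel_measurable borel" for \<tau>
      unfolding Q_def by measurable
    have Qint: "integrable lborel (Q \<tau>)" for \<tau>
      by (rule integrable_bounded_support[where B = M and L = L]) (use mb in \<open>simp_all add: Q_def norm_mult\<close>)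
    have GQint: "integrable lborel (\<lambda>\<xi>. cis (- y * \<xi>) * (G (\<zeta> - \<xi>) * Q \<tau> \<xi>))" for \<tau> y
    proof (rule integrable_bounded_support[where B = "g1 * M" and L = L])
      show "cmod (cis (- y * \<xi>) * (G (\<zeta> - \<xi>) * Q \<tau> \<xi>)) \<le> g1 * M * indicator {-L..L} \<xi>" for \<xi>
        using mult_mono[OF Gb[of "\<zeta> - \<xi>"] mb[of \<xi>]] pos by (simp add: Q_def norm_mult mult.assoc)
    qed measurable
    have base: "cmod (LINT \<xi>|lborel. cis (- z * (\<zeta> - \<xi>)) * (cis (- y * \<xi>) * Q \<tau> \<xi>)) \<le> C / T ^ N"
      if \<tau>: "T < \<tau>" and yz: "\<bar>y\<bar> \<le> R" "\<bar>z\<bar> \<le> R" for \<tau> y z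
    proof -
      define \<mu> where "\<mu> = (y - z) / \<tau>"
      have "\<bar>\<mu>\<bar> \<le> \<epsilon> / 2"
      proof -
        have "\<bar>y - z\<bar> \<le> 2 * R" using yz by linarith
        also have "\<dots> \<le> \<epsilon> / 2 * T" using RT \<epsilon>(1) by (simp add: field_simps)
        also have "\<dots> \<le> \<epsilon> / 2 * \<tau>" using \<tau> \<epsilon>(1) by simp
        finally show ?thesis using T0 \<tau> by (simp add: \<mu>_def field_simps)
      qed
      then have "cmod (LINT \<xi>|lborel. m (\<xi>, \<zeta> - \<xi>) * cis (\<tau> * (b \<xi> + c (\<zeta> - \<xi>) - \<mu> * \<xi>))) \<le> C / \<bar>\<tau>\<bar> ^ N"
        using T0 \<tau> by (intro decay) auto
      also have "\<dots> \<le> C / T ^ N"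
        using T0 \<tau> C by (intro divide_left_mono power_mono mult_pos_pos zero_less_power) auto
      finally have le: "cmod (LINT \<xi>|lborel. m (\<xi>, \<zeta> - \<xi>) * cis (\<tau> * (b \<xi> + c (\<zeta> - \<xi>) - \<mu> * \<xi>))) \<le> C / T ^ N" .
      have "cis (- z * (\<zeta> - \<xi>)) * (cis (- y * \<xi>) * Q \<tau> \<xi>) = cis (- z * \<zeta> - \<tau> * a \<zeta>) *
          (m (\<xi>, \<zeta> - \<xi>) * cis (\<tau> * (b \<xi> + c (\<zeta> - \<xi>) - \<mu> * \<xi>)))" for \<xi>
      proof -
        have \<mu>\<tau>: "\<tau> * \<mu> = y - z" using T0 \<tau> by (simp add: \<mu>_def)
        have "\<tau> * (b \<xi> + c (\<zeta> - \<xi>) - \<mu> * \<xi>) = \<tau> * (b \<xi> + c (\<zeta> - \<xi>)) - (\<tau> * \<mu>) * \<xi>"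
          by (simp add: algebra_simps)
        then have "cis (- z * (\<zeta> - \<xi>)) * cis (- y * \<xi>) * cis (\<tau> * (b \<xi> + c (\<zeta> - \<xi>) - a \<zeta>))
          = cis (- z * \<zeta> - \<tau> * a \<zeta>) * cis (\<tau> * (b \<xi> + c (\<zeta> - \<xi>) - \<mu> * \<xi>))"
          unfolding cis_mult \<mu>\<tau> by (intro arg_cong[of _ _ cis]) (simp add: algebra_simps)
        then show ?thesis unfolding Q_def by (simp add: mult_ac)
      qed
      then show ?thesis using le by (simp add: norm_mult)
    qed
    \<comment> \<open>The transform of \<open>f\<close> is unfolded first, then that of
      \<open>g\<close>; what remains is the symbol with linear phases, which \<open>base\<close>
      estimates.\<close>
    have slice: "cmod (LINT \<xi>|lborel. F \<xi> * (G (\<zeta> - \<xi>) * Q \<tau> \<xi>)) \<le> C / T ^ N * g1 * f1" if \<tau>: "T < \<tau>" for \<tau>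
      unfolding F_def f1_def
    proof (rule norm_LINT_oscillatory_average_le[OF fi])
      show "integrable lborel (\<lambda>\<xi>. G (\<zeta> - \<xi>) * Q \<tau> \<xi>)" using GQint[of 0 \<tau>] by simp
      show "cmod (LINT \<xi>|lborel. cis (- y * \<xi>) * (G (\<zeta> - \<xi>) * Q \<tau> \<xi>)) \<le> C / T ^ N * g1" if "f y \<noteq> 0" for y
      proof -
        have y: "\<bar>y\<bar> \<le> R" using that supp by force
        have "(LINT \<xi>|lborel. cis (- y * \<xi>) * (G (\<zeta> - \<xi>) * Q \<tau> \<xi>))
            = (LINT \<xi>|lborel. (LINT z|lborel. cis (- z * (\<zeta> - \<xi>)) * g z) * (cis (- y * \<xi>) * Q \<tau> \<xi>))"
          unfolding G_def by (simp only: mult_ac)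
        also have "cmod \<dots> \<le> C / T ^ N * g1"
          unfolding g1_def
        proof (rule norm_LINT_oscillatory_average_le[OF gi])
          show "integrable lborel (\<lambda>\<xi>. cis (- y * \<xi>) * Q \<tau> \<xi>)"
            by (rule Bochner_Integration.integrable_bound[OF Qint[of \<tau>]]) (auto simp: norm_mult Q_def)
          show "cmod (LINT \<xi>|lborel. cis (- z * (\<zeta> - \<xi>)) * (cis (- y * \<xi>) * Q \<tau> \<xi>)) \<le> C / T ^ N" if "g z \<noteq> 0" for z
            using that supp by (intro base[OF \<tau> y]) force
        qed measurable
        finally show ?thesis .
      qed
    qed measurable
    have Aint: "integrable lborel (indicator {T<..t} :: real \<Rightarrow> real)"
      using T by (intro integrable_real_indicator) auto
    have int: "integrable (lborel \<Otimes>\<^sub>M lborel) (\<lambda>(\<xi>, \<tau>). indicator {T<..t} \<tau> *\<^sub>R (F \<xi> * (G (\<zeta> - \<xi>) * Q \<tau> \<xi>)))"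
    proof (rule Bochner_Integration.integrable_bound)
      have "integrable lborel (\<lambda>\<xi>. f1 * g1 * M * indicator {-L..L} \<xi> :: real)"
        by (intro integrable_mult_right integrable_real_indicator) (auto simp: emeasure_lborel_Icc_eq)
      from integrable_pair_mult[OF this Aint]
      show "integrable (lborel \<Otimes>\<^sub>M lborel) (\<lambda>(\<xi>, \<tau>). (f1 * g1 * M * indicator {-L..L} \<xi>) * indicator {T<..t} \<tau>)" .
      show "AE p in lborel \<Otimes>\<^sub>M lborel. norm (case p of (\<xi>, \<tau>) \<Rightarrow> indicator {T<..t} \<tau> *\<^sub>R (F \<xi> * (G (\<zeta> - \<xi>) * Q \<tau> \<xi>)))
          \<le> norm (case p of (\<xi>, \<tau>) \<Rightarrow> (f1 * g1 * M * indicator {-L..L} \<xi>) * indicator {T<..t} \<tau>)"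
      proof (rule AE_I2, clarify)
        fix \<xi> \<tau>
        have "cmod (F \<xi>) * (cmod (G (\<zeta> - \<xi>)) * cmod (m (\<xi>, \<zeta> - \<xi>))) \<le> f1 * (g1 * (M * indicator {-L..L} \<xi>))"
          by (intro mult_mono Fb Gb mb) (auto simp: pos)
        then have "cmod (F \<xi>) * (cmod (G (\<zeta> - \<xi>)) * cmod (m (\<xi>, \<zeta> - \<xi>))) * indicator {T<..t} \<tau> \<le> f1 * (g1 * (M * indicator {-L..L} \<xi>)) * indicator {T<..t} \<tau>"
          by (rule mult_right_mono) simp
        then show "norm (indicator {T<..t} \<tau> *\<^sub>R (F \<xi> * (G (\<zeta> - \<xi>) * Q \<tau> \<xi>))) \<le> norm ((f1 * g1 * M * indicator {-L..L} \<xi>) * indicator {T<..t} \<tau>)"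
          using pos M by (simp add: Q_def norm_mult abs_mult mult_ac)
      qed
    qed (unfold Q_def, measurable)
    have "fiber F G t {T<..t} \<zeta> = cis (t * a \<zeta>) * (LINT \<xi>|lborel. LINT \<tau>|lborel. indicator {T<..t} \<tau> *\<^sub>R (F \<xi> * (G (\<zeta> - \<xi>) * Q \<tau> \<xi>)))"
    proof -
      have "F \<xi> * G (\<zeta> - \<xi>) * (m (\<xi>, \<zeta> - \<xi>) * (LINT \<tau>|lborel. indicator {T<..t} \<tau> *\<^sub>R cis (\<tau> * (b \<xi> + c (\<zeta> - \<xi>) - a \<zeta>))))
          = (LINT \<tau>|lborel. indicator {T<..t} \<tau> *\<^sub>R (F \<xi> * (G (\<zeta> - \<xi>) * Q \<tau> \<xi>)))" for \<xi>
        unfolding mult.assoc[symmetric] by (subst integral_mult_right_zero[symmetric]) (simp add: Q_def mult_ac)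
      then show ?thesis unfolding fiber_def by simp
    qed
    also have "\<dots> = cis (t * a \<zeta>) * (LINT \<tau>|lborel. LINT \<xi>|lborel. indicator {T<..t} \<tau> *\<^sub>R (F \<xi> * (G (\<zeta> - \<xi>) * Q \<tau> \<xi>)))"
      using lborel_pair.Fubini_integral[OF int] by simp
    finally have "cmod (fiber F G t {T<..t} \<zeta>) = cmod (LINT \<tau>|lborel. indicator {T<..t} \<tau> *\<^sub>R (LINT \<xi>|lborel. F \<xi> * (G (\<zeta> - \<xi>) * Q \<tau> \<xi>)))"
      by (simp add: norm_mult)
    also have "\<dots> \<le> (LINT \<tau>|lborel. (C / T ^ N * g1 * f1) * indicator {T<..t} \<tau>)"
    proof (rule norm_LINT_le_LINT)
      show "integrable lborel (\<lambda>\<tau>. (C / T ^ N * g1 * f1) * indicator {T<..t} \<tau> :: real)"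
        using Aint by (rule integrable_mult_right)
      show "norm (indicator {T<..t} \<tau> *\<^sub>R (LINT \<xi>|lborel. F \<xi> * (G (\<zeta> - \<xi>) * Q \<tau> \<xi>))) \<le> (C / T ^ N * g1 * f1) * indicator {T<..t} \<tau>" for \<tau>
        using slice by (auto simp: indicator_def)
    qed
    also have "\<dots> = (C / T ^ N) * (f1 * g1) * (t - T)" using T by simp
    also have "\<dots> \<le> (C / T ^ N) * (2 * R * v * w) * t"
      using C T0 T pos vw R by (intro mult_mono fg1 mult_nonneg_nonneg) auto
    also have "\<dots> = 2 * C * t * R * v * w / T ^ N" by simp
    finally show ?thesis unfolding F_def G_def .
  qed
  then show ?thesis using C by (intro exI[of _ "2 * C"]) auto
qed

end

section \<open>Decomposition into annuli and interpolation\<close>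

lemma wnorm_nonneg: "0 \<le> wnorm s f"
  unfolding wnorm_def by (intro real_sqrt_ge_zero Bochner_Integration.integral_nonneg) auto

text \<open>Chebyshev's inequality for the weight. The radius \<open>r\<close> and the gain
  \<open>\<rho>\<close> are kept separate so that r = -1 with \<open>\<rho>\<close> = 1 covers the
  full norm, and equal values cover the exterior of a ball.\<close>

lemma L2tail_le_wnorm:
  assumes f: "in_L2s s f" and s: "0 \<le> s" and \<rho>: "0 < \<rho>" and r: "\<And>x. r < \<bar>x\<bar> \<Longrightarrow> \<rho>\<^sup>2 \<le> 1 + x\<^sup>2"
  shows "L2tail f r \<le> ennreal ((\<rho> powr (- s) * wnorm s f)\<^sup>2)"
proof -
  have [measurable]: "f \<in> borel_measurable borel"
    and int: "integrable lborel (\<lambda>x. (1 + x\<^sup>2) powr s * (cmod (f x))\<^sup>2)"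
    using f by (auto simp: in_L2s_def)
  have "L2tail f r \<le> (\<integral>\<^sup>+ x. ennreal (\<rho> powr (- (2 * s))) * ennreal ((1 + x\<^sup>2) powr s * (cmod (f x))\<^sup>2) \<partial>lborel)"
    unfolding L2tail_def L2sq_def
  proof (rule nn_integral_mono)
    fix x
    show "ennreal ((cmod (if r < \<bar>x\<bar> then f x else 0))\<^sup>2) \<le> ennreal (\<rho> powr (- (2 * s))) * ennreal ((1 + x\<^sup>2) powr s * (cmod (f x))\<^sup>2)"
    proof (cases "r < \<bar>x\<bar>")
      case True
      have "\<rho> powr (2 * s) = (\<rho>\<^sup>2) powr s"
        using \<rho> by (simp add: powr_powr flip: powr_numeral)
      also have "\<dots> \<le> (1 + x\<^sup>2) powr s"
        using r[OF True] s by (intro powr_mono2) auto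
      finally have "1 \<le> \<rho> powr (- (2 * s)) * (1 + x\<^sup>2) powr s"
        using \<rho> by (simp add: powr_minus field_simps)
      then have "1 * (cmod (f x))\<^sup>2 \<le> (\<rho> powr (- (2 * s)) * (1 + x\<^sup>2) powr s) * (cmod (f x))\<^sup>2"
        by (intro mult_right_mono) auto
      then show ?thesis using True by (simp add: ennreal_mult'[symmetric] ennreal_leI mult.assoc)
    qed simp
  qed
  also have "\<dots> = ennreal (\<rho> powr (- (2 * s))) * ennreal (LINT x|lborel. (1 + x\<^sup>2) powr s * (cmod (f x))\<^sup>2)"
    by (simp add: nn_integral_cmult nn_integral_eq_integral[OF int])
  also have "\<dots> = ennreal (\<rho> powr (- (2 * s)) * (LINT x|lborel. (1 + x\<^sup>2) powr s * (cmod (f x))\<^sup>2))"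
    by (simp add: ennreal_mult'[symmetric])
  also have "\<rho> powr (- (2 * s)) * (LINT x|lborel. (1 + x\<^sup>2) powr s * (cmod (f x))\<^sup>2) = (\<rho> powr (- s) * wnorm s f)\<^sup>2"
  proof -
    have "0 \<le> (LINT x|lborel. (1 + x\<^sup>2) powr s * (cmod (f x))\<^sup>2)"
      by (intro Bochner_Integration.integral_nonneg) auto
    then show ?thesis
      by (simp add: wnorm_def power_mult_distrib power2_eq_square[of "_ powr _"] flip: powr_add)
  qed
  finally show ?thesis .
qed

text \<open>For j < K the piece \<open>F j\<close> is the transform of the part \<open>h j\<close>
  of the data in the annulus between t^(j/K) and t^((j+1)/K), with a ball for j = 0; the weight
  gains the inner radius to the power -s. The last piece, from |x| > t, is a remainder known through
  its L^2 norm alone.\<close>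

lemma fourier_annuli:
  assumes f: "in_L2s s f" and s: "0 \<le> s" and t: "1 \<le> t" and K: "0 < (K::nat)"
  shows "\<exists>F h. (\<forall>\<xi>. fourier f \<xi> = (\<Sum>j\<le>K. F j \<xi>)) \<and>
    (\<forall>j\<le>K. F j \<in> borel_measurable borel \<and>
       L2sq (F j) \<le> ennreal ((sqrt (4 * pi) * t powr (- (real j * s / real K)) * wnorm s f)\<^sup>2)) \<and>
    (\<forall>j<K. h j \<in> borel_measurable borel \<and>
       L2sq (h j) \<le> ennreal ((sqrt (4 * pi) * t powr (- (real j * s / real K)) * wnorm s f)\<^sup>2) \<and>
       (\<forall>x. t powr (real (Suc j) / real K) < \<bar>x\<bar> \<longrightarrow> h j x = 0) \<and>
       F j = (\<lambda>\<xi>. LINT y|lborel. cis (- y * \<xi>) * h j y))"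
proof -
  have fm[measurable]: "f \<in> borel_measurable borel" using f by (auto simp: in_L2s_def)
  \<comment> \<open>The interval [1, -1] is empty, so the innermost piece starts from the zero function.\<close>
  define r where "r j = (if j = 0 then -1 else t powr (real j / real K))" for j
  have r_mono: "r j \<le> r (Suc j)" for j
  proof (cases "j = 0")
    case True
    then show ?thesis by (simp add: r_def) (smt (verit) powr_ge_zero)
  next
    case False
    then show ?thesis using t K by (auto simp: r_def intro!: powr_mono divide_right_mono)
  qed
  have tail: "L2tail f (r j) \<le> ennreal ((t powr (- (real j * s / real K)) * wnorm s f)\<^sup>2)" for j
  proof -
    have "L2tail f (r j) \<le> ennreal (((t powr (real j / real K)) powr (- s) * wnorm s f)\<^sup>2)"
    proof (rule L2tail_le_wnorm[OF f s])
      show "0 < t powr (real j / real K)" using t by simp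
      show "(t powr (real j / real K))\<^sup>2 \<le> 1 + x\<^sup>2" if "r j < \<bar>x\<bar>" for x
      proof (cases "j = 0")
        case False
        then have "(t powr (real j / real K))\<^sup>2 \<le> \<bar>x\<bar>\<^sup>2"
          using that by (intro power_mono) (auto simp: r_def)
        then show ?thesis by simp
      qed (use t in simp)
    qed
    also have "(t powr (real j / real K)) powr (- s) = t powr (- (real j * s / real K))"
      by (simp add: powr_powr)
    finally show ?thesis .
  qed
  have fin: "L2sq f < \<infinity>"
  proof -
    have "L2sq f = L2tail f (r 0)" unfolding L2tail_def L2sq_def r_def by (intro nn_integral_cong) auto
    then show ?thesis using le_less_trans[OF tail[of 0]] by simp
  qed
  define v where "v j = sqrt (4 * pi) * t powr (- (real j * s / real K)) * wnorm s f" for j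
  have v: "ennreal (4 * pi) * L2tail f (r j) \<le> ennreal ((v j)\<^sup>2)" for j
  proof -
    have "ennreal (4 * pi) * L2tail f (r j) \<le> ennreal (4 * pi) * ennreal ((t powr (- (real j * s / real K)) * wnorm s f)\<^sup>2)"
      by (intro mult_left_mono tail) simp
    also have "\<dots> = ennreal ((v j)\<^sup>2)"
      by (simp add: ennreal_mult'[symmetric] v_def power_mult_distrib mult_ac)
    finally show ?thesis .
  qed
  \<comment> \<open>One number \<open>v j\<close> serves all pieces: the constant is 1 for
    \<open>h j\<close>, 2 pi for the transforms of annuli and 4 pi for the remainder.\<close>
  have small: "ennreal \<alpha> * L2tail f (r j) \<le> ennreal ((v j)\<^sup>2)" if "\<alpha> \<le> 4 * pi" for \<alpha> j
    using that by (intro order_trans[OF mult_right_mono v] ennreal_leI) auto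
  define F where "F j = (if j < K then (\<lambda>\<xi>. fourier_trunc f (r (Suc j)) \<xi> - fourier_trunc f (r j) \<xi>)
    else (\<lambda>\<xi>. fourier f \<xi> - fourier_trunc f (r K) \<xi>))" for j
  define h where "h j = (\<lambda>x. if r j < \<bar>x\<bar> \<and> \<bar>x\<bar> \<le> r (Suc j) then f x else 0)" for j
  have "fourier f \<xi> = (\<Sum>j\<le>K. F j \<xi>)" for \<xi>
  proof -
    have "(\<Sum>j\<le>K. F j \<xi>) = (\<Sum>j<K. F j \<xi>) + F K \<xi>"
      by (simp add: lessThan_Suc_atMost[symmetric])
    also have "(\<Sum>j<K. F j \<xi>) = (\<Sum>j<K. fourier_trunc f (r (Suc j)) \<xi> - fourier_trunc f (r j) \<xi>)"
      by (intro sum.cong) (auto simp: F_def)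
    also have "\<dots> = fourier_trunc f (r K) \<xi> - fourier_trunc f (r 0) \<xi>"
      by (rule sum_lessThan_telescope)
    also have "fourier_trunc f (r 0) \<xi> = 0"
      by (simp add: r_def fourier_trunc_def set_lebesgue_integral_def)
    finally show ?thesis by (simp add: F_def)
  qed
  moreover have "F j \<in> borel_measurable borel" for j
  proof -
    note [measurable] = fourier_spec(1)[OF fm fin]
    show ?thesis unfolding F_def by (cases "j < K") simp_all
  qed
  moreover have "L2sq (F j) \<le> ennreal ((v j)\<^sup>2)" if "j \<le> K" for j
  proof (cases "j < K")
    case True
    then show ?thesis
      using order_trans[OF L2sq_fourier_trunc_diff[OF fm fin r_mono] small[of "2 * pi" j]] by (simp add: F_def)
  next
    case False
    then have "j = K" using that by simp
    then show ?thesis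
      using order_trans[OF L2sq_fourier_tail[OF fm fin] v] by (simp add: F_def)
  qed
  moreover have "h j \<in> borel_measurable borel" for j unfolding h_def by measurable
  moreover have "L2sq (h j) \<le> ennreal ((v j)\<^sup>2)" for j
  proof -
    have "L2sq (h j) \<le> L2tail f (r j)" unfolding L2tail_def h_def by (rule L2sq_mono) auto
    also have "\<dots> \<le> ennreal ((v j)\<^sup>2)" using small[of 1 j] pi_ge_two by simp
    finally show ?thesis .
  qed
  moreover have "h j x = 0" if "t powr (real (Suc j) / real K) < \<bar>x\<bar>" for j x
    using that by (simp add: h_def r_def)
  moreover have "F j = (\<lambda>\<xi>. LINT y|lborel. cis (- y * \<xi>) * h j y)" if "j < K" for j
    unfolding F_def h_def using that fourier_trunc_diff(1)[OF fm fin r_mono] by simp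
  ultimately show ?thesis unfolding v_def by (intro exI[of _ F] exI[of _ h] conjI allI impI)
qed

section \<open>Interpolation in L^q and sums of finitely many pieces\<close>

lemma nn_integral_powr_interpolate:
  fixes u :: "real \<Rightarrow> complex"
  assumes [measurable]: "u \<in> borel_measurable borel" and p: "2 \<le> p"
    and sup: "\<And>x. cmod (u x) \<le> A" and L2: "L2sq u \<le> ennreal (B\<^sup>2)"
  shows "(\<integral>\<^sup>+ x. ennreal (cmod (u x) powr p) \<partial>lborel) \<le> ennreal (A powr (p - 2) * B\<^sup>2)"
proof -
  have "(\<integral>\<^sup>+ x. ennreal (cmod (u x) powr p) \<partial>lborel) \<le> (\<integral>\<^sup>+ x. ennreal (A powr (p - 2)) * ennreal ((cmod (u x))\<^sup>2) \<partial>lborel)"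
  proof (rule nn_integral_mono)
    fix x
    have "cmod (u x) powr p \<le> A powr (p - 2) * (cmod (u x))\<^sup>2"
    proof (cases "u x = 0")
      case False
      have "cmod (u x) powr p = cmod (u x) powr (p - 2) * (cmod (u x))\<^sup>2"
        using powr_add[of "cmod (u x)" "p - 2" 2] by simp
      also have "\<dots> \<le> A powr (p - 2) * (cmod (u x))\<^sup>2"
        using False p sup[of x] by (auto intro!: mult_mono powr_mono2)
      finally show ?thesis .
    qed simp
    then show "ennreal (cmod (u x) powr p) \<le> ennreal (A powr (p - 2)) * ennreal ((cmod (u x))\<^sup>2)"
      by (simp add: ennreal_mult'[symmetric] ennreal_leI)
  qed
  also have "\<dots> = ennreal (A powr (p - 2)) * L2sq u"
    unfolding L2sq_def by (rule nn_integral_cmult) measurable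
  also have "\<dots> \<le> ennreal (A powr (p - 2)) * ennreal (B\<^sup>2)"
    by (intro mult_left_mono L2) simp
  finally show ?thesis by (simp add: ennreal_mult'[symmetric])
qed

text \<open>Every term is replaced by the largest. The constant is far from optimal, but the number
  of terms is fixed by delta.\<close>

lemma powr_sum_le:
  fixes y :: "'i \<Rightarrow> real"
  assumes I: "finite I" and y: "\<And>i. i \<in> I \<Longrightarrow> 0 \<le> y i" and p: "0 < p"
  shows "(\<Sum>i\<in>I. y i) powr p \<le> real (card I) powr p * (\<Sum>i\<in>I. y i powr p)"
proof (cases "I = {}")
  case False
  define Y where "Y = Max (y ` I)"
  have "Y \<in> y ` I" unfolding Y_def using I False by (intro Max_in) auto
  then obtain i0 where i0: "i0 \<in> I" "Y = y i0" by auto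
  have "(\<Sum>i\<in>I. y i) \<le> real (card I) * y i0"
    using I i0 by (intro sum_bounded_above) (auto simp: i0(2)[symmetric] Y_def)
  then have "(\<Sum>i\<in>I. y i) powr p \<le> (real (card I) * y i0) powr p"
    using y p by (intro powr_mono2 sum_nonneg) auto
  also have "\<dots> = real (card I) powr p * y i0 powr p"
    using y[OF i0(1)] by (intro powr_mult)
  also have "\<dots> \<le> real (card I) powr p * (\<Sum>i\<in>I. y i powr p)"
    using I i0 by (intro mult_left_mono member_le_sum) auto
  finally show ?thesis .
qed simp

text \<open>A coarse substitute for Minkowski's inequality, with n^2 in place of n for n pieces of
  size at most \<open>E\<close>. The solution enters through \<open>w\<close>, which is only
  compared in modulus with the sum, so the factor -i needs no treatment.\<close>

lemma Lq_norm_sum_le_finite: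
  fixes u :: "'i \<Rightarrow> real \<Rightarrow> complex"
  assumes I: "finite I" "I \<noteq> {}" and u[measurable]: "\<And>i. i \<in> I \<Longrightarrow> u i \<in> borel_measurable borel"
    and p: "1 \<le> p" and E: "0 \<le> E" "\<And>i. i \<in> I \<Longrightarrow> (\<integral>\<^sup>+ x. ennreal (cmod (u i x) powr p) \<partial>lborel) \<le> ennreal (E powr p)"
    and w[measurable]: "w \<in> borel_measurable borel" and wu: "\<And>x. cmod (w x) \<le> cmod (\<Sum>i\<in>I. u i x)"
  shows "Lq_norm (ereal p) w \<le> ennreal ((real (card I))\<^sup>2 * E)"
proof -
  define n where "n = real (card I)"
  have n: "1 \<le> n" unfolding n_def using I by (simp add: Suc_leI card_gt_0_iff)
  have "(\<integral>\<^sup>+ x. ennreal (cmod (w x) powr p) \<partial>lborel) \<le> (\<integral>\<^sup>+ x. ennreal (n powr p) * (\<Sum>i\<in>I. ennreal (cmod (u i x) powr p)) \<partial>lborel)"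
  proof (rule nn_integral_mono)
    fix x
    have "cmod (w x) \<le> (\<Sum>i\<in>I. cmod (u i x))"
      using wu[of x] norm_sum[of "\<lambda>i. u i x" I] by linarith
    then have "cmod (w x) powr p \<le> (\<Sum>i\<in>I. cmod (u i x)) powr p"
      using p by (intro powr_mono2) auto
    also have "\<dots> \<le> n powr p * (\<Sum>i\<in>I. cmod (u i x) powr p)"
      unfolding n_def using I p by (intro powr_sum_le) auto
    finally show "ennreal (cmod (w x) powr p) \<le> ennreal (n powr p) * (\<Sum>i\<in>I. ennreal (cmod (u i x) powr p))"
      by (subst sum_ennreal) (auto simp: ennreal_mult'[symmetric] intro!: ennreal_leI sum_nonneg)
  qed
  also have "\<dots> = ennreal (n powr p) * (\<integral>\<^sup>+ x. (\<Sum>i\<in>I. ennreal (cmod (u i x) powr p)) \<partial>lborel)"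
    by (rule nn_integral_cmult) measurable
  also have "(\<integral>\<^sup>+ x. (\<Sum>i\<in>I. ennreal (cmod (u i x) powr p)) \<partial>lborel) = (\<Sum>i\<in>I. \<integral>\<^sup>+ x. ennreal (cmod (u i x) powr p) \<partial>lborel)"
    by (rule nn_integral_sum) measurable
  also have "ennreal (n powr p) * (\<Sum>i\<in>I. \<integral>\<^sup>+ x. ennreal (cmod (u i x) powr p) \<partial>lborel) \<le> ennreal (n powr p) * (\<Sum>i\<in>I. ennreal (E powr p))"
    by (intro mult_left_mono sum_mono E) auto
  also have "\<dots> = ennreal (n powr p * (n * E powr p))"
    by (subst sum_ennreal) (auto simp: n_def ennreal_mult'[symmetric])
  also have "\<dots> \<le> ennreal ((n\<^sup>2 * E) powr p)"
  proof (rule ennreal_leI)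
    \<comment> \<open>One factor n^p comes from \<open>powr_sum_le\<close> and a factor n from
      adding the n integrals; since p >= 1 the latter is at most another n^p.\<close>
    have "n \<le> n powr p" using n p powr_mono[of 1 p n] by simp
    then have "n powr p * (n * E powr p) \<le> n powr p * (n powr p * E powr p)"
      by (intro mult_left_mono mult_right_mono) auto
    also have "\<dots> = (n\<^sup>2 * E) powr p"
      using n E by (simp add: powr_mult power2_eq_square mult.assoc)
    finally show "n powr p * (n * E powr p) \<le> (n\<^sup>2 * E) powr p" .
  qed
  finally have le: "(\<integral>\<^sup>+ x. ennreal (cmod (w x) powr p) \<partial>lborel) \<le> ennreal ((n\<^sup>2 * E) powr p)" .
  have int: "integrable lborel (\<lambda>x. cmod (w x) powr p)"
    by (rule integrableI_bounded) (use le_less_trans[OF le] in auto)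
  have "ennreal (LINT x|lborel. cmod (w x) powr p) \<le> ennreal ((n\<^sup>2 * E) powr p)"
    using le by (simp add: nn_integral_eq_integral[OF int])
  then have "(LINT x|lborel. cmod (w x) powr p) \<le> (n\<^sup>2 * E) powr p" by (simp add: ennreal_le_iff)
  then have "(LINT x|lborel. cmod (w x) powr p) powr (1 / p) \<le> ((n\<^sup>2 * E) powr p) powr (1 / p)"
    using p by (intro powr_mono2 Bochner_Integration.integral_nonneg) auto
  also have "\<dots> = n\<^sup>2 * E" using p n E by (simp add: powr_powr)
  finally show ?thesis using int by (simp add: Lq_norm_def n_def ennreal_leI)
qed

lemma Lq_norm_infinity_le:
  assumes "\<And>x. cmod (w x) \<le> E"
  shows "Lq_norm \<infinity> w \<le> ennreal E"
  unfolding Lq_norm_def using assms by (auto intro!: Inf_lower ennreal_leI)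

context interaction
begin

lemma duhamel_measurable:
  assumes "F \<in> borel_measurable borel" "G \<in> borel_measurable borel"
    and "L2sq F < \<infinity>" "L2sq G < \<infinity>" "A \<in> sets borel" "A \<subseteq> {0..t}"
  shows "duhamel F G t A \<in> borel_measurable borel"
proof -
  note [measurable] = fiber_measurable[OF assms(1,2,5), of t]
  have "duhamel F G t A = (\<lambda>x. LINT \<zeta>|lborel. cis (x * \<zeta>) * fiber F G t A \<zeta>)"
    using duhamel_fiber[OF assms] by auto
  also have "\<dots> \<in> borel_measurable borel" by measurable
  finally show ?thesis .
qed

lemma duhamel_time_integrable:
  assumes "F \<in> borel_measurable borel" "G \<in> borel_measurable borel"
    and "L2sq F < \<infinity>" "L2sq G < \<infinity>" "A \<in> sets borel" "A \<subseteq> {0..t}"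
  shows "integrable lborel (\<lambda>\<tau>. indicator A \<tau> *\<^sub>R (LINT p|lborel. integrand F G t x \<tau> p))"
  using lborel_pair.integrable_fst[OF duhamel_integrable[OF assms, of x]] by simp

lemma duhamel_split:
  assumes FG: "F \<in> borel_measurable borel" "G \<in> borel_measurable borel"
    and fin: "L2sq F < \<infinity>" "L2sq G < \<infinity>" and T: "0 \<le> T" "T \<le> t"
  shows "duhamel F G t {0..t} x = duhamel F G t {0..T} x + duhamel F G t {T<..t} x"
proof -
  have ind: "indicator {0..t} \<tau> = indicator {0..T} \<tau> + (indicator {T<..t} \<tau> :: real)" for \<tau>
    using T by (auto simp: indicator_def)
  have "{0..T} \<in> sets borel" "{0..T} \<subseteq> {0..t}" "{T<..t} \<in> sets borel" "{T<..t} \<subseteq> {0..t}"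
    using T by auto
  note ints = duhamel_time_integrable[OF FG fin this(1,2), of x] duhamel_time_integrable[OF FG fin this(3,4), of x]
  show ?thesis
    unfolding duhamel_def set_lebesgue_integral_def ind scaleR_add_left
    by (rule Bochner_Integration.integral_add[OF ints])
qed

lemma duhamel_double_sum:
  assumes F: "\<And>j. j \<in> J \<Longrightarrow> F j \<in> borel_measurable borel" "\<And>j. j \<in> J \<Longrightarrow> L2sq (F j) < \<infinity>"
    and G: "\<And>j. j \<in> J \<Longrightarrow> G j \<in> borel_measurable borel" "\<And>j. j \<in> J \<Longrightarrow> L2sq (G j) < \<infinity>"
    and t: "0 \<le> t" and Fs: "\<And>\<xi>. F' \<xi> = (\<Sum>j\<in>J. F j \<xi>)" and Gs: "\<And>\<xi>. G' \<xi> = (\<Sum>j\<in>J. G j \<xi>)"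
  shows "duhamel F' G' t {0..t} x = (\<Sum>i\<in>J \<times> J. duhamel (F (fst i)) (G (snd i)) t {0..t} x)"
proof -
  have eq: "integrand F' G' t x \<tau> p = (\<Sum>i\<in>J \<times> J. integrand (F (fst i)) (G (snd i)) t x \<tau> p)" for \<tau> p
  proof -
    obtain \<xi> \<eta> where p: "p = (\<xi>, \<eta>)" by force
    define k where "k = cis (x * (\<xi> + \<eta>)) * cis ((t - \<tau>) * a (\<xi> + \<eta>)) * cis (\<tau> * b \<xi>) * cis (\<tau> * c \<eta>) * m (\<xi>, \<eta>)"
    have k: "integrand F G t x \<tau> p = k * (F \<xi> * G \<eta>)" for F G
      by (simp add: integrand_def p k_def mult_ac)
    have "(\<Sum>j\<in>J. F j \<xi>) * (\<Sum>j\<in>J. G j \<eta>) = (\<Sum>i\<in>J \<times> J. F (fst i) \<xi> * G (snd i) \<eta>)"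
      by (simp add: sum_product sum.cartesian_product case_prod_beta)
    then show ?thesis unfolding k Fs Gs by (simp only: sum_distrib_left)
  qed
  have sets: "{0..t} \<in> sets borel" "{0..t} \<subseteq> {0..t}" by auto
  have "(LINT p|lborel. integrand F' G' t x \<tau> p) = (\<Sum>i\<in>J \<times> J. LINT p|lborel. integrand (F (fst i)) (G (snd i)) t x \<tau> p)" for \<tau>
    unfolding eq using F G by (intro Bochner_Integration.integral_sum integrand_integrable) auto
  then have "duhamel F' G' t {0..t} x = (LINT \<tau>|lborel. (\<Sum>i\<in>J \<times> J. indicator {0..t} \<tau> *\<^sub>R (LINT p|lborel. integrand (F (fst i)) (G (snd i)) t x \<tau> p)))"
    unfolding duhamel_def set_lebesgue_integral_def by (simp add: scaleR_sum_right)
  also have "\<dots> = (\<Sum>i\<in>J \<times> J. (LINT \<tau>|lborel. indicator {0..t} \<tau> *\<^sub>R (LINT p|lborel. integrand (F (fst i)) (G (snd i)) t x \<tau> p)))"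
    using F G by (intro Bochner_Integration.integral_sum duhamel_time_integrable sets) auto
  finally show ?thesis unfolding duhamel_def set_lebesgue_integral_def .
qed

end

text \<open>The interpolated bound as a p-th power, for R = t^rho: the exponents (rho - theta/2)(p -
  2) and rho add up to p times rho (1 - 1/p) - (theta/2)(1 - 2/p).\<close>

lemma interpolated_bound_eq:
  fixes c R t \<rho> \<theta> p :: real
  assumes c: "0 \<le> c" and t: "1 \<le> t" and R: "R = t powr \<rho>" and p: "2 \<le> p"
  shows "(c * R * t powr (- \<theta> / 2)) powr (p - 2) * (c * sqrt R)\<^sup>2
    = (c * t powr (\<rho> * (1 - 1 / p) - \<theta> / 2 * (1 - 2 / p))) powr p"
proof (cases "c = 0")
  case False
  with c have c: "0 < c" by simp
  have e1: "(c * R * t powr (- \<theta> / 2)) powr (p - 2) = c powr (p - 2) * t powr ((\<rho> - \<theta> / 2) * (p - 2))"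
    using c t by (simp add: R powr_mult powr_powr mult.assoc flip: powr_add)
  have e2: "(c * sqrt R)\<^sup>2 = c powr 2 * t powr \<rho>"
    using c t by (simp add: R power_mult_distrib)
  have e3: "c powr (p - 2) * t powr ((\<rho> - \<theta> / 2) * (p - 2)) * (c powr 2 * t powr \<rho>)
      = (c powr (p - 2) * c powr 2) * (t powr ((\<rho> - \<theta> / 2) * (p - 2)) * t powr \<rho>)"
    by (simp only: mult_ac)
  have e4: "c powr (p - 2) * c powr 2 = c powr p"
    using powr_add[of c "p - 2" 2] by simp
  have e5: "t powr ((\<rho> - \<theta> / 2) * (p - 2)) * t powr \<rho> = (t powr (\<rho> * (1 - 1 / p) - \<theta> / 2 * (1 - 2 / p))) powr p"
  proof -
    have "(\<rho> - \<theta> / 2) * (p - 2) + \<rho> = (\<rho> * (1 - 1 / p) - \<theta> / 2 * (1 - 2 / p)) * p"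
      using p by (simp add: field_simps)
    then show ?thesis by (simp add: powr_powr flip: powr_add)
  qed
  show ?thesis unfolding e1 e2 e3 e4 e5
    by (subst powr_mult) (use c in simp_all)
qed (use p in simp)

text \<open>Of the two weight gains only that of the larger annulus is needed. With l = max j k / K
  the exponent is then, up to losses, l (1 - sigma - s) - (1/2 - sigma), linear in l on [0, 1]; its
  endpoint values are sigma - 1/2 and 1/2 - s. The losses are delta/2 for the width of an annulus
  and delta/2 for replacing theta by 1.\<close>

lemma piece_exponent_le:
  fixes \<sigma> s \<theta> \<delta> :: real and j k K :: nat
  assumes K: "0 < K" "1 / real K \<le> \<delta> / 2" and jk: "j \<le> K" "k \<le> K" and s: "0 \<le> s"
    and \<sigma>: "0 \<le> \<sigma>" "\<sigma> \<le> 1 / 2" and \<theta>: "\<theta> \<le> 1" "1 - \<theta> \<le> \<delta>"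
  shows "real (Suc (max j k)) / real K * (1 - \<sigma>) - \<theta> / 2 * (1 - 2 * \<sigma>) - real j * s / real K - real k * s / real K
    \<le> max (1 / 2 - s) (\<sigma> - 1 / 2) + \<delta>"
proof -
  define l where "l = real (max j k) / real K"
  have l: "0 \<le> l" "l \<le> 1" using K jk by (auto simp: l_def)
  have "real (max j k) * s \<le> real j * s + real k * s"
    using s by (auto simp: max_def)
  then have ls: "l * s \<le> real j * s / real K + real k * s / real K"
    using K(1) unfolding l_def by (simp add: divide_right_mono flip: add_divide_distrib)
  have lK: "real (Suc (max j k)) / real K = l + 1 / real K"
    by (simp add: l_def add_divide_distrib)
  have r: "1 / real K * (1 - \<sigma>) \<le> \<delta> / 2 * 1"
    using K \<sigma> \<theta> by (intro mult_mono) auto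
  have th: "(1 - \<theta>) / 2 * (1 - 2 * \<sigma>) \<le> \<delta> / 2 * 1"
    using \<sigma> \<theta> by (intro mult_mono) auto
  have lm: "l * (1 - \<sigma> - s) \<le> max 0 (1 - \<sigma> - s)"
    using l mult_left_le_one_le[of "1 - \<sigma> - s" l] mult_nonneg_nonpos[of l "1 - \<sigma> - s"]
    by (cases "0 \<le> 1 - \<sigma> - s") auto
  have mx: "max 0 (1 - \<sigma> - s) = max (1 / 2 - s) (\<sigma> - 1 / 2) + (1 / 2 - \<sigma>)"
    by (auto simp: max_def)
  have id: "(l + r) * (1 - \<sigma>) - \<theta> / 2 * (1 - 2 * \<sigma>) - x - y
      = l * (1 - \<sigma> - s) + r * (1 - \<sigma>) + (1 - \<theta>) / 2 * (1 - 2 * \<sigma>) - (1 / 2 - \<sigma>) + (l * s - x - y)" for r x y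
    by (simp add: field_simps)
  show ?thesis unfolding lK id using ls r th lm mx by linarith
qed

context interaction
begin

text \<open>The alternative $t \le R$ covers the outermost annulus, where no cutoff in time is made and the
  functions $f$ and $g$ play no role.\<close>

lemma duhamel_piece_bound:
  assumes \<theta>: "0 < \<theta>" "\<theta> < 1"
  shows "\<exists>C\<ge>0. \<forall>F G f g v w R t. F \<in> borel_measurable borel \<longrightarrow> G \<in> borel_measurable borel \<longrightarrow>
    L2sq F \<le> ennreal (v\<^sup>2) \<longrightarrow> L2sq G \<le> ennreal (w\<^sup>2) \<longrightarrow> 0 \<le> v \<longrightarrow> 0 \<le> w \<longrightarrow> 1 \<le> t \<longrightarrow> 1 \<le> R \<longrightarrow>
    t \<le> R \<or> (f \<in> borel_measurable borel \<and> g \<in> borel_measurable borel \<and>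
      L2sq f \<le> ennreal (v\<^sup>2) \<and> L2sq g \<le> ennreal (w\<^sup>2) \<and> (\<forall>x. R < \<bar>x\<bar> \<longrightarrow> f x = 0 \<and> g x = 0) \<and>
      F = (\<lambda>\<xi>. LINT y|lborel. cis (- y * \<xi>) * f y) \<and> G = (\<lambda>\<xi>. LINT y|lborel. cis (- y * \<xi>) * g y) \<and> t\<^sup>2 \<le> R ^ N) \<longrightarrow>
    (\<forall>x. cmod (duhamel F G t {0..t} x) \<le> C * R * t powr (- \<theta> / 2) * v * w) \<and>
    L2sq (duhamel F G t {0..t}) \<le> ennreal ((C * sqrt R * v * w)\<^sup>2)"
proof -
  obtain C1 where C1: "0 \<le> C1" and sup: "\<And>F G v w t T x. F \<in> borel_measurable borel \<Longrightarrow> G \<in> borel_measurable borel \<Longrightarrow>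
    L2sq F \<le> ennreal (v\<^sup>2) \<Longrightarrow> L2sq G \<le> ennreal (w\<^sup>2) \<Longrightarrow> 0 \<le> v \<Longrightarrow> 0 \<le> w \<Longrightarrow>
    0 < t \<Longrightarrow> 0 \<le> T \<Longrightarrow> T \<le> t / 2 \<or> T = t \<Longrightarrow>
    cmod (duhamel F G t {0..T} x) \<le> C1 * T * t powr (- \<theta> / 2) * v * w"
    using duhamel_sup_bound[OF \<theta>] by blast
  obtain C2 where C2: "0 \<le> C2" and L2: "\<And>F G v w t T. F \<in> borel_measurable borel \<Longrightarrow> G \<in> borel_measurable borel \<Longrightarrow>
    L2sq F \<le> ennreal (v\<^sup>2) \<Longrightarrow> L2sq G \<le> ennreal (w\<^sup>2) \<Longrightarrow> 0 \<le> T \<Longrightarrow> T \<le> t \<Longrightarrow>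
    L2sq (duhamel F G t {0..T}) \<le> ennreal ((C2 * sqrt T * v * w)\<^sup>2)"
    using duhamel_L2_bound by blast
  \<comment> \<open>One order of decay beyond \<open>N\<close> is requested, to cancel the factor R
    in the late bound; the other N powers are compared with t^2.\<close>
  obtain C3 where C3: "0 \<le> C3" and late: "\<And>f g v w R T t \<zeta>. f \<in> borel_measurable borel \<Longrightarrow> g \<in> borel_measurable borel \<Longrightarrow>
    L2sq f \<le> ennreal (v\<^sup>2) \<Longrightarrow> L2sq g \<le> ennreal (w\<^sup>2) \<Longrightarrow> 0 \<le> v \<Longrightarrow> 0 \<le> w \<Longrightarrow>
    \<forall>x. R < \<bar>x\<bar> \<longrightarrow> f x = 0 \<and> g x = 0 \<Longrightarrow> 0 < R \<Longrightarrow> 4 * R / \<epsilon> \<le> T \<Longrightarrow> T \<le> t \<Longrightarrow>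
    cmod (fiber (\<lambda>\<xi>. LINT y|lborel. cis (- y * \<xi>) * f y) (\<lambda>\<xi>. LINT y|lborel. cis (- y * \<xi>) * g y) t {T<..t} \<zeta>)
      \<le> C3 * t * R * v * w / T ^ Suc N"
    using fiber_late_bound[of "Suc N"] by blast
  \<comment> \<open>Packets of radius R are separated after time 4R / \<open>\<epsilon>\<close>. The
    maximum with 1 makes the cutoff time at least R, so that powers of it may be replaced by powers
    of R, and puts t <= R into the case t <= 2 K0 R.\<close>
  define K0 where "K0 = max 1 (4 / \<epsilon>)"
  have K0: "1 \<le> K0" "4 / \<epsilon> \<le> K0" by (auto simp: K0_def)
  define C where "C = 2 * K0 * C1 + 4 * L * C3 + 2 * (C2 * sqrt (2 * K0) + sqrt (8 * pi * L) * C3)"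
  have terms: "0 \<le> 2 * K0 * C1" "0 \<le> 4 * L * C3" "0 \<le> C2 * sqrt (2 * K0)" "0 \<le> sqrt (8 * pi * L) * C3"
    using K0 C1 C2 C3 L by auto
  have aux: "x \<le> x + y + 2 * (z + r) \<and> x + y \<le> x + y + 2 * (z + r) \<and> z \<le> x + y + 2 * (z + r) \<and>
      2 * (z + r) \<le> x + y + 2 * (z + r) \<and> 0 \<le> x + y + 2 * (z + r)"
    if "0 \<le> x" "0 \<le> y" "0 \<le> z" "0 \<le> r" for x y z r :: real
    using that by auto
  have Cge: "2 * K0 * C1 \<le> C" "2 * K0 * C1 + 4 * L * C3 \<le> C" "C2 * sqrt (2 * K0) \<le> C"
      "2 * (C2 * sqrt (2 * K0) + sqrt (8 * pi * L) * C3) \<le> C" and C0: "0 \<le> C"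
    unfolding C_def using aux[OF terms] by blast+
  have "(\<forall>x. cmod (duhamel F G t {0..t} x) \<le> C * R * t powr (- \<theta> / 2) * v * w) \<and>
    L2sq (duhamel F G t {0..t}) \<le> ennreal ((C * sqrt R * v * w)\<^sup>2)"
    if FG: "F \<in> borel_measurable borel" "G \<in> borel_measurable borel"
      and F: "L2sq F \<le> ennreal (v\<^sup>2)" and G: "L2sq G \<le> ennreal (w\<^sup>2)" and vw: "0 \<le> v" "0 \<le> w" and t: "1 \<le> t" and R: "1 \<le> R"
      and alt: "t \<le> R \<or> (f \<in> borel_measurable borel \<and> g \<in> borel_measurable borel \<and>
      L2sq f \<le> ennreal (v\<^sup>2) \<and> L2sq g \<le> ennreal (w\<^sup>2) \<and> (\<forall>x. R < \<bar>x\<bar> \<longrightarrow> f x = 0 \<and> g x = 0) \<and>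
      F = (\<lambda>\<xi>. LINT y|lborel. cis (- y * \<xi>) * f y) \<and> G = (\<lambda>\<xi>. LINT y|lborel. cis (- y * \<xi>) * g y) \<and> t\<^sup>2 \<le> R ^ N)"
    for F G f g v w R t
  proof -
    have fin: "L2sq F < \<infinity>" "L2sq G < \<infinity>"
      using le_less_trans[OF F] le_less_trans[OF G] by auto
    define P where "P = t powr (- \<theta> / 2)"
    have P0: "0 \<le> P" by (simp add: P_def)
    \<comment> \<open>Late times will contribute O(1/t), which the dispersive factor
      dominates.\<close>
    have tP: "1 / t \<le> P"
    proof -
      have "t powr (- 1) \<le> t powr (- \<theta> / 2)" using \<theta> t by (intro powr_mono) auto
      then show ?thesis using t by (simp add: P_def powr_minus_divide)
    qed
    show ?thesis
    proof (cases "t \<le> 2 * K0 * R")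
      case True
      \<comment> \<open>Here t is at most a multiple of R, and the bounds over the whole time
        interval already have the required form.\<close>
      have "cmod (duhamel F G t {0..t} x) \<le> C * R * P * v * w" for x
      proof -
        have "cmod (duhamel F G t {0..t} x) \<le> C1 * t * P * v * w"
          unfolding P_def using t by (intro sup FG F G vw) auto
        also have "\<dots> \<le> C1 * (2 * K0 * R) * P * v * w"
          using True C1 P0 vw by (intro mult_right_mono mult_left_mono)
        also have "\<dots> = (2 * K0 * C1) * (R * P * v * w)" by (simp add: mult_ac)
        also have "\<dots> \<le> C * (R * P * v * w)"
          using R P0 vw by (intro mult_right_mono Cge) auto
        finally show ?thesis by (simp add: mult_ac)
      qed
      moreover have "L2sq (duhamel F G t {0..t}) \<le> ennreal ((C * sqrt R * v * w)\<^sup>2)"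
      proof -
        have "C2 * sqrt t * v * w \<le> C2 * sqrt (2 * K0 * R) * v * w"
          using True C2 vw by (intro mult_right_mono mult_left_mono) auto
        also have "\<dots> = (C2 * sqrt (2 * K0)) * (sqrt R * v * w)" by (simp add: real_sqrt_mult mult_ac)
        also have "\<dots> \<le> C * (sqrt R * v * w)"
          using R vw by (intro mult_right_mono Cge) auto
        finally have "(C2 * sqrt t * v * w)\<^sup>2 \<le> (C * sqrt R * v * w)\<^sup>2"
          using C2 vw t by (intro power_mono) (auto simp: mult_ac)
        then show ?thesis
          using L2[OF FG F G, of t t] t by (auto intro: order_trans ennreal_leI)
      qed
      ultimately show ?thesis by (simp add: P_def)
    next
      case False
      \<comment> \<open>The margin 2 in the case distinction gives T <= t/2, as the sup bound for
        early times demands.\<close>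
      define T where "T = K0 * R"
      have RT: "R \<le> T" using K0 R by (simp add: T_def)
      have Tt: "T \<le> t / 2" using False by (simp add: T_def)
      have T: "0 < T" "0 \<le> T" "T \<le> t" using RT R Tt t by auto
      have T4: "4 * R / \<epsilon> \<le> T" using mult_right_mono[OF K0(2), of R] R by (simp add: T_def)
      have "\<not> t \<le> R" using RT Tt R by linarith
      with alt have f: "f \<in> borel_measurable borel" "g \<in> borel_measurable borel"
        "L2sq f \<le> ennreal (v\<^sup>2)" "L2sq g \<le> ennreal (w\<^sup>2)" "\<forall>x. R < \<bar>x\<bar> \<longrightarrow> f x = 0 \<and> g x = 0"
        and Feq: "F = (\<lambda>\<xi>. LINT y|lborel. cis (- y * \<xi>) * f y)" "G = (\<lambda>\<xi>. LINT y|lborel. cis (- y * \<xi>) * g y)"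
        and RN: "t\<^sup>2 \<le> R ^ N" by auto
      \<comment> \<open>The late bound carries t R in the numerator and at least R^(N+1) in the
        denominator; with t^2 <= R^N this leaves 1/t.\<close>
      define B where "B = C3 * (v * w) / t"
      have B0: "0 \<le> B" using C3 vw t by (simp add: B_def)
      have fib: "cmod (fiber F G t {T<..t} \<zeta>) \<le> B" for \<zeta>
      proof -
        have "cmod (fiber F G t {T<..t} \<zeta>) \<le> C3 * t * R * v * w / T ^ Suc N"
          unfolding Feq using R by (intro late f vw T4 T) auto
        also have "\<dots> \<le> C3 * t * R * v * w / R ^ Suc N"
          using RT R C3 t vw T by (intro divide_left_mono power_mono mult_nonneg_nonneg mult_pos_pos zero_less_power) auto
        also have "\<dots> = C3 * t * v * w / R ^ N" using R by simp
        also have "\<dots> \<le> C3 * t * v * w / t\<^sup>2"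
          using RN R C3 t vw by (intro divide_left_mono mult_nonneg_nonneg mult_pos_pos zero_less_power) auto
        also have "\<dots> = B" using t by (simp add: B_def power2_eq_square)
        finally show ?thesis .
      qed
      have A: "{T<..t} \<in> sets borel" "{T<..t} \<subseteq> {0..t}" using T by auto
      have A': "{0..T} \<in> sets borel" "{0..T} \<subseteq> {0..t}" using T by auto
      note late_b = duhamel_bounds_of_fiber_bound[OF FG fin A fib]
      have "cmod (duhamel F G t {0..t} x) \<le> C * R * P * v * w" for x
      proof -
        have "cmod (duhamel F G t {0..t} x) \<le> cmod (duhamel F G t {0..T} x) + cmod (duhamel F G t {T<..t} x)"
          unfolding duhamel_split[OF FG fin T(2,3)] by (rule norm_triangle_ineq)
        also have "\<dots> \<le> C1 * T * P * v * w + 4 * L * B"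
          unfolding P_def using t T Tt by (intro add_mono sup FG F G vw late_b(1)) auto
        also have "\<dots> \<le> (2 * K0 * C1) * (R * P * v * w) + (4 * L * C3) * (R * P * v * w)"
        proof (rule add_mono)
          have "C1 * T * P * v * w = (K0 * C1) * (R * P * v * w)" by (simp add: T_def mult_ac)
          also have "\<dots> \<le> (2 * K0 * C1) * (R * P * v * w)"
            using C1 K0 R P0 vw by (intro mult_right_mono) auto
          finally show "C1 * T * P * v * w \<le> (2 * K0 * C1) * (R * P * v * w)" .
          have "1 / t \<le> R * P" using mult_mono[OF R tP] t R by simp
          then have "(4 * L * C3 * (v * w)) * (1 / t) \<le> (4 * L * C3 * (v * w)) * (R * P)"
            using L C3 vw by (intro mult_left_mono) auto
          then show "4 * L * B \<le> (4 * L * C3) * (R * P * v * w)" by (simp add: B_def mult_ac)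
        qed
        also have "\<dots> = (2 * K0 * C1 + 4 * L * C3) * (R * P * v * w)" by (simp add: distrib_right)
        also have "\<dots> \<le> C * (R * P * v * w)"
          using R P0 vw by (intro mult_right_mono Cge) auto
        finally show ?thesis by (simp add: mult_ac)
      qed
      moreover have "L2sq (duhamel F G t {0..t}) \<le> ennreal ((C * sqrt R * v * w)\<^sup>2)"
      proof -
        define X where "X = sqrt R * v * w"
        have X0: "0 \<le> X" using R vw by (simp add: X_def)
        have e1: "C2 * sqrt T * v * w \<le> (C2 * sqrt (2 * K0)) * X"
        proof -
          have "sqrt T \<le> sqrt (2 * K0) * sqrt R"
            unfolding real_sqrt_mult[symmetric] T_def using K0 R by simp
          then have "C2 * sqrt T * v * w \<le> C2 * (sqrt (2 * K0) * sqrt R) * v * w"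
            using C2 vw by (intro mult_right_mono mult_left_mono) auto
          then show ?thesis by (simp add: X_def mult_ac)
        qed
        have e2: "sqrt (8 * pi * L) * B \<le> (sqrt (8 * pi * L) * C3) * X"
        proof -
          have "1 / t \<le> 1" using t by simp
          also have "1 \<le> sqrt R" using R by simp
          finally have "(sqrt (8 * pi * L) * C3 * (v * w)) * (1 / t) \<le> (sqrt (8 * pi * L) * C3 * (v * w)) * sqrt R"
            using terms vw by (intro mult_left_mono) auto
          then show ?thesis by (simp add: X_def B_def mult_ac)
        qed
        have nn: "0 \<le> C2 * sqrt T * v * w" "0 \<le> sqrt (8 * pi * L) * B"
          using C2 vw T B0 L by auto
        have "L2sq (duhamel F G t {0..t}) = L2sq (\<lambda>x. duhamel F G t {0..T} x + duhamel F G t {T<..t} x)"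
          unfolding L2sq_def duhamel_split[OF FG fin T(2,3)] ..
        also have "\<dots> \<le> 2 * L2sq (duhamel F G t {0..T}) + 2 * L2sq (duhamel F G t {T<..t})"
          by (intro L2sq_add_le duhamel_measurable FG fin A A')
        also have "\<dots> \<le> 2 * ennreal ((C2 * sqrt T * v * w)\<^sup>2) + 2 * ennreal ((sqrt (8 * pi * L) * B)\<^sup>2)"
          by (intro add_mono mult_left_mono L2 FG F G T late_b(2)) auto
        also have "\<dots> = ennreal (2 * (C2 * sqrt T * v * w)\<^sup>2 + 2 * (sqrt (8 * pi * L) * B)\<^sup>2)"
          by (simp add: ennreal_plus ennreal_mult')
        also have "\<dots> \<le> ennreal ((2 * (C2 * sqrt T * v * w + sqrt (8 * pi * L) * B))\<^sup>2)"
        proof (rule ennreal_leI)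
          have "2 * y\<^sup>2 + 2 * z\<^sup>2 \<le> (2 * (y + z))\<^sup>2" if "0 \<le> y" "0 \<le> z" for y z :: real
            using mult_nonneg_nonneg[OF that] by (simp add: power2_eq_square algebra_simps)
          then show "2 * (C2 * sqrt T * v * w)\<^sup>2 + 2 * (sqrt (8 * pi * L) * B)\<^sup>2 \<le> (2 * (C2 * sqrt T * v * w + sqrt (8 * pi * L) * B))\<^sup>2"
            using nn by blast
        qed
        also have "\<dots> \<le> ennreal ((C * X)\<^sup>2)"
        proof (intro ennreal_leI power_mono)
          have "2 * (C2 * sqrt T * v * w + sqrt (8 * pi * L) * B) \<le> (2 * (C2 * sqrt (2 * K0) + sqrt (8 * pi * L) * C3)) * X"
            using e1 e2 by (simp add: distrib_right)
          also have "\<dots> \<le> C * X"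
            using X0 by (intro mult_right_mono Cge) auto
          finally show "2 * (C2 * sqrt T * v * w + sqrt (8 * pi * L) * B) \<le> C * X" .
        qed (use nn in simp)
        finally show ?thesis by (simp add: X_def mult_ac)
      qed
      ultimately show ?thesis by (simp add: P_def)
    qed
  qed
  then show ?thesis using C0 by blast
qed

text \<open>One exponent serves all s >= 0 and all q; the three regimes appear only in the theorem.
  The constant depends on \<open>\<theta>\<close> and \<open>K\<close>, hence on delta, but not on
  the data or on t.\<close>

lemma solution_decay:
  assumes s: "0 \<le> s" and q: "2 \<le> q" and \<delta>: "0 < \<delta>"
  shows "\<exists>C\<ge>0. \<forall>f g t. in_L2s s f \<longrightarrow> in_L2s s g \<longrightarrow> 1 \<le> t \<longrightarrow>
    Lq_norm q (sol a b c m f g t) \<le>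
      ennreal (C * t powr (max (1 / 2 - s) (qinv q - 1 / 2) + \<delta>) * wnorm s f * wnorm s g)"
proof -
  \<comment> \<open>The minimum keeps \<open>\<theta>\<close> positive when delta is large.\<close>
  define \<theta> where "\<theta> = 1 - min \<delta> (1 / 2)"
  have \<theta>: "0 < \<theta>" "\<theta> < 1" "1 - \<theta> \<le> \<delta>" using \<delta> by (auto simp: \<theta>_def)
  \<comment> \<open>The ratio t^(1/K) of consecutive radii is then at most t^(delta/2).\<close>
  obtain K :: nat where K: "2 / \<delta> < real K" using reals_Archimedean2 by blast
  have K0: "0 < K" using K \<delta> by (metis divide_pos_pos gr0I not_less_iff_gr_or_eq of_nat_0 order_less_trans zero_less_numeral)
  have K1: "1 / real K \<le> \<delta> / 2" using K K0 \<delta> by (simp add: field_simps)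
  have \<sigma>: "0 \<le> qinv q" "qinv q \<le> 1 / 2"
    using q by (cases q; simp add: qinv_def field_simps)+
  obtain C where C: "0 \<le> C" and piece: "\<And>F G f g v w R t. F \<in> borel_measurable borel \<Longrightarrow> G \<in> borel_measurable borel \<Longrightarrow>
    L2sq F \<le> ennreal (v\<^sup>2) \<Longrightarrow> L2sq G \<le> ennreal (w\<^sup>2) \<Longrightarrow> 0 \<le> v \<Longrightarrow> 0 \<le> w \<Longrightarrow> 1 \<le> t \<Longrightarrow> 1 \<le> R \<Longrightarrow>
    t \<le> R \<or> (f \<in> borel_measurable borel \<and> g \<in> borel_measurable borel \<and>
      L2sq f \<le> ennreal (v\<^sup>2) \<and> L2sq g \<le> ennreal (w\<^sup>2) \<and> (\<forall>x. R < \<bar>x\<bar> \<longrightarrow> f x = 0 \<and> g x = 0) \<and>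
      F = (\<lambda>\<xi>. LINT y|lborel. cis (- y * \<xi>) * f y) \<and> G = (\<lambda>\<xi>. LINT y|lborel. cis (- y * \<xi>) * g y) \<and> t\<^sup>2 \<le> R ^ (2 * K)) \<Longrightarrow>
    (\<forall>x. cmod (duhamel F G t {0..t} x) \<le> C * R * t powr (- \<theta> / 2) * v * w) \<and>
    L2sq (duhamel F G t {0..t}) \<le> ennreal ((C * sqrt R * v * w)\<^sup>2)"
    using duhamel_piece_bound[OF \<theta>(1,2), of "2 * K"] by blast
  define n where "n = real (card ({..K} \<times> {..K}))"
  have n1: "1 \<le> n" by (simp add: n_def card_cartesian_product)
  define \<nu> where "\<nu> = max (1 / 2 - s) (qinv q - 1 / 2) + \<delta>"
  have "Lq_norm q (sol a b c m f g t) \<le> ennreal ((n\<^sup>2 * (C * (4 * pi))) * t powr \<nu> * wnorm s f * wnorm s g)"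
    if f: "in_L2s s f" and g: "in_L2s s g" and t: "1 \<le> t" for f g t
  proof -
    define vf where "vf j = sqrt (4 * pi) * t powr (- (real j * s / real K)) * wnorm s f" for j
    define vg where "vg j = sqrt (4 * pi) * t powr (- (real j * s / real K)) * wnorm s g" for j
    have v0: "0 \<le> vf j" "0 \<le> vg j" for j by (simp_all add: vf_def vg_def wnorm_nonneg)
    obtain F hf where Fsum: "\<And>\<xi>. fourier f \<xi> = (\<Sum>j\<le>K. F j \<xi>)"
      and F: "\<And>j. j \<le> K \<Longrightarrow> F j \<in> borel_measurable borel" "\<And>j. j \<le> K \<Longrightarrow> L2sq (F j) \<le> ennreal ((vf j)\<^sup>2)"
      and hf: "\<And>j. j < K \<Longrightarrow> hf j \<in> borel_measurable borel" "\<And>j. j < K \<Longrightarrow> L2sq (hf j) \<le> ennreal ((vf j)\<^sup>2)"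
        "\<And>j x. j < K \<Longrightarrow> t powr (real (Suc j) / real K) < \<bar>x\<bar> \<Longrightarrow> hf j x = 0"
        "\<And>j. j < K \<Longrightarrow> F j = (\<lambda>\<xi>. LINT y|lborel. cis (- y * \<xi>) * hf j y)"
      using fourier_annuli[OF f s t K0] unfolding vf_def by blast
    obtain G hg where Gsum: "\<And>\<xi>. fourier g \<xi> = (\<Sum>j\<le>K. G j \<xi>)"
      and G: "\<And>j. j \<le> K \<Longrightarrow> G j \<in> borel_measurable borel" "\<And>j. j \<le> K \<Longrightarrow> L2sq (G j) \<le> ennreal ((vg j)\<^sup>2)"
      and hg: "\<And>j. j < K \<Longrightarrow> hg j \<in> borel_measurable borel" "\<And>j. j < K \<Longrightarrow> L2sq (hg j) \<le> ennreal ((vg j)\<^sup>2)"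
        "\<And>j x. j < K \<Longrightarrow> t powr (real (Suc j) / real K) < \<bar>x\<bar> \<Longrightarrow> hg j x = 0"
        "\<And>j. j < K \<Longrightarrow> G j = (\<lambda>\<xi>. LINT y|lborel. cis (- y * \<xi>) * hg j y)"
      using fourier_annuli[OF g s t K0] unfolding vg_def by blast
    have Ffin: "L2sq (F j) < \<infinity>" and Gfin: "L2sq (G j) < \<infinity>" if "j \<le> K" for j
      using le_less_trans[OF F(2)[OF that]] le_less_trans[OF G(2)[OF that]] by auto
    define W where "W = wnorm s f * wnorm s g"
    have W0: "0 \<le> W" by (simp add: W_def wnorm_nonneg)
    define E where "E = C * (4 * pi) * W * t powr \<nu>"
    have E0: "0 \<le> E" using C W0 by (simp add: E_def)
    define u where "u i = duhamel (F (fst i)) (G (snd i)) t {0..t}" for i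
    \<comment> \<open>R = t^rho is the outer radius of the larger annulus of the pair, which governs
      the time of separation. If the larger index is K, that annulus is unbounded, and R is merely a
      number above t.\<close>
    define \<rho> where "\<rho> i = real (Suc (max (fst i) (snd i))) / real K" for i
    define cc where "cc i = C * vf (fst i) * vg (snd i)" for i
    have cc0: "0 \<le> cc i" for i using C v0 by (simp add: cc_def)
    have scale: "cc i * t powr (\<rho> i * (1 - qinv q) - \<theta> / 2 * (1 - 2 * qinv q)) \<le> E" if i: "i \<in> {..K} \<times> {..K}" for i
    proof -
      obtain j k where jk: "i = (j, k)" "j \<le> K" "k \<le> K" using i by auto
      have "cc i * t powr (\<rho> i * (1 - qinv q) - \<theta> / 2 * (1 - 2 * qinv q))
        = C * (sqrt (4 * pi) * sqrt (4 * pi)) * W * (t powr (- (real j * s / real K)) * t powr (- (real k * s / real K)) *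
            t powr (\<rho> i * (1 - qinv q) - \<theta> / 2 * (1 - 2 * qinv q)))"
        by (simp only: cc_def vf_def vg_def W_def jk fst_conv snd_conv mult_ac)
      also have "\<dots> = C * (4 * pi) * W * t powr (\<rho> i * (1 - qinv q) - \<theta> / 2 * (1 - 2 * qinv q) - real j * s / real K - real k * s / real K)"
        by (simp add: algebra_simps flip: powr_add)
      also have "\<dots> \<le> E"
        unfolding E_def \<nu>_def \<rho>_def jk fst_conv snd_conv
        using C W0 t \<theta> by (intro mult_left_mono powr_mono piece_exponent_le K0 K1 jk s \<sigma>) auto
      finally show ?thesis .
    qed
    have bounds: "(\<forall>x. cmod (u i x) \<le> cc i * t powr (\<rho> i) * t powr (- \<theta> / 2)) \<and>
        L2sq (u i) \<le> ennreal ((cc i * sqrt (t powr (\<rho> i)))\<^sup>2)" if i: "i \<in> {..K} \<times> {..K}" for i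
    proof -
      obtain j k where jk: "i = (j, k)" "j \<le> K" "k \<le> K" using i by auto
      define R where "R = t powr (\<rho> i)"
      have R1: "1 \<le> R" using t by (simp add: R_def \<rho>_def ge_one_powr_ge_zero)
      have "(\<forall>x. cmod (duhamel (F j) (G k) t {0..t} x) \<le> C * R * t powr (- \<theta> / 2) * vf j * vg k) \<and>
        L2sq (duhamel (F j) (G k) t {0..t}) \<le> ennreal ((C * sqrt R * vf j * vg k)\<^sup>2)"
      proof (rule piece[where f = "hf j" and g = "hg k"])
        show "t \<le> R \<or> (hf j \<in> borel_measurable borel \<and> hg k \<in> borel_measurable borel \<and>
          L2sq (hf j) \<le> ennreal ((vf j)\<^sup>2) \<and> L2sq (hg k) \<le> ennreal ((vg k)\<^sup>2) \<and> (\<forall>x. R < \<bar>x\<bar> \<longrightarrow> hf j x = 0 \<and> hg k x = 0) \<and>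
          F j = (\<lambda>\<xi>. LINT y|lborel. cis (- y * \<xi>) * hf j y) \<and> G k = (\<lambda>\<xi>. LINT y|lborel. cis (- y * \<xi>) * hg k y) \<and> t\<^sup>2 \<le> R ^ (2 * K))"
        proof (cases "max j k < K")
          case False
          \<comment> \<open>The outermost pieces: R >= t, and the first alternative of
            \<open>piece\<close> applies, where no spatial support is asked for.\<close>
          then have "K \<le> Suc (max j k)" by linarith
          then have "real K \<le> real (Suc (max j k))" by (rule of_nat_mono)
          then have "1 \<le> \<rho> i" using K0 by (simp add: \<rho>_def jk del: of_nat_Suc)
          then have "t powr 1 \<le> R" unfolding R_def using t by (intro powr_mono) auto
          then show ?thesis using t by simp
        next
          case True
          then have jkK: "j < K" "k < K" by auto
          have mono: "t powr (real (Suc l) / real K) \<le> R" if "l \<le> max j k" for l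
            unfolding R_def \<rho>_def jk fst_conv snd_conv using t that by (intro powr_mono divide_right_mono) auto
          \<comment> \<open>Even the innermost pair has rho >= 1/K, because its ball has radius
            t^(1/K); this fixes the number 2K of powers.\<close>
          have "t\<^sup>2 \<le> R ^ (2 * K)"
          proof -
            have "t\<^sup>2 = t powr 2" using t by simp
            also have "\<dots> \<le> t powr (\<rho> i * real (2 * K))"
              using t K0 by (intro powr_mono) (auto simp: \<rho>_def)
            also have "\<dots> = R powr real (2 * K)" by (simp add: R_def powr_powr)
            also have "\<dots> = R ^ (2 * K)" using R1 by (intro powr_realpow) simp
            finally show ?thesis .
          qed
          moreover have "hf j x = 0 \<and> hg k x = 0" if "R < \<bar>x\<bar>" for x
            using that mono[of j] mono[of k] by (intro conjI hf(3) hg(3) jkK) auto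
          ultimately show ?thesis using jkK hf hg by blast
        qed
      qed (use F G jk v0 t R1 in auto)
      then show ?thesis by (simp add: u_def cc_def jk(1) R_def mult_ac)
    qed
    have um: "u i \<in> borel_measurable borel" if "i \<in> {..K} \<times> {..K}" for i
      unfolding u_def using that F G Ffin Gfin by (intro duhamel_measurable) auto
    have usum: "sol a b c m f g t x = - \<i> * (\<Sum>i\<in>{..K} \<times> {..K}. u i x)" for x
    proof -
      have "sol a b c m f g t x = - \<i> * duhamel (fourier f) (fourier g) t {0..t} x"
        unfolding sol_def duhamel_def integrand_def ..
      also have "duhamel (fourier f) (fourier g) t {0..t} x = (\<Sum>i\<in>{..K} \<times> {..K}. u i x)"
        unfolding u_def using F G Ffin Gfin t Fsum Gsum by (intro duhamel_double_sum) auto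
      finally show ?thesis .
    qed
    have le: "cmod (sol a b c m f g t x) \<le> cmod (\<Sum>i\<in>{..K} \<times> {..K}. u i x)" for x
      unfolding usum by (simp add: norm_mult)
    have solm: "sol a b c m f g t \<in> borel_measurable borel"
    proof -
      have "(\<lambda>x. - \<i> * (\<Sum>i\<in>{..K} \<times> {..K}. u i x)) \<in> borel_measurable borel"
        using um by (intro borel_measurable_times borel_measurable_sum) auto
      then show ?thesis unfolding usum[symmetric] .
    qed
    have "Lq_norm q (sol a b c m f g t) \<le> ennreal (n\<^sup>2 * E)"
    proof (cases "q = \<infinity>")
      case True
      then have q0: "qinv q = 0" by (simp add: qinv_def)
      have "cmod (sol a b c m f g t x) \<le> n\<^sup>2 * E" for x
      proof -
        have "cmod (u i x) \<le> E" if i: "i \<in> {..K} \<times> {..K}" for i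
        proof -
          have "cmod (u i x) \<le> cc i * t powr (\<rho> i) * t powr (- \<theta> / 2)" using bounds[OF i] by blast
          also have "\<dots> = cc i * t powr (\<rho> i * (1 - qinv q) - \<theta> / 2 * (1 - 2 * qinv q))"
            by (simp add: q0 mult.assoc flip: powr_add)
          also have "\<dots> \<le> E" by (rule scale[OF i])
          finally show ?thesis .
        qed
        then have "cmod (\<Sum>i\<in>{..K} \<times> {..K}. u i x) \<le> n * E"
          unfolding n_def by (intro sum_norm_bound)
        also have "\<dots> \<le> n\<^sup>2 * E"
          using n1 E0 by (intro mult_right_mono) (auto simp: power2_eq_square)
        finally show ?thesis using le[of x] by linarith
      qed
      then show ?thesis unfolding True by (rule Lq_norm_infinity_le)
    next
      case False
      with q obtain p where p: "q = ereal p" "2 \<le> p" by (cases q) auto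
      have qp: "qinv q = 1 / p" by (simp add: qinv_def p)
      show ?thesis unfolding p n_def
      proof (rule Lq_norm_sum_le_finite[OF _ _ um _ E0 _ solm le])
        fix i assume i: "i \<in> {..K} \<times> {..K}"
        have "(\<integral>\<^sup>+ x. ennreal (cmod (u i x) powr p) \<partial>lborel) \<le>
            ennreal ((cc i * t powr (\<rho> i) * t powr (- \<theta> / 2)) powr (p - 2) * (cc i * sqrt (t powr (\<rho> i)))\<^sup>2)"
          using bounds[OF i] by (intro nn_integral_powr_interpolate um[OF i] p(2)) auto
        also have "\<dots> = ennreal ((cc i * t powr (\<rho> i * (1 - qinv q) - \<theta> / 2 * (1 - 2 * qinv q))) powr p)"
          unfolding interpolated_bound_eq[OF cc0 t refl p(2)] qp by simp
        also have "\<dots> \<le> ennreal (E powr p)"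
          using p cc0 scale[OF i] by (intro ennreal_leI powr_mono2) auto
        finally show "(\<integral>\<^sup>+ x. ennreal (cmod (u i x) powr p) \<partial>lborel) \<le> ennreal (E powr p)" .
      qed (use p in auto)
    qed
    also have "n\<^sup>2 * E = (n\<^sup>2 * (C * (4 * pi))) * t powr \<nu> * wnorm s f * wnorm s g"
      by (simp add: E_def W_def mult_ac)
    finally show ?thesis .
  qed
  moreover have "0 \<le> n\<^sup>2 * (C * (4 * pi))" using C by simp
  ultimately show ?thesis unfolding \<nu>_def by blast
qed

end

text \<open>Compactness of the support turns the qualitative hypotheses into constants: a box, a
  bound for the symbol, and a positive minimum of |b' - c'|.\<close>

lemma interaction_of_hypotheses:
  assumes "smooth_fun a" "smooth_fun b" "smooth_fun c" and H: "hyp_H a"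
    and m: "smooth_symbol m" and K: "compact (supp m)"
    and nr: "\<forall>\<xi> \<eta>. (\<xi>, \<eta>) \<in> supp m \<longrightarrow>
      deriv (\<lambda>\<xi>'. phase a b c (\<xi>', \<eta>)) \<xi> - deriv (\<lambda>\<eta>'. phase a b c (\<xi>, \<eta>')) \<eta> \<noteq> 0"
  shows "\<exists>D L M \<kappa> \<epsilon>. interaction a b c m D L M \<kappa> \<epsilon>"
proof -
  have D1: "(h has_real_derivative deriv h x) (at x)" if "smooth_fun h" for h x
    using smooth_fun_DERIV[OF that, of 0 x] by simp
  note da = D1[OF assms(1)] and db = D1[OF assms(2)] and dc = D1[OF assms(3)]
  obtain \<kappa> where \<kappa>: "0 < \<kappa>" "\<forall>x. \<kappa> \<le> \<bar>deriv (deriv a) x\<bar>" using H by (auto simp: hyp_H_def)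
  from m obtain D :: "nat \<Rightarrow> nat \<Rightarrow> real \<times> real \<Rightarrow> complex" where D: "D 0 0 = m" "\<forall>j k. continuous_on UNIV (D j k)"
      "\<forall>j k x y. ((\<lambda>x'. D j k (x', y)) has_vector_derivative D (Suc j) k (x, y)) (at x) \<and>
                 ((\<lambda>y'. D j k (x, y')) has_vector_derivative D j (Suc k) (x, y)) (at y)"
    unfolding smooth_symbol_def by blast
  have in_supp: "p \<in> supp m" if "m p \<noteq> 0" for p
    unfolding supp_def using that closure_subset[of "{p. m p \<noteq> 0}"] by auto
  obtain L where L: "0 < L" "\<And>p. p \<in> supp m \<Longrightarrow> norm p \<le> L"
    using compact_imp_bounded[OF K] by (auto simp: bounded_pos)
  have Lm: "\<bar>\<xi>\<bar> \<le> L \<and> \<bar>\<eta>\<bar> \<le> L" if "m (\<xi>, \<eta>) \<noteq> 0" for \<xi> \<eta>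
    using L(2)[OF in_supp[OF that]] norm_fst_le[of \<xi> \<eta>] norm_snd_le[of \<eta> \<xi>] by auto
  have "continuous_on (supp m) m" using D(1,2) continuous_on_subset by blast
  then have "compact (m ` supp m)" using K by (rule compact_continuous_image)
  then obtain M where M: "0 < M" "\<And>p. p \<in> supp m \<Longrightarrow> cmod (m p) \<le> M"
    using compact_imp_bounded[of "m ` supp m"] by (auto simp: bounded_pos)
  have Mm: "cmod (m p) \<le> M" for p
    using M in_supp[of p] by (cases "m p = 0") auto
  \<comment> \<open>Both partial derivatives of the phase contain the same term -a'(xi + eta), which
    drops out of the difference.\<close>
  have nz: "deriv b \<xi> - deriv c \<eta> \<noteq> 0" if "(\<xi>, \<eta>) \<in> supp m" for \<xi> \<eta>
  proof -
    have e1: "deriv (\<lambda>\<xi>'. phase a b c (\<xi>', \<eta>)) \<xi> = - deriv a (\<xi> + \<eta>) + deriv b \<xi>"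
      unfolding phase_def prod.case
      by (rule DERIV_imp_deriv) (auto intro!: derivative_eq_intros DERIV_chain2[OF da] db)
    have e2: "deriv (\<lambda>\<eta>'. phase a b c (\<xi>, \<eta>')) \<eta> = - deriv a (\<xi> + \<eta>) + deriv c \<eta>"
      unfolding phase_def prod.case
      by (rule DERIV_imp_deriv) (auto intro!: derivative_eq_intros DERIV_chain2[OF da] dc)
    show ?thesis using nr[rule_format, OF that] unfolding e1 e2 by simp
  qed
  define \<beta> where "\<beta> p = \<bar>deriv b (fst p) - deriv c (snd p)\<bar>" for p
  have "continuous_on (supp m) \<beta>"
    unfolding \<beta>_def
    using smooth_fun_continuous_on[OF assms(2), of UNIV 1] smooth_fun_continuous_on[OF assms(3), of UNIV 1]
    by (auto intro!: continuous_intros continuous_on_compose2[of UNIV "deriv b"] continuous_on_compose2[of UNIV "deriv c"])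
  \<comment> \<open>The minimum is attained on a nonempty support; for the zero symbol any positive
    number will do.\<close>
  have "\<exists>\<epsilon>>0. \<forall>p\<in>supp m. \<epsilon> \<le> \<beta> p"
  proof (cases "supp m = {}")
    case False
    then obtain p0 where p0: "p0 \<in> supp m" "\<forall>p\<in>supp m. \<beta> p0 \<le> \<beta> p"
      using continuous_attains_inf[OF K False \<open>continuous_on (supp m) \<beta>\<close>] by blast
    have "0 < \<beta> p0" using nz[of "fst p0" "snd p0"] p0(1) by (simp add: \<beta>_def)
    with p0(2) show ?thesis by blast
  qed (auto intro: exI[of _ 1])
  then obtain \<epsilon> where \<epsilon>: "0 < \<epsilon>" "\<And>p. p \<in> supp m \<Longrightarrow> \<epsilon> \<le> \<beta> p" by blast
  have "interaction a b c m D L M \<kappa> \<epsilon>"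
    using assms(1-3) \<kappa> D K L(1) Lm M(1) Mm \<epsilon> by unfold_locales (auto simp: \<beta>_def)
  then show ?thesis by blast
qed

theorem theorem4p3:
  fixes a b c :: "real \<Rightarrow> real" and m :: "real \<times> real \<Rightarrow> complex"
    and q :: ereal and s :: real
  assumes "smooth_fun a" and "smooth_fun b" and "smooth_fun c"
    and "hyp_H a" and "hyp_H b" and "hyp_H c"
    and "smooth_symbol m" and "compact (supp m)"
    and "\<forall>\<xi> \<eta>. (\<xi>, \<eta>) \<in> supp m \<longrightarrow>
           deriv (\<lambda>\<xi>'. phase a b c (\<xi>', \<eta>)) \<xi> - deriv (\<lambda>\<eta>'. phase a b c (\<xi>, \<eta>')) \<eta> \<noteq> 0"
    and "2 \<le> q"
  shows
    "(0 \<le> s \<and> s < qinv q \<longrightarrow> (\<forall>\<delta>>0. \<exists>C. \<forall>f g t. in_L2s s f \<longrightarrow> in_L2s s g \<longrightarrow> 1 \<le> t \<longrightarrow>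
        Lq_norm q (sol a b c m f g t) \<le>
          ennreal (C * t powr (qinv q / 2 + 1/2 - 3/2 * s + \<delta>) * wnorm s f * wnorm s g)))
   \<and> (qinv q < s \<and> s < 1 - qinv q \<longrightarrow> (\<forall>\<delta>>0. \<exists>C. \<forall>f g t. in_L2s s f \<longrightarrow> in_L2s s g \<longrightarrow> 1 \<le> t \<longrightarrow>
        Lq_norm q (sol a b c m f g t) \<le>
          ennreal (C * t powr (1/2 - s + \<delta>) * wnorm s f * wnorm s g)))
   \<and> (1 - qinv q < s \<longrightarrow> (\<forall>\<delta>>0. \<exists>C. \<forall>f g t. in_L2s s f \<longrightarrow> in_L2s s g \<longrightarrow> 1 \<le> t \<longrightarrow>
        Lq_norm q (sol a b c m f g t) \<le>
          ennreal (C * t powr (qinv q - 1/2 + \<delta>) * wnorm s f * wnorm s g)))"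
proof -
  obtain D L M \<kappa> \<epsilon> where "interaction a b c m D L M \<kappa> \<epsilon>"
    using interaction_of_hypotheses[OF assms(1-4,7-9)] by blast
  then interpret interaction a b c m D L M \<kappa> \<epsilon> .
  have \<sigma>: "0 \<le> qinv q" "qinv q \<le> 1 / 2"
    using \<open>2 \<le> q\<close> by (cases q; simp add: qinv_def field_simps)+
  have decay: "\<exists>C. \<forall>f g t. in_L2s s f \<longrightarrow> in_L2s s g \<longrightarrow> 1 \<le> t \<longrightarrow>
      Lq_norm q (sol a b c m f g t) \<le> ennreal (C * t powr (e + \<delta>) * wnorm s f * wnorm s g)"
    if s: "0 \<le> s" and \<delta>: "0 < \<delta>" and e: "max (1 / 2 - s) (qinv q - 1 / 2) \<le> e" for e \<delta>
  proof -
    obtain C where C: "0 \<le> C" and bound: "\<And>f g t. in_L2s s f \<Longrightarrow> in_L2s s g \<Longrightarrow> 1 \<le> t \<Longrightarrow>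
        Lq_norm q (sol a b c m f g t) \<le>
          ennreal (C * t powr (max (1 / 2 - s) (qinv q - 1 / 2) + \<delta>) * wnorm s f * wnorm s g)"
      using solution_decay[OF s \<open>2 \<le> q\<close> \<delta>] by blast
    have "Lq_norm q (sol a b c m f g t) \<le> ennreal (C * t powr (e + \<delta>) * wnorm s f * wnorm s g)"
      if "in_L2s s f" "in_L2s s g" "1 \<le> t" for f g t
      using that e C
      by (intro order_trans[OF bound] ennreal_leI mult_right_mono mult_left_mono powr_mono wnorm_nonneg) auto
    then show ?thesis by blast
  qed
  show ?thesis
  proof (intro conjI impI allI)
    fix \<delta> :: real
    \<comment> \<open>The claimed exponent exceeds 1/2 - s by (1/q - s)/2, and 1/2 - s is the
      maximum because s < 1/q <= 1 - 1/q.\<close>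
    assume "0 \<le> s \<and> s < qinv q" "0 < \<delta>"
    then show "\<exists>C. \<forall>f g t. in_L2s s f \<longrightarrow> in_L2s s g \<longrightarrow> 1 \<le> t \<longrightarrow> Lq_norm q (sol a b c m f g t) \<le>
        ennreal (C * t powr (qinv q / 2 + 1/2 - 3/2 * s + \<delta>) * wnorm s f * wnorm s g)"
      using \<sigma> by (intro decay) auto
  next
    fix \<delta> :: real
    \<comment> \<open>The condition s < 1 - 1/q says that 1/2 - s is the larger of the two
      exponents.\<close>
    assume "qinv q < s \<and> s < 1 - qinv q" "0 < \<delta>"
    then show "\<exists>C. \<forall>f g t. in_L2s s f \<longrightarrow> in_L2s s g \<longrightarrow> 1 \<le> t \<longrightarrow> Lq_norm q (sol a b c m f g t) \<le>
        ennreal (C * t powr (1/2 - s + \<delta>) * wnorm s f * wnorm s g)"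
      using \<sigma> by (intro decay) auto
  next
    fix \<delta> :: real
    \<comment> \<open>Now 1/q - 1/2 is the larger exponent; s >= 0 follows from 1/q <= 1/2.\<close>
    assume "1 - qinv q < s" "0 < \<delta>"
    then show "\<exists>C. \<forall>f g t. in_L2s s f \<longrightarrow> in_L2s s g \<longrightarrow> 1 \<le> t \<longrightarrow> Lq_norm q (sol a b c m f g t) \<le>
        ennreal (C * t powr (qinv q - 1/2 + \<delta>) * wnorm s f * wnorm s g)"
      using \<sigma> by (intro decay) auto
  qed
qed

end
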